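(* Let $\Gamma$ be a $*$-semigroup that acts on the nonempty set $X$, let $\mathcal{H}$ be a VH-space over an admissible space $Z$, and let $\mathbf{k}\colon X\times X\to\mathcal{L}_c^*(\mathcal{H})$ be a kernel. Then the following assertions are equivalent: (1) $\mathbf{k}$ is positive semidefinite and invariant under the action of $\Gamma$ on $X$ (that is, $\mathbf{k}(y,\xi\cdot x)=\mathbf{k}(\xi^*\cdot y,x)$ for all $x,y\in X$, $\xi\in\Gamma$) and, in addition, the following two conditions hold: (b1) For any $\xi\in\Gamma$ and any $p\in S(Z)$ there exist $q\in S(Z)$ and a constant $c_p(\xi)\ge 0$ such that for all $n\in\mathbb{N}$, $h_1,\dots,h_n\in\mathcal{H}$, $x_1,\dots,x_n\in X$, $$p\Bigl(\sum_{i,j=1}^n[\mathbf{k}(\xi\cdot x_i,\xi\cdot x_j)h_j,h_i]_{\mathcal{H}}\Bigr)\le c_p(\xi)\,q\Bigl(\sum_{i,j=1}^n[\mathbf{k}(x_i,x_j)h_j,h_i]_{\mathcal{H}}\Bigr).$$ (b2) For any $x\in X$ and any $p\in S(Z)$ there exist $q\in S(Z)$ and a constant $c_p(x)\ge 0$ such that for all $n\in\mathbb{N}$, $y_1,\dots,y_n\in X$, $h_1,\dots,h_n\in\mathcal{H}$, $$p\Bigl(\sum_{i,j=1}^n[\mathbf{k}(x,y_i)h_i,\mathbf{k}(x,y_j)h_j]_{\mathcal{H}}\Bigr)\le c_p(x)\,q\Bigl(\sum_{i,j=1}^n[\mathbf{k}(y_j,y_i)h_i,h_j]_{\mathcal{H}}\Bigr).$$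 (2) $\mathbf{k}$ has a $\Gamma$-invariant VH-space linearisation $(\mathcal{K};\pi;V)$. (3) $\mathbf{k}$ admits an $\mathcal{H}$-reproducing kernel VH-space $\mathcal{R}$ and there exists a $*$-representation $\rho\colon\Gamma\to\mathcal{L}_c^*(\mathcal{R})$ such that $\rho(\xi)\mathbf{k}_xh=\mathbf{k}_{\xi\cdot x}h$ for all $\xi\in\Gamma$, $x\in X$, $h\in\mathcal{H}$. In addition, in case any of the assertions (1), (2), or (3) holds, a minimal $\Gamma$-invariant VH-space linearisation of $\mathbf{k}$ can be constructed, any minimal $\Gamma$-invariant VH-space linearisation of $\mathbf{k}$ is unique up to unitary equivalence, and the pair $(\mathcal{R};\rho)$ as in assertion (3) is uniquely determined by $\mathbf{k}$ as well.
   Context: An ordered $*$-space is a complex vector space $Z$ with a conjugate linear involution $z\mapsto z^*$ and a cone $Z^+$ (closed under linear combinations with nonnegative coefficients) that is strict ($Z^+\cap(-Z^+)=\{0\}$) and consists of selfadjoint elements; for selfadjoint $z_1,z_2$, $z_1\ge z_2$ means $z_1-z_2\in Z^+$. A seminorm $p$ on $Z$ is increasing if $0\le x\le y$ implies $p(x)\le p(y)$. $Z$ is topologically ordered if it is also a Hausdorff locally convex space whose topology is generated by a family of absolutely convex neighbourhoods $C$ of the origin that are solid ($x\in C$, $0\le y\le x$ imply $y\in C$); equivalently, its topology is defined by a family of increasing seminorms. $Z$ is an admissible space if, in addition, $Z^+$ is closed and $Z$ is complete. $S(Z)$ is the set of all continuous increasing seminorms on $Z$. A VE-space over an ordered $*$-space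 $Z$ is a complex vector space $\mathcal{E}$ with a map (gramian) $[\cdot,\cdot]\colon\mathcal{E}\times\mathcal{E}\to Z$, linear in the second variable, with $[x,y]=[y,x]^*$, $[x,x]\ge 0$, and $[x,x]=0$ iff $x=0$. If $Z$ is topologically ordered, $\mathcal{E}$ carries the Hausdorff locally convex topology generated by the seminorms $\tilde p(h)=p([h,h])^{1/2}$, $p\in S(Z)$. A VH-space over an admissible space $Z$ is a VE-space over $Z$ that is complete in this topology. A linear operator $T\colon\mathcal{E}\to\mathcal{F}$ between VE-spaces over the same $Z$ is adjointable if there is a (unique) linear $T^*\colon\mathcal{F}\to\mathcal{E}$ with $[Te,f]_{\mathcal{F}}=[e,T^*f]_{\mathcal{E}}$ for all $e\in\mathcal{E}$, $f\in\mathcal{F}$. For VH-spaces over the same $Z$, $\mathcal{L}_c^*(\mathcal{E},\mathcal{F})$ is the space of adjointable $T$ with both $T$ and $T^*$ continuous; $\mathcal{L}_c^*(\mathcal{E})=\mathcal{L}_c^*(\mathcal{E},\mathcal{E})$. A unitary operator is a linear bijection preserving gramians. A $*$-semigroup $\Gamma$ is a semigroup with an involution satisfying $(\xi\eta)^*=\eta^*\xi^*$, $(\xi^* )^*=\xi$. It acts on $X$ if $\alpha\cdot(\beta\cdot x)=(\alpha\beta)\cdot x$ for all $\alpha,\beta\in\Gamma$, $x\in X$. A $*$-representation is a multiplicative map $\pi$ with $\pi(\xi^* )=\pi(\xi)^*$. A kernel $\mathbf{k}$ is a map on $X\times X$ with operator values; it is Hermitian if $\mathbf{k}(x,y)=\mathbf{k}(y,x)^*$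 for all $x,y$, and positive semidefinite if $\sum_{i,j=1}^n[\mathbf{k}(x_i,x_j)h_j,h_i]_{\mathcal{H}}\ge 0$ for all $n\in\mathbb{N}$, $x_1,\dots,x_n\in X$, $h_1,\dots,h_n\in\mathcal{H}$. A VH-space linearisation of $\mathbf{k}$ is a pair $(\mathcal{K};V)$ with $\mathcal{K}$ a VH-space over $Z$ and $V\colon X\to\mathcal{L}_c^*(\mathcal{H},\mathcal{K})$ such that $\mathbf{k}(x,y)=V(x)^*V(y)$ for all $x,y\in X$; it is minimal if the linear span of $V(X)\mathcal{H}$ is dense in $\mathcal{K}$. Two VH-space linearisations $(\mathcal{K};V)$ and $(\mathcal{K}';V')$ of $\mathbf{k}$ are unitary equivalent if there is a unitary $U\colon\mathcal{K}\to\mathcal{K}'$ with $UV(x)=V'(x)$ for all $x\in X$. A $\Gamma$-invariant VH-space linearisation is a triple $(\mathcal{K};\pi;V)$ with $(\mathcal{K};V)$ a VH-space linearisation of $\mathbf{k}$, $\pi\colon\Gamma\to\mathcal{L}_c^*(\mathcal{K})$ a $*$-representation, and $V(\xi\cdot x)=\pi(\xi)V(x)$ for all $\xi\in\Gamma$, $x\in X$; it is minimal if $(\mathcal{K};V)$ is. For minimal triples, a unitary $U$ with $UV(x)=V'(x)$ for all $x\in X$ automatically satisfies $U\pi(\xi)=\pi'(\xi)U$ for all $\xi\in\Gamma$. $\mathcal{F}(X;\mathcal{H})$ is the vector space of all functions $X\to\mathcal{H}$, and $\mathbf{k}_xh=\mathbf{k}(\cdot,x)h$. An $\mathcal{H}$-reproducing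 kernel VH-space on $X$ with (Hermitian) kernel $\mathbf{k}\colon X\times X\to\mathcal{L}_c^*(\mathcal{H})$ is a VH-space $\mathcal{R}$ over $Z$ such that: $\mathcal{R}$ is a linear subspace of $\mathcal{F}(X;\mathcal{H})$; $\mathbf{k}_xh\in\mathcal{R}$ for all $x\in X$, $h\in\mathcal{H}$; $[f(x),h]_{\mathcal{H}}=[f,\mathbf{k}_xh]_{\mathcal{R}}$ for all $f\in\mathcal{R}$, $x\in X$, $h\in\mathcal{H}$; and each evaluation $\mathcal{R}\ni f\mapsto f(x)\in\mathcal{H}$, $x\in X$, is continuous.
   Formalization: Uniqueness of (R;ρ) fails in general, so it is proved for R in which the span of the k_x h is dense; moreover this minimal R lies, with the same gramian, in every R' as in (3), and for any two pairs as in (3) the representations agree on the intersection of the two spaces. *)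

theory Defs
  imports "HOL-Analysis.Analysis" "HOL-Library.Function_Algebras"
begin

section \<open>Complex vector spaces\<close>

class scaleC =
  fixes scaleC :: "complex \<Rightarrow> 'a \<Rightarrow> 'a"  (infixr \<open>*\<^sub>C\<close> 75)

class complex_vector = scaleC + ab_group_add +
  assumes scaleC_add_right: "a *\<^sub>C (x + y) = a *\<^sub>C x + a *\<^sub>C y"
    and scaleC_add_left: "(a + b) *\<^sub>C x = a *\<^sub>C x + b *\<^sub>C x"
    and scaleC_scaleC: "a *\<^sub>C b *\<^sub>C x = (a * b) *\<^sub>C x"
    and scaleC_one: "1 *\<^sub>C x = x"

global_interpretation complex_vector: vector_space "scaleC :: complex \<Rightarrow> 'a \<Rightarrow> 'a::complex_vector"
  defines csubspace = complex_vector.subspace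
    and cspan = complex_vector.span
  by unfold_locales (simp_all add: scaleC_add_right scaleC_add_left scaleC_scaleC scaleC_one)

text \<open>The space \<open>\<F>(X;\<H>)\<close> of all functions is the function type with pointwise operations.\<close>

instantiation "fun" :: (type, complex_vector) complex_vector
begin

definition "c *\<^sub>C f = (\<lambda>x. c *\<^sub>C f x)"

instance
  by standard
    (simp_all add: scaleC_fun_def fun_eq_iff scaleC_add_right scaleC_add_left scaleC_scaleC scaleC_one)

end

definition linear_op :: "'a::complex_vector set \<Rightarrow> 'b::complex_vector set \<Rightarrow> ('a \<Rightarrow> 'b) \<Rightarrow> bool" where
  "linear_op E F T \<longleftrightarrow> T ` E \<subseteq> F \<and>
     (\<forall>x\<in>E. \<forall>y\<in>E. T (x + y) = T x + T y) \<and> (\<forall>c. \<forall>x\<in>E. T (c *\<^sub>C x) = c *\<^sub>C T x)"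

definition seminorm :: "('a::complex_vector \<Rightarrow> real) \<Rightarrow> bool" where
  "seminorm p \<longleftrightarrow> (\<forall>x. 0 \<le> p x) \<and> (\<forall>x y. p (x + y) \<le> p x + p y) \<and>
     (\<forall>c x. p (c *\<^sub>C x) = cmod c * p x)"

definition (in complex_vector) absolutely_convex :: "'a set \<Rightarrow> bool" where
  "absolutely_convex C \<longleftrightarrow>
     (\<forall>x\<in>C. \<forall>y\<in>C. \<forall>a b. cmod a + cmod b \<le> 1 \<longrightarrow> a *\<^sub>C x + b *\<^sub>C y \<in> C)"

text \<open>Completeness of a linear topology on a subspace \<open>topspace T\<close>: every Cauchy filter
  (with respect to the translation-invariant uniformity) converges.\<close>

definition (in ab_group_add) complete_in :: "'a topology \<Rightarrow> bool" where
  "complete_in T \<longleftrightarrow>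
     (\<forall>F. F \<noteq> bot \<and> F \<le> principal (topspace T) \<and>
          (\<forall>U. openin T U \<and> 0 \<in> U \<longrightarrow> (\<forall>\<^sub>F (x, y) in F \<times>\<^sub>F F. x - y \<in> U))
        \<longrightarrow> (\<exists>l. limitin T (\<lambda>x. x) l F))"


section \<open>Ordered \<open>*\<close>-spaces, admissible spaces\<close>

class star =
  fixes star :: "'a \<Rightarrow> 'a"

text \<open>The cone is \<open>{z. 0 \<le> z}\<close>. The class \<open>ordered_ab_group_add\<close> says that
  \<open>x \<le> y \<longleftrightarrow> 0 \<le> y - x\<close> and that the cone is strict and closed under addition. The relation
  \<open>\<le>\<close> thereby makes sense for all elements, not only selfadjoint ones; it is used only
  in the form \<open>0 \<le> x \<le> y\<close>, which forces \<open>x\<close> and \<open>y\<close> to be selfadjoint.\<close>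

class ordered_star_space = complex_vector + star + ordered_ab_group_add +
  assumes star_add: "star (x + y) = star x + star y"
    and star_scaleC: "star (c *\<^sub>C x) = cnj c *\<^sub>C star x"
    and star_involution: "star (star x) = x"
    and scaleC_nonneg: "0 \<le> r \<Longrightarrow> 0 \<le> x \<Longrightarrow> 0 \<le> complex_of_real r *\<^sub>C x"
    and nonneg_selfadjoint: "0 \<le> x \<Longrightarrow> star x = x"

definition (in ordered_star_space) solid :: "'a set \<Rightarrow> bool" where
  "solid C \<longleftrightarrow> (\<forall>x\<in>C. \<forall>y. 0 \<le> y \<and> y \<le> x \<longrightarrow> y \<in> C)"

definition increasing_seminorm :: "('z::ordered_star_space \<Rightarrow> real) \<Rightarrow> bool" where
  "increasing_seminorm p \<longleftrightarrow> seminorm p \<and> (\<forall>x y. 0 \<le> x \<and> x \<le> y \<longrightarrow> p x \<le> p y)"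

class topologically_ordered_space = ordered_star_space + topological_ab_group_add + t2_space +
  assumes tendsto_scaleC_nhds:
      "((\<lambda>u. fst u *\<^sub>C snd u) \<longlongrightarrow> c *\<^sub>C x) (nhds c \<times>\<^sub>F nhds x)"
    and solid_neighbourhood_base:
      "open U \<Longrightarrow> 0 \<in> U \<Longrightarrow>
        \<exists>C V. open V \<and> 0 \<in> V \<and> V \<subseteq> C \<and> C \<subseteq> U \<and> absolutely_convex C \<and> solid C"

class admissible_space = topologically_ordered_space +
  assumes closed_cone: "closed {z. 0 \<le> z}"
    and complete_space: "complete_in (topology open)"

text \<open>\<open>S(Z)\<close>\<close>

definition cont_incr_seminorms :: "('z::topologically_ordered_space \<Rightarrow> real) set" where
  "cont_incr_seminorms = {p. increasing_seminorm p \<and> continuous_on UNIV p}"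


section \<open>VE-spaces and VH-spaces\<close>

text \<open>The underlying vector space is a linear subspace \<open>E\<close> of an ambient type, so that
  one can quantify existentially over spaces; the gramian is relevant only on \<open>E\<close>.\<close>

locale VE_space =
  fixes E :: "'e::complex_vector set" and gram :: "'e \<Rightarrow> 'e \<Rightarrow> 'z::ordered_star_space"
  assumes subspace: "csubspace E"
    and gram_add_right: "\<lbrakk>x \<in> E; y \<in> E; z \<in> E\<rbrakk> \<Longrightarrow> gram x (y + z) = gram x y + gram x z"
    and gram_scaleC_right: "\<lbrakk>x \<in> E; y \<in> E\<rbrakk> \<Longrightarrow> gram x (c *\<^sub>C y) = c *\<^sub>C gram x y"
    and gram_star: "\<lbrakk>x \<in> E; y \<in> E\<rbrakk> \<Longrightarrow> gram x y = star (gram y x)"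
    and gram_nonneg: "x \<in> E \<Longrightarrow> 0 \<le> gram x x"
    and gram_eq_0_iff: "x \<in> E \<Longrightarrow> gram x x = 0 \<longleftrightarrow> x = 0"

text \<open>The topology on \<open>E\<close> generated by the seminorms \<open>h \<mapsto> p([h,h])\<^sup>1\<^sup>/\<^sup>2\<close>, \<open>p \<in> S(Z)\<close>.\<close>

definition ve_topology ::
    "'e::complex_vector set \<Rightarrow> ('e \<Rightarrow> 'e \<Rightarrow> 'z::topologically_ordered_space) \<Rightarrow> 'e topology" where
  "ve_topology E gram = topology_generated_by
     {{y \<in> E. sqrt (p (gram (y - x) (y - x))) < e} | x p e. x \<in> E \<and> p \<in> cont_incr_seminorms \<and> 0 < e}"

locale VH_space = VE_space E gram
  for E :: "'e::complex_vector set" and gram :: "'e \<Rightarrow> 'e \<Rightarrow> 'z::admissible_space" +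
  assumes complete: "complete_in (ve_topology E gram)"

definition adjointable ::
    "'e::complex_vector set \<Rightarrow> ('e \<Rightarrow> 'e \<Rightarrow> 'z) \<Rightarrow> 'f::complex_vector set \<Rightarrow> ('f \<Rightarrow> 'f \<Rightarrow> 'z)
      \<Rightarrow> ('e \<Rightarrow> 'f) \<Rightarrow> bool" where
  "adjointable E gE F gF T \<longleftrightarrow> linear_op E F T \<and>
     (\<exists>T'. linear_op F E T' \<and> (\<forall>e\<in>E. \<forall>f\<in>F. gF (T e) f = gE e (T' f)))"

text \<open>The adjoint, meaningful on \<open>F\<close> for adjointable operators.\<close>

definition adjoint_op ::
    "'e::complex_vector set \<Rightarrow> ('e \<Rightarrow> 'e \<Rightarrow> 'z) \<Rightarrow> 'f::complex_vector set \<Rightarrow> ('f \<Rightarrow> 'f \<Rightarrow> 'z)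
      \<Rightarrow> ('e \<Rightarrow> 'f) \<Rightarrow> ('f \<Rightarrow> 'e)" where
  "adjoint_op E gE F gF T f = (THE e'. e' \<in> E \<and> (\<forall>e\<in>E. gF (T e) f = gE e e'))"

text \<open>\<open>\<L>\<^sub>c\<^sup>*(E,F)\<close>\<close>

definition cont_adjointable_ops ::
    "'e::complex_vector set \<Rightarrow> ('e \<Rightarrow> 'e \<Rightarrow> 'z::admissible_space)
      \<Rightarrow> 'f::complex_vector set \<Rightarrow> ('f \<Rightarrow> 'f \<Rightarrow> 'z) \<Rightarrow> ('e \<Rightarrow> 'f) set" where
  "cont_adjointable_ops E gE F gF =
     {T. adjointable E gE F gF T \<and>
         continuous_map (ve_topology E gE) (ve_topology F gF) T \<and>
         continuous_map (ve_topology F gF) (ve_topology E gE) (adjoint_op E gE F gF T)}"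

definition unitary_op ::
    "'e::complex_vector set \<Rightarrow> ('e \<Rightarrow> 'e \<Rightarrow> 'z) \<Rightarrow> 'f::complex_vector set \<Rightarrow> ('f \<Rightarrow> 'f \<Rightarrow> 'z)
      \<Rightarrow> ('e \<Rightarrow> 'f) \<Rightarrow> bool" where
  "unitary_op E gE F gF U \<longleftrightarrow> linear_op E F U \<and> bij_betw U E F \<and>
     (\<forall>x\<in>E. \<forall>y\<in>E. gF (U x) (U y) = gE x y)"


section \<open>\<open>*\<close>-semigroups, actions, representations\<close>

class star_semigroup = semigroup_mult + star +
  assumes star_mult: "star (x * y) = star y * star x"
    and star_star: "star (star x) = x"

definition is_action :: "('g::star_semigroup \<Rightarrow> 'x \<Rightarrow> 'x) \<Rightarrow> bool" where
  "is_action act \<longleftrightarrow> (\<forall>\<alpha> \<beta> x. act \<alpha> (act \<beta> x) = act (\<alpha> * \<beta>) x)"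

definition star_representation ::
    "'e::complex_vector set \<Rightarrow> ('e \<Rightarrow> 'e \<Rightarrow> 'z::admissible_space)
      \<Rightarrow> ('g::star_semigroup \<Rightarrow> 'e \<Rightarrow> 'e) \<Rightarrow> bool" where
  "star_representation E gE \<pi> \<longleftrightarrow>
     (\<forall>\<xi>. \<pi> \<xi> \<in> cont_adjointable_ops E gE E gE) \<and>
     (\<forall>\<xi> \<eta>. \<forall>f\<in>E. \<pi> (\<xi> * \<eta>) f = \<pi> \<xi> (\<pi> \<eta> f)) \<and>
     (\<forall>\<xi>. \<forall>f\<in>E. \<pi> (star \<xi>) f = adjoint_op E gE E gE (\<pi> \<xi>) f)"


section \<open>Kernels\<close>

text \<open>From here on \<open>\<H>\<close> is the whole type \<open>'h\<close> with gramian \<open>gH\<close>.\<close>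

definition hermitian_kernel ::
    "('h::complex_vector \<Rightarrow> 'h \<Rightarrow> 'z::ordered_star_space) \<Rightarrow> ('x \<Rightarrow> 'x \<Rightarrow> 'h \<Rightarrow> 'h) \<Rightarrow> bool" where
  "hermitian_kernel gH k \<longleftrightarrow> (\<forall>x y. k x y = adjoint_op UNIV gH UNIV gH (k y x))"

definition psd_kernel ::
    "('h::complex_vector \<Rightarrow> 'h \<Rightarrow> 'z::ordered_star_space) \<Rightarrow> ('x \<Rightarrow> 'x \<Rightarrow> 'h \<Rightarrow> 'h) \<Rightarrow> bool" where
  "psd_kernel gH k \<longleftrightarrow>
     (\<forall>(n::nat) (x :: nat \<Rightarrow> 'x) (h :: nat \<Rightarrow> 'h).
        0 \<le> (\<Sum>i<n. \<Sum>j<n. gH (k (x i) (x j) (h j)) (h i)))"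

definition invariant_kernel ::
    "('g::star_semigroup \<Rightarrow> 'x \<Rightarrow> 'x) \<Rightarrow> ('x \<Rightarrow> 'x \<Rightarrow> 'h \<Rightarrow> 'h) \<Rightarrow> bool" where
  "invariant_kernel act k \<longleftrightarrow> (\<forall>x y \<xi>. k y (act \<xi> x) = k (act (star \<xi>) y) x)"

definition cond_b1 ::
    "('g::star_semigroup \<Rightarrow> 'x \<Rightarrow> 'x) \<Rightarrow> ('h::complex_vector \<Rightarrow> 'h \<Rightarrow> 'z::admissible_space)
      \<Rightarrow> ('x \<Rightarrow> 'x \<Rightarrow> 'h \<Rightarrow> 'h) \<Rightarrow> bool" where
  "cond_b1 act gH k \<longleftrightarrow>
     (\<forall>\<xi>. \<forall>p\<in>cont_incr_seminorms. \<exists>q\<in>cont_incr_seminorms. \<exists>c\<ge>0.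
        \<forall>(n::nat) (h :: nat \<Rightarrow> 'h) (x :: nat \<Rightarrow> 'x).
          p (\<Sum>i<n. \<Sum>j<n. gH (k (act \<xi> (x i)) (act \<xi> (x j)) (h j)) (h i))
            \<le> c * q (\<Sum>i<n. \<Sum>j<n. gH (k (x i) (x j) (h j)) (h i)))"

definition cond_b2 ::
    "('h::complex_vector \<Rightarrow> 'h \<Rightarrow> 'z::admissible_space) \<Rightarrow> ('x \<Rightarrow> 'x \<Rightarrow> 'h \<Rightarrow> 'h) \<Rightarrow> bool" where
  "cond_b2 gH k \<longleftrightarrow>
     (\<forall>x. \<forall>p\<in>cont_incr_seminorms. \<exists>q\<in>cont_incr_seminorms. \<exists>c\<ge>0.
        \<forall>(n::nat) (y :: nat \<Rightarrow> 'x) (h :: nat \<Rightarrow> 'h).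
          p (\<Sum>i<n. \<Sum>j<n. gH (k x (y i) (h i)) (k x (y j) (h j)))
            \<le> c * q (\<Sum>i<n. \<Sum>j<n. gH (k (y j) (y i) (h i)) (h j)))"


section \<open>Linearisations\<close>

definition linearisation ::
    "('h::complex_vector \<Rightarrow> 'h \<Rightarrow> 'z::admissible_space) \<Rightarrow> ('x \<Rightarrow> 'x \<Rightarrow> 'h \<Rightarrow> 'h)
      \<Rightarrow> 'k::complex_vector set \<Rightarrow> ('k \<Rightarrow> 'k \<Rightarrow> 'z) \<Rightarrow> ('x \<Rightarrow> 'h \<Rightarrow> 'k) \<Rightarrow> bool" where
  "linearisation gH k K gK V \<longleftrightarrow> VH_space K gK \<and>
     (\<forall>x. V x \<in> cont_adjointable_ops UNIV gH K gK) \<and>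
     (\<forall>x y h. k x y h = adjoint_op UNIV gH K gK (V x) (V y h))"

definition minimal_linearisation ::
    "('h::complex_vector \<Rightarrow> 'h \<Rightarrow> 'z::admissible_space) \<Rightarrow> ('x \<Rightarrow> 'x \<Rightarrow> 'h \<Rightarrow> 'h)
      \<Rightarrow> 'k::complex_vector set \<Rightarrow> ('k \<Rightarrow> 'k \<Rightarrow> 'z) \<Rightarrow> ('x \<Rightarrow> 'h \<Rightarrow> 'k) \<Rightarrow> bool" where
  "minimal_linearisation gH k K gK V \<longleftrightarrow> linearisation gH k K gK V \<and>
     ve_topology K gK closure_of cspan {V x h | x h. True} = K"

definition invariant_linearisation ::
    "('g::star_semigroup \<Rightarrow> 'x \<Rightarrow> 'x) \<Rightarrow> ('h::complex_vector \<Rightarrow> 'h \<Rightarrow> 'z::admissible_space)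
      \<Rightarrow> ('x \<Rightarrow> 'x \<Rightarrow> 'h \<Rightarrow> 'h) \<Rightarrow> 'k::complex_vector set \<Rightarrow> ('k \<Rightarrow> 'k \<Rightarrow> 'z)
      \<Rightarrow> ('g \<Rightarrow> 'k \<Rightarrow> 'k) \<Rightarrow> ('x \<Rightarrow> 'h \<Rightarrow> 'k) \<Rightarrow> bool" where
  "invariant_linearisation act gH k K gK \<pi> V \<longleftrightarrow>
     linearisation gH k K gK V \<and> star_representation K gK \<pi> \<and>
     (\<forall>\<xi> x h. V (act \<xi> x) h = \<pi> \<xi> (V x h))"

definition minimal_invariant_linearisation ::
    "('g::star_semigroup \<Rightarrow> 'x \<Rightarrow> 'x) \<Rightarrow> ('h::complex_vector \<Rightarrow> 'h \<Rightarrow> 'z::admissible_space)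
      \<Rightarrow> ('x \<Rightarrow> 'x \<Rightarrow> 'h \<Rightarrow> 'h) \<Rightarrow> 'k::complex_vector set \<Rightarrow> ('k \<Rightarrow> 'k \<Rightarrow> 'z)
      \<Rightarrow> ('g \<Rightarrow> 'k \<Rightarrow> 'k) \<Rightarrow> ('x \<Rightarrow> 'h \<Rightarrow> 'k) \<Rightarrow> bool" where
  "minimal_invariant_linearisation act gH k K gK \<pi> V \<longleftrightarrow>
     invariant_linearisation act gH k K gK \<pi> V \<and> minimal_linearisation gH k K gK V"

text \<open>Unitary equivalence of triples. The intertwining condition on \<open>\<pi>\<close>, \<open>\<pi>'\<close> is automatic for
  minimal triples.\<close>

definition unitary_equivalent ::
    "'k::complex_vector set \<Rightarrow> ('k \<Rightarrow> 'k \<Rightarrow> 'z) \<Rightarrow> ('g \<Rightarrow> 'k \<Rightarrow> 'k) \<Rightarrow> ('x \<Rightarrow> 'h \<Rightarrow> 'k)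
      \<Rightarrow> 'l::complex_vector set \<Rightarrow> ('l \<Rightarrow> 'l \<Rightarrow> 'z) \<Rightarrow> ('g \<Rightarrow> 'l \<Rightarrow> 'l) \<Rightarrow> ('x \<Rightarrow> 'h \<Rightarrow> 'l)
      \<Rightarrow> bool" where
  "unitary_equivalent K gK \<pi> V K' gK' \<pi>' V' \<longleftrightarrow>
     (\<exists>U. unitary_op K gK K' gK' U \<and> (\<forall>x h. U (V x h) = V' x h) \<and>
          (\<forall>\<xi>. \<forall>f\<in>K. U (\<pi> \<xi> f) = \<pi>' \<xi> (U f)))"

text \<open>Existence of an invariant linearisation whose space lives in the type \<open>'k\<close>. HOL cannot
  quantify existentially over all types, but the type \<open>'x \<Rightarrow> 'h\<close> is always large enough to hold a
  linearisation, while consequences of having one are to be stated for arbitrary \<open>'k\<close>.\<close>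

definition has_invariant_linearisation ::
    "'k::complex_vector itself \<Rightarrow> ('g::star_semigroup \<Rightarrow> 'x \<Rightarrow> 'x)
      \<Rightarrow> ('h::complex_vector \<Rightarrow> 'h \<Rightarrow> 'z::admissible_space) \<Rightarrow> ('x \<Rightarrow> 'x \<Rightarrow> 'h \<Rightarrow> 'h) \<Rightarrow> bool" where
  "has_invariant_linearisation t act gH k \<longleftrightarrow>
     (\<exists>(K :: 'k set) gK \<pi> V. invariant_linearisation act gH k K gK \<pi> V)"


section \<open>Reproducing kernel VH-spaces\<close>

definition kernel_section :: "('x \<Rightarrow> 'x \<Rightarrow> 'h \<Rightarrow> 'h) \<Rightarrow> 'x \<Rightarrow> 'h \<Rightarrow> ('x \<Rightarrow> 'h)" where
  "kernel_section k x h = (\<lambda>y. k y x h)"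

definition reproducing_kernel_VH_space ::
    "('h::complex_vector \<Rightarrow> 'h \<Rightarrow> 'z::admissible_space) \<Rightarrow> ('x \<Rightarrow> 'x \<Rightarrow> 'h \<Rightarrow> 'h)
      \<Rightarrow> ('x \<Rightarrow> 'h) set \<Rightarrow> (('x \<Rightarrow> 'h) \<Rightarrow> ('x \<Rightarrow> 'h) \<Rightarrow> 'z) \<Rightarrow> bool" where
  "reproducing_kernel_VH_space gH k R gR \<longleftrightarrow>
     hermitian_kernel gH k \<and> VH_space R gR \<and>
     (\<forall>x h. kernel_section k x h \<in> R) \<and>
     (\<forall>f\<in>R. \<forall>x h. gH (f x) h = gR f (kernel_section k x h)) \<and>
     (\<forall>x. continuous_map (ve_topology R gR) (ve_topology UNIV gH) (\<lambda>f. f x))"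

definition invariant_rk_pair ::
    "('g::star_semigroup \<Rightarrow> 'x \<Rightarrow> 'x) \<Rightarrow> ('h::complex_vector \<Rightarrow> 'h \<Rightarrow> 'z::admissible_space)
      \<Rightarrow> ('x \<Rightarrow> 'x \<Rightarrow> 'h \<Rightarrow> 'h) \<Rightarrow> ('x \<Rightarrow> 'h) set \<Rightarrow> (('x \<Rightarrow> 'h) \<Rightarrow> ('x \<Rightarrow> 'h) \<Rightarrow> 'z)
      \<Rightarrow> ('g \<Rightarrow> ('x \<Rightarrow> 'h) \<Rightarrow> ('x \<Rightarrow> 'h)) \<Rightarrow> bool" where
  "invariant_rk_pair act gH k R gR \<rho> \<longleftrightarrow>
     reproducing_kernel_VH_space gH k R gR \<and> star_representation R gR \<rho> \<and>
     (\<forall>\<xi> x h. \<rho> \<xi> (kernel_section k x h) = kernel_section k (act \<xi> x) h)"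

text \<open>Unlike for Hilbert spaces, the functions \<open>k\<^sub>xh\<close> need not span a dense subspace of a
  reproducing kernel VH-space, so \<open>k\<close> alone does not determine the space. Take
  \<open>Z = \<H> = C[0,1]\<close> with \<open>[f,g] = cnj f * g\<close>, \<open>X\<close> a single point, and the kernel
  \<open>h \<mapsto> t\<^sup>2h\<close>. Both \<open>{t f | f \<in> C[0,1]}\<close> and \<open>{t f | f \<in> C[0,1], f(0) = 0}\<close> with
  \<open>[t f, t g] = cnj f * g\<close> are reproducing kernel VH-spaces with this kernel.
  Uniqueness of the space requires minimality.\<close>

definition minimal_invariant_rk_pair ::
    "('g::star_semigroup \<Rightarrow> 'x \<Rightarrow> 'x) \<Rightarrow> ('h::complex_vector \<Rightarrow> 'h \<Rightarrow> 'z::admissible_space)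
      \<Rightarrow> ('x \<Rightarrow> 'x \<Rightarrow> 'h \<Rightarrow> 'h) \<Rightarrow> ('x \<Rightarrow> 'h) set \<Rightarrow> (('x \<Rightarrow> 'h) \<Rightarrow> ('x \<Rightarrow> 'h) \<Rightarrow> 'z)
      \<Rightarrow> ('g \<Rightarrow> ('x \<Rightarrow> 'h) \<Rightarrow> ('x \<Rightarrow> 'h)) \<Rightarrow> bool" where
  "minimal_invariant_rk_pair act gH k R gR \<rho> \<longleftrightarrow>
     invariant_rk_pair act gH k R gR \<rho> \<and>
     ve_topology R gR closure_of cspan {kernel_section k x h | x h. True} = R"

end

theory Submission
  imports Defs
begin

text \<open>
  The implications are proved in the cycle kernel conditions \<open>\<Longrightarrow>\<close> reproducing kernel space
  \<open>\<Longrightarrow>\<close> linearisation \<open>\<Longrightarrow>\<close> kernel conditions. Two of them are short. If \<open>k(x,y) = V(x)\<^sup>* V(y)\<close>, then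
  the double sums of the kernel conditions are gramians \<open>[w,w]\<close> of vectors \<open>w = \<Sum> V(x\<^sub>i) h\<^sub>i\<close>, and the
  two boundedness conditions are the continuity of \<open>\<pi>(\<xi>)\<close> and of \<open>V(x)\<^sup>*\<close> on such vectors. A
  reproducing kernel space is itself a linearisation, with \<open>V(x) h = k\<^sub>x h\<close> and with evaluation at
  \<open>x\<close> as \<open>V(x)\<^sup>*\<close>.

  For the remaining implication, the span of the functions \<open>k\<^sub>x h\<close> carries the gramian
  \<open>[f, \<Sum> k\<^sub>y h] = \<Sum> [f(y), h]\<close>. The second boundedness condition says that evaluations are
  continuous, so Cauchy nets in the span converge pointwise, and the completion can be sought among
  functions. It is a space of functions because a Cauchy net \<open>u\<close> that tends to \<open>0\<close> pointwise
  tends to \<open>0\<close> (lemma \<open>approximates_zero\<close>): for a fixed \<open>a\<close> of the span close to the tail of the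
  net, \<open>[u,u]\<close> is close to \<open>[u,a]\<close>, and \<open>[u,a]\<close> tends to \<open>0\<close> by the reproducing property. By the
  invariance of \<open>k\<close>, the representation has to be \<open>f \<mapsto> f(\<xi>\<^sup>* \<cdot>)\<close>; the first boundedness condition makes it
  continuous on the span, hence on the completion.

  The same description of the completion gives the uniqueness statements. An element of a minimal
  reproducing kernel space is the limit of a net in the span; this net is Cauchy in any other
  reproducing kernel space of \<open>k\<close> and converges there to the same function, because evaluations are
  continuous. A minimal linearisation embeds into the functions by \<open>f \<mapsto> (x \<mapsto> V(x)\<^sup>* f)\<close>, and its image
  is the minimal reproducing kernel space, so two minimal linearisations are related by the
  composition of one embedding with the inverse of the other.

  Three features of the ordered setting shape the details. The topologies need not be metrizable, and
  nets indexed by \<open>S(Z)\<close> itself take the place of sequences (\<open>seminorm_filter\<close>). The Schwarz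
  inequality is replaced by \<open>p[x,y] \<le> 4 p[x,x]\<^sup>1\<^sup>/\<^sup>2 p[y,y]\<^sup>1\<^sup>/\<^sup>2\<close>, a consequence of polarization and of
  \<open>p\<close> being increasing (\<open>schwarz\<close>). The involution of \<open>Z\<close> need not be continuous, so symmetry of
  a limit of gramians is derived from positivity, which the closed cone preserves
  (\<open>gram_limit_star\<close>).
\<close>

section \<open>The seminorms that define the topology of an admissible space\<close>

lemma scaleC_zero_left [simp]: "0 *\<^sub>C (x::'a::complex_vector) = 0"
  by (rule complex_vector.scale_zero_left)

lemma seminorm_zero: "seminorm p \<Longrightarrow> p 0 = 0"
  unfolding seminorm_def by (metis mult_zero_left norm_zero scaleC_zero_left)

lemma seminorm_minus: "seminorm p \<Longrightarrow> p (- x) = p x"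
  unfolding seminorm_def
  by (metis complex_vector.scale_minus_left scaleC_one mult_1 norm_minus_cancel norm_one)

lemma seminorm_diff_le: "seminorm p \<Longrightarrow> p (x - y) \<le> p x + p y"
  by (metis (no_types, lifting) add_uminus_conv_diff seminorm_def seminorm_minus)

lemma seminorm_abs_diff_le:
  assumes "seminorm p" shows "\<bar>p x - p y\<bar> \<le> p (x - y)"
proof -
  have "p x \<le> p (x - y) + p y" "p y \<le> p (y - x) + p x"
    using assms unfolding seminorm_def by (metis diff_add_cancel)+
  moreover have "p (y - x) = p (x - y)"
    using seminorm_minus[OF assms, of "x - y"] by simp
  ultimately show ?thesis by linarith
qed

context
  fixes p :: "'z::topologically_ordered_space \<Rightarrow> real"
  assumes p: "p \<in> cont_incr_seminorms"
begin

lemma cis_seminorm: "seminorm p"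
  using p by (simp add: cont_incr_seminorms_def increasing_seminorm_def)

lemma cis_nonneg: "0 \<le> p x"
  using cis_seminorm by (simp add: seminorm_def)

lemma cis_add: "p (x + y) \<le> p x + p y"
  using cis_seminorm by (simp add: seminorm_def)

lemma cis_scaleC: "p (c *\<^sub>C x) = cmod c * p x"
  using cis_seminorm by (simp add: seminorm_def)

lemma cis_mono: "0 \<le> x \<Longrightarrow> x \<le> y \<Longrightarrow> p x \<le> p y"
  using p by (simp add: cont_incr_seminorms_def increasing_seminorm_def)

lemma cis_continuous: "continuous_on UNIV p"
  using p by (simp add: cont_incr_seminorms_def)

lemmas cis_zero = seminorm_zero[OF cis_seminorm]
lemmas cis_minus = seminorm_minus[OF cis_seminorm]
lemmas cis_diff = seminorm_diff_le[OF cis_seminorm]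

lemma cis_tendsto: "(z \<longlongrightarrow> w) F \<Longrightarrow> ((\<lambda>i. p (z i)) \<longlongrightarrow> p w) F"
  using cis_continuous by (metis UNIV_I continuous_on_def tendsto_compose)

lemma cis_scale:
  assumes c: "0 \<le> c" shows "(\<lambda>z. c * p z) \<in> cont_incr_seminorms"
  unfolding cont_incr_seminorms_def increasing_seminorm_def seminorm_def mem_Collect_eq
proof (intro conjI allI impI)
  fix x y a
  show "0 \<le> c * p x" using c cis_nonneg by simp
  show "c * p (x + y) \<le> c * p x + c * p y"
    using mult_left_mono[OF cis_add c, of x y] by (simp add: algebra_simps)
  show "c * p (a *\<^sub>C x) = cmod a * (c * p x)" by (simp add: cis_scaleC)
  show "c * p x \<le> c * p y" if "0 \<le> x \<and> x \<le> y" using that c by (simp add: cis_mono mult_left_mono)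
  show "continuous_on UNIV (\<lambda>z. c * p z)" by (intro continuous_intros cis_continuous)
qed

end

lemma cis_plus:
  assumes "p \<in> cont_incr_seminorms" "q \<in> cont_incr_seminorms"
  shows "(\<lambda>z. p z + q z) \<in> cont_incr_seminorms"
  unfolding cont_incr_seminorms_def increasing_seminorm_def seminorm_def mem_Collect_eq
proof (intro conjI allI impI)
  fix x y c
  show "0 \<le> p x + q x"
    using cis_nonneg[OF assms(1), of x] cis_nonneg[OF assms(2), of x] by linarith
  show "p (x + y) + q (x + y) \<le> p x + q x + (p y + q y)"
    using cis_add[OF assms(1), of x y] cis_add[OF assms(2), of x y] by linarith
  show "p (c *\<^sub>C x) + q (c *\<^sub>C x) = cmod c * (p x + q x)"
    by (simp add: cis_scaleC[OF assms(1)] cis_scaleC[OF assms(2)] algebra_simps)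
  show "p x + q x \<le> p y + q y" if "0 \<le> x \<and> x \<le> y"
    using that cis_mono[OF assms(1), of x y] cis_mono[OF assms(2), of x y] by linarith
  show "continuous_on UNIV (\<lambda>z. p z + q z)"
    using assms by (intro continuous_intros) (simp_all add: cis_continuous)
qed

lemma cis_const_zero: "(\<lambda>_. 0) \<in> cont_incr_seminorms"
  by (simp add: cont_incr_seminorms_def increasing_seminorm_def seminorm_def)

lemma tendsto_scaleC:
  fixes x :: "'a \<Rightarrow> 'z::topologically_ordered_space"
  assumes "(c \<longlongrightarrow> c0) F" "(x \<longlongrightarrow> x0) F"
  shows "((\<lambda>i. c i *\<^sub>C x i) \<longlongrightarrow> c0 *\<^sub>C x0) F"
proof -
  have "filterlim (\<lambda>i. (c i, x i)) (nhds c0 \<times>\<^sub>F nhds x0) F"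
    using assms by (rule filterlim_Pair)
  from filterlim_compose[OF tendsto_scaleC_nhds this] show ?thesis by simp
qed

lemma open_scaled_preimage:
  fixes V :: "'z::topologically_ordered_space set"
  assumes "open V" shows "open ((\<lambda>x. c *\<^sub>C x) -` V)"
proof -
  have "continuous_on UNIV (\<lambda>x. c *\<^sub>C x :: 'z)"
    unfolding continuous_on_def by (auto intro!: tendsto_scaleC tendsto_ident_at)
  with assms show ?thesis by (simp add: open_vimage)
qed

text \<open>The Minkowski functional of \<open>C\<close>.\<close>

definition gauge :: "'a::complex_vector set \<Rightarrow> 'a \<Rightarrow> real" where
  "gauge C z = Inf {t. 0 < t \<and> z \<in> (\<lambda>y. complex_of_real t *\<^sub>C y) ` C}"

lemma scaleC_mono:
  assumes "0 \<le> r" "x \<le> (y::'z::ordered_star_space)"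
  shows "complex_of_real r *\<^sub>C x \<le> complex_of_real r *\<^sub>C y"
proof -
  have "0 \<le> complex_of_real r *\<^sub>C (y - x)" using assms by (simp add: scaleC_nonneg)
  then show ?thesis by (simp add: complex_vector.scale_right_diff_distrib)
qed

text \<open>The gauge of a solid set is increasing, because \<open>0 \<le> x \<le> y\<close> puts \<open>x\<close> into every multiple of \<open>C\<close> that
  contains \<open>y\<close>. Hence \<open>S(Z)\<close> has enough members to generate the topology of \<open>Z\<close>.\<close>

lemma gauge_cont_incr_seminorm:
  fixes C :: "'z::topologically_ordered_space set"
  assumes V: "open V" "0 \<in> V" "V \<subseteq> C" and ac: "absolutely_convex C" and so: "solid C"
  shows "gauge C \<in> cont_incr_seminorms" "{z. gauge C z < 1} \<subseteq> C"
proof -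
  define A where "A z = {t. 0 < t \<and> z \<in> (\<lambda>y. complex_of_real t *\<^sub>C y) ` C}" for z :: 'z
  have g: "gauge C z = Inf (A z)" for z by (simp add: gauge_def A_def)
  have C0: "0 \<in> C" using V by auto
  have A_iff: "t \<in> A z \<longleftrightarrow> 0 < t \<and> complex_of_real (1 / t) *\<^sub>C z \<in> C" for t z
  proof (cases "0 < t")
    case True
    have 1: "z = complex_of_real t *\<^sub>C complex_of_real (1 / t) *\<^sub>C z"
      using True by simp
    have 2: "complex_of_real (1 / t) *\<^sub>C complex_of_real t *\<^sub>C y = y" for y :: 'z
      using True by simp
    have "complex_of_real (1 / t) *\<^sub>C z \<in> C" if "t \<in> A z"
    proof -
      from that obtain y where "y \<in> C" "z = complex_of_real t *\<^sub>C y" by (auto simp: A_def)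
      then show ?thesis by (simp only: 2)
    qed
    moreover have "t \<in> A z" if "complex_of_real (1 / t) *\<^sub>C z \<in> C"
      unfolding A_def using True that 1 by blast
    ultimately show ?thesis using True by blast
  qed (simp add: A_def)
  have bdd: "bdd_below (A z)" for z by (rule bdd_belowI[of _ 0]) (simp add: A_def less_imp_le)
  have ne: "A z \<noteq> {}" for z
  proof -
    have "((\<lambda>t. complex_of_real t *\<^sub>C z) \<longlongrightarrow> complex_of_real 0 *\<^sub>C z) (at_right 0)"
      by (intro tendsto_scaleC tendsto_of_real tendsto_ident_at tendsto_const)
    then have "eventually (\<lambda>t. complex_of_real t *\<^sub>C z \<in> V) (at_right 0)"
      using V by (auto dest: topological_tendstoD)
    moreover have "eventually (\<lambda>t::real. 0 < t) (at_right 0)"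
      by (simp add: eventually_at_right_less)
    ultimately have "eventually (\<lambda>t. complex_of_real t *\<^sub>C z \<in> V \<and> 0 < t) (at_right 0)"
      by (rule eventually_conj)
    then obtain t where "complex_of_real t *\<^sub>C z \<in> V" "0 < t"
      using eventually_happens' trivial_limit_at_right_real by blast
    then have "1 / t \<in> A z" using V by (auto simp: A_iff)
    then show ?thesis by auto
  qed
  have le: "gauge C z \<le> t" if "t \<in> A z" for t z
    unfolding g using that bdd by (rule cInf_lower)
  have less: "\<exists>t\<in>A z. t < s" if "gauge C z < s" for s z
    using that cInf_lessD[OF ne] unfolding g by metis
  have nonneg: "0 \<le> gauge C z" for z
    unfolding g using ne by (intro cInf_greatest) (auto simp: A_def)
  have add: "gauge C (z + w) \<le> gauge C z + gauge C w" for z w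
  proof (rule field_le_epsilon)
    fix e :: real assume "0 < e"
    then obtain t s where t: "t \<in> A z" "t < gauge C z + e / 2" and s: "s \<in> A w" "s < gauge C w + e / 2"
      using less[of z "gauge C z + e / 2"] less[of w "gauge C w + e / 2"] by auto
    have pos: "0 < t" "0 < s" using s t by (auto simp: A_def)
    have "cmod (complex_of_real (t / (t + s))) + cmod (complex_of_real (s / (t + s))) \<le> 1"
      using pos by (simp only: norm_of_real) (simp add: divide_simps)
    moreover have "complex_of_real (1 / t) *\<^sub>C z \<in> C" "complex_of_real (1 / s) *\<^sub>C w \<in> C"
      using t s A_iff by blast+
    ultimately have "complex_of_real (t / (t + s)) *\<^sub>C complex_of_real (1 / t) *\<^sub>C z
        + complex_of_real (s / (t + s)) *\<^sub>C complex_of_real (1 / s) *\<^sub>C w \<in> C"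
      using ac unfolding absolutely_convex_def by metis
    also have "complex_of_real (t / (t + s)) *\<^sub>C complex_of_real (1 / t) *\<^sub>C z
        + complex_of_real (s / (t + s)) *\<^sub>C complex_of_real (1 / s) *\<^sub>C w
        = complex_of_real (1 / (t + s)) *\<^sub>C (z + w)"
      using pos by (simp add: scaleC_add_right flip: of_real_mult)
    finally have "t + s \<in> A (z + w)" using pos by (simp add: A_iff)
    from le[OF this] t s show "gauge C (z + w) \<le> gauge C z + gauge C w + e" by linarith
  qed
  have zero: "gauge C 0 = 0"
  proof (rule antisym[OF field_le_epsilon nonneg])
    fix e :: real assume "0 < e"
    then have "e \<in> A 0" using C0 by (simp add: A_iff)
    from le[OF this] show "gauge C 0 \<le> 0 + e" by simp
  qed
  have scale_le: "gauge C (c *\<^sub>C z) \<le> cmod c * gauge C z" if c: "c \<noteq> 0" for c z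
  proof (rule field_le_epsilon)
    fix e :: real assume "0 < e"
    then have "gauge C z < gauge C z + e / cmod c" using c by simp
    then obtain t where t: "t \<in> A z" "t < gauge C z + e / cmod c" using less by blast
    then have pos: "0 < t" by (simp add: A_def)
    have "cmod (sgn c) + cmod 0 \<le> 1" using c by (simp add: norm_sgn)
    moreover have "complex_of_real (1 / t) *\<^sub>C z \<in> C" using t A_iff by blast
    ultimately have "sgn c *\<^sub>C complex_of_real (1 / t) *\<^sub>C z + 0 *\<^sub>C complex_of_real (1 / t) *\<^sub>C z \<in> C"
      using ac unfolding absolutely_convex_def by metis
    also have "sgn c *\<^sub>C complex_of_real (1 / t) *\<^sub>C z + 0 *\<^sub>C complex_of_real (1 / t) *\<^sub>C z
       = complex_of_real (1 / (cmod c * t)) *\<^sub>C c *\<^sub>C z"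
      using pos c by (simp add: sgn_eq field_simps)
    finally have "cmod c * t \<in> A (c *\<^sub>C z)" using pos c by (simp add: A_iff)
    from le[OF this] have "gauge C (c *\<^sub>C z) \<le> cmod c * t" .
    also have "\<dots> \<le> cmod c * (gauge C z + e / cmod c)" using t by (intro mult_left_mono) auto
    finally show "gauge C (c *\<^sub>C z) \<le> cmod c * gauge C z + e" using c by (simp add: distrib_left)
  qed
  have scale: "gauge C (c *\<^sub>C z) = cmod c * gauge C z" for c z
  proof (cases "c = 0")
    case False
    have "gauge C z = gauge C (inverse c *\<^sub>C c *\<^sub>C z)" using False by (simp)
    also have "\<dots> \<le> cmod (inverse c) * gauge C (c *\<^sub>C z)" using False by (intro scale_le) simp
    finally have "cmod c * gauge C z \<le> gauge C (c *\<^sub>C z)"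
      using False by (simp add: norm_inverse pos_le_divide_eq mult.commute divide_inverse_commute[symmetric])
    with scale_le[OF False, of z] show ?thesis by linarith
  qed (simp add: zero)
  have sn: "seminorm (gauge C)" using nonneg add scale by (simp add: seminorm_def)
  have mono: "gauge C x \<le> gauge C y" if "0 \<le> x" "x \<le> y" for x y
  proof (rule field_le_epsilon)
    fix e :: real assume "0 < e"
    then obtain t where t: "t \<in> A y" "t < gauge C y + e" using less[of y "gauge C y + e"] by auto
    then have pos: "0 < t" by (simp add: A_def)
    have "complex_of_real (1 / t) *\<^sub>C x \<le> complex_of_real (1 / t) *\<^sub>C y"
      "0 \<le> complex_of_real (1 / t) *\<^sub>C x"
      using pos that by (auto intro!: scaleC_mono scaleC_nonneg simp del: of_real_divide)
    moreover have "complex_of_real (1 / t) *\<^sub>C y \<in> C" using t A_iff by blast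
    ultimately have "complex_of_real (1 / t) *\<^sub>C x \<in> C" using so unfolding solid_def by metis
    then have "t \<in> A x" using A_iff pos by blast
    from le[OF this] t show "gauge C x \<le> gauge C y + e" by linarith
  qed
  have "continuous_on UNIV (gauge C)"
    unfolding continuous_on_def
  proof
    fix x :: 'z
    have "((\<lambda>y. gauge C y - gauge C x) \<longlongrightarrow> 0) (at x)"
      unfolding tendsto_iff
    proof (intro allI impI)
      fix e :: real assume e: "0 < e"
      \<comment> \<open>On \<open>?W\<close> the gauge is at most \<open>e / 2\<close>.\<close>
      let ?W = "(\<lambda>y. complex_of_real (2 / e) *\<^sub>C y) -` V"
      have W: "open ?W" "0 \<in> ?W" using V open_scaled_preimage by auto
      have "((\<lambda>y. y - x) \<longlongrightarrow> x - x) (at x)" by (intro tendsto_intros)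
      then have "eventually (\<lambda>y. y - x \<in> ?W) (at x)"
        using W by (auto dest!: topological_tendstoD simp del: vimage_eq)
      then show "eventually (\<lambda>y. dist (gauge C y - gauge C x) 0 < e) (at x)"
      proof eventually_elim
        case (elim y)
        then have "e / 2 \<in> A (y - x)" using e V by (auto simp: A_iff)
        from le[OF this] have "gauge C (y - x) < e" using e by simp
        with seminorm_abs_diff_le[OF sn, of y x] show ?case by simp
      qed
    qed
    from LIM_zero_cancel[OF this] show "(gauge C \<longlongrightarrow> gauge C x) (at x within UNIV)" .
  qed
  with sn mono show "gauge C \<in> cont_incr_seminorms"
    by (simp add: cont_incr_seminorms_def increasing_seminorm_def)
  show "{z. gauge C z < 1} \<subseteq> C"
  proof
    fix z assume "z \<in> {z. gauge C z < 1}"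
    then obtain t where t: "t \<in> A z" "t < 1" using less by blast
    then have pos: "0 < t" by (simp add: A_def)
    have "cmod (complex_of_real t) + cmod 0 \<le> 1" using t pos by simp
    moreover have "complex_of_real (1 / t) *\<^sub>C z \<in> C" using t A_iff by blast
    ultimately have "complex_of_real t *\<^sub>C complex_of_real (1 / t) *\<^sub>C z + 0 *\<^sub>C complex_of_real (1 / t) *\<^sub>C z \<in> C"
      using ac unfolding absolutely_convex_def by metis
    then show "z \<in> C" using pos by (simp)
  qed
qed

lemma seminorm_neighbourhood:
  fixes U :: "'z::topologically_ordered_space set"
  assumes "open U" "0 \<in> U"
  obtains p where "p \<in> cont_incr_seminorms" "{z. p z < 1} \<subseteq> U"
proof -
  obtain C V where "open V" "0 \<in> V" "V \<subseteq> C" "C \<subseteq> U" "absolutely_convex C" "solid C"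
    using solid_neighbourhood_base[OF assms] by auto
  with gauge_cont_incr_seminorm[of V C] that[of "gauge C"] show thesis by blast
qed

lemma tendsto_iff_seminorms:
  fixes z :: "'i \<Rightarrow> 'z::topologically_ordered_space"
  shows "(z \<longlongrightarrow> w) F \<longleftrightarrow> (\<forall>p\<in>cont_incr_seminorms. ((\<lambda>i. p (z i - w)) \<longlongrightarrow> 0) F)"
proof safe
  fix p :: "'z \<Rightarrow> real" assume p: "p \<in> cont_incr_seminorms" and "(z \<longlongrightarrow> w) F"
  then have "((\<lambda>i. z i - w) \<longlongrightarrow> w - w) F" by (intro tendsto_intros)
  from cis_tendsto[OF p this] show "((\<lambda>i. p (z i - w)) \<longlongrightarrow> 0) F"
    by (simp add: cis_zero[OF p])
next
  assume *: "\<forall>p\<in>cont_incr_seminorms. ((\<lambda>i. p (z i - w)) \<longlongrightarrow> 0) F"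
  show "(z \<longlongrightarrow> w) F"
  proof (rule topological_tendstoI)
    fix U :: "'z set" assume U: "open U" "w \<in> U"
    have "open ((\<lambda>x. x + w) -` U)"
      using U by (intro open_vimage continuous_intros)
    then obtain p where p: "p \<in> cont_incr_seminorms" "{z. p z < 1} \<subseteq> (\<lambda>x. x + w) -` U"
      using U seminorm_neighbourhood by (metis add_0 vimageI)
    have "eventually (\<lambda>i. p (z i - w) < 1) F" using * p(1) by (intro order_tendstoD(2)[of _ 0]) auto
    then show "eventually (\<lambda>i. z i \<in> U) F" by eventually_elim (use p in auto)
  qed
qed

lemma eq_zero_iff_seminorms:
  fixes w :: "'z::topologically_ordered_space"
  shows "w = 0 \<longleftrightarrow> (\<forall>p\<in>cont_incr_seminorms. p w = 0)"
proof
  assume *: "\<forall>p\<in>cont_incr_seminorms. p w = 0"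
  have "((\<lambda>n::nat. 0) \<longlongrightarrow> w) sequentially"
    unfolding tendsto_iff_seminorms by (simp add: cis_minus *)
  then show "w = 0" using LIMSEQ_unique tendsto_const by blast
qed (simp add: cis_zero)

text \<open>Here and below, a net is Cauchy if for every seminorm and radius it is eventually in some ball, whose
  centre may depend on both. This is equivalent to the condition with differences of two members of
  the net, and it needs no product filter.\<close>

lemma complete_admissible:
  fixes z :: "'i \<Rightarrow> 'z::admissible_space"
  assumes F: "F \<noteq> bot"
    and cauchy: "\<And>p e. p \<in> cont_incr_seminorms \<Longrightarrow> 0 < e \<Longrightarrow> \<exists>a. eventually (\<lambda>i. p (z i - a) < e) F"
  obtains w where "(z \<longlongrightarrow> w) F"
proof -
  let ?G = "filtermap z F"
  have "\<exists>l. limitin (topology open) (\<lambda>x::'z. x) l ?G"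
  proof (rule complete_space[unfolded complete_in_def, rule_format], intro conjI allI impI)
    show "?G \<noteq> bot" using F by (simp add: filtermap_bot_iff)
    show "?G \<le> principal (topspace (topology open))"
      by simp
    fix U :: "'z set" assume "openin (topology open) U \<and> 0 \<in> U"
    then have "open U" "0 \<in> U" by (auto simp flip: open_openin)
    then obtain p where p: "p \<in> cont_incr_seminorms" "{z. p z < 1} \<subseteq> U" by (rule seminorm_neighbourhood)
    obtain a where a: "eventually (\<lambda>i. p (z i - a) < 1 / 2) F" using cauchy[OF p(1), of "1/2"] by auto
    have "x - y \<in> U" if "p (x - a) < 1 / 2" "p (y - a) < 1 / 2" for x y
    proof -
      have "p ((x - a) - (y - a)) < 1" using that cis_diff[OF p(1), of "x - a" "y - a"] by linarith
      then show ?thesis using p by auto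
    qed
    then show "\<forall>\<^sub>F (x, y) in ?G \<times>\<^sub>F ?G. x - y \<in> U"
      unfolding eventually_prod_filter eventually_filtermap using a
      by (intro exI[of _ "\<lambda>x. p (x - a) < 1/2"]) auto
  qed
  then obtain l where "limitin euclidean (\<lambda>x::'z. x) l ?G" by auto
  then have "(z \<longlongrightarrow> l) F" by (simp add: limitin_canonical_iff filterlim_filtermap)
  then show thesis by (rule that)
qed

lemma nonneg_limit:
  fixes z :: "'i \<Rightarrow> 'z::admissible_space"
  assumes "F \<noteq> bot" "eventually (\<lambda>i. 0 \<le> z i) F" "(z \<longlongrightarrow> w) F" shows "0 \<le> w"
  using Lim_in_closed_set[OF closed_cone _ assms(1,3)] assms(2) by simp

text \<open>Sending every seminorm \<open>q\<close> to an element that is within distance \<open>1\<close> of a given point with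
  respect to \<open>q\<close> gives a net that converges to this
  point along this filter.\<close>

definition seminorm_filter :: "('z::topologically_ordered_space \<Rightarrow> real) filter" where
  "seminorm_filter = (INF p\<in>cont_incr_seminorms. principal {q \<in> cont_incr_seminorms. p \<le> q})"

lemma eventually_seminorm_filter:
  "eventually P seminorm_filter \<longleftrightarrow>
    (\<exists>p\<in>cont_incr_seminorms. \<forall>q\<in>cont_incr_seminorms. p \<le> q \<longrightarrow> P q)"
proof -
  have "eventually P seminorm_filter \<longleftrightarrow> (\<exists>p\<in>cont_incr_seminorms.
      eventually P (principal {q \<in> cont_incr_seminorms. p \<le> q}))"
    unfolding seminorm_filter_def
  proof (rule eventually_INF_base)
    show "cont_incr_seminorms \<noteq> {}" using cis_const_zero by blast
    fix a b :: "'a \<Rightarrow> real" assume ab: "a \<in> cont_incr_seminorms" "b \<in> cont_incr_seminorms"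
    have "a \<le> (\<lambda>z. a z + b z)" "b \<le> (\<lambda>z. a z + b z)"
      using ab cis_nonneg by (auto simp: le_fun_def)
    then show "\<exists>x\<in>cont_incr_seminorms. principal {q \<in> cont_incr_seminorms. x \<le> q}
        \<le> inf (principal {q \<in> cont_incr_seminorms. a \<le> q}) (principal {q \<in> cont_incr_seminorms. b \<le> q})"
      using cis_plus[OF ab] by (intro bexI[of _ "\<lambda>z. a z + b z"]) auto
  qed
  then show ?thesis by (auto simp: eventually_principal)
qed

lemma seminorm_filter_neq_bot: "seminorm_filter \<noteq> bot"
  unfolding trivial_limit_def eventually_seminorm_filter by auto

lemma eventually_le_seminorm_filter:
  "p \<in> cont_incr_seminorms \<Longrightarrow> eventually (\<lambda>q. q \<in> cont_incr_seminorms \<and> p \<le> q) seminorm_filter"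
  unfolding eventually_seminorm_filter by blast

section \<open>Seminorms and nets in VE-spaces\<close>

lemma star_zero: "star (0::'z::ordered_star_space) = 0"
  using star_add[of 0 "0::'z"] by simp

context VE_space
begin

lemma zero_mem: "0 \<in> E"
  by (rule complex_vector.subspace_0[OF subspace])

lemma add_mem: "x \<in> E \<Longrightarrow> y \<in> E \<Longrightarrow> x + y \<in> E"
  by (rule complex_vector.subspace_add[OF subspace])

lemma diff_mem: "x \<in> E \<Longrightarrow> y \<in> E \<Longrightarrow> x - y \<in> E"
  by (rule complex_vector.subspace_diff[OF subspace])

lemma minus_mem: "x \<in> E \<Longrightarrow> - x \<in> E"
  by (rule complex_vector.subspace_neg[OF subspace])

lemma scaleC_mem: "x \<in> E \<Longrightarrow> c *\<^sub>C x \<in> E"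
  by (rule complex_vector.subspace_scale[OF subspace])

lemma sum_mem: "(\<And>i. i \<in> I \<Longrightarrow> f i \<in> E) \<Longrightarrow> sum f I \<in> E"
  by (rule complex_vector.subspace_sum[OF subspace])

lemma gram_add_left: "\<lbrakk>x \<in> E; y \<in> E; z \<in> E\<rbrakk> \<Longrightarrow> gram (x + y) z = gram x z + gram y z"
  using gram_star[of "x + y" z] gram_star[of x z] gram_star[of y z]
  by (simp add: add_mem gram_add_right star_add)

lemma gram_scaleC_left: "\<lbrakk>x \<in> E; y \<in> E\<rbrakk> \<Longrightarrow> gram (c *\<^sub>C x) y = cnj c *\<^sub>C gram x y"
  using gram_star[of "c *\<^sub>C x" y] gram_star[of x y]
  by (simp add: scaleC_mem gram_scaleC_right star_scaleC)

lemma gram_zero_right: "x \<in> E \<Longrightarrow> gram x 0 = 0"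
  using gram_scaleC_right[of x 0 0] zero_mem by simp

lemma gram_zero_left: "x \<in> E \<Longrightarrow> gram 0 x = 0"
  using gram_scaleC_left[of 0 x 0] zero_mem by simp

lemma gram_diff_right: "\<lbrakk>x \<in> E; y \<in> E; z \<in> E\<rbrakk> \<Longrightarrow> gram x (y - z) = gram x y - gram x z"
  using gram_add_right[of x "y - z" z] by (simp add: diff_mem)

lemma gram_diff_left: "\<lbrakk>x \<in> E; y \<in> E; z \<in> E\<rbrakk> \<Longrightarrow> gram (x - y) z = gram x z - gram y z"
  using gram_add_left[of "x - y" y z] by (simp add: diff_mem)

lemma gram_sum_right:
  "\<lbrakk>x \<in> E; \<And>i. i \<in> I \<Longrightarrow> f i \<in> E\<rbrakk> \<Longrightarrow> gram x (sum f I) = (\<Sum>i\<in>I. gram x (f i))"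
  by (induction I rule: infinite_finite_induct) (simp_all add: gram_zero_right gram_add_right sum_mem)

lemma gram_sum_left:
  "\<lbrakk>x \<in> E; \<And>i. i \<in> I \<Longrightarrow> f i \<in> E\<rbrakk> \<Longrightarrow> gram (sum f I) x = (\<Sum>i\<in>I. gram (f i) x)"
  by (induction I rule: infinite_finite_induct) (simp_all add: gram_zero_left gram_add_left sum_mem)

lemmas gram_simps = gram_add_left gram_add_right gram_diff_left gram_diff_right
  gram_scaleC_left gram_scaleC_right

lemma gram_eqI:
  assumes "x \<in> E" "y \<in> E" "\<And>z. z \<in> E \<Longrightarrow> gram z x = gram z y" shows "x = y"
proof -
  have "gram (x - y) (x - y) = 0"
    using assms by (simp add: gram_diff_right diff_mem)
  then show ?thesis using assms gram_eq_0_iff[of "x - y"] by (simp add: diff_mem)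
qed

lemma gram_add_scaleC:
  assumes "x \<in> E" "y \<in> E"
  shows "gram (x + c *\<^sub>C y) (x + c *\<^sub>C y)
    = gram x x + c *\<^sub>C gram x y + cnj c *\<^sub>C gram y x + (c * cnj c) *\<^sub>C gram y y"
  using assms by (simp add: gram_simps add_mem scaleC_mem scaleC_add_right algebra_simps)

lemma polarization:
  assumes "x \<in> E" "y \<in> E"
  shows "4 *\<^sub>C gram x y = gram (x + 1 *\<^sub>C y) (x + 1 *\<^sub>C y) - gram (x + (-1) *\<^sub>C y) (x + (-1) *\<^sub>C y)
    - \<i> *\<^sub>C gram (x + \<i> *\<^sub>C y) (x + \<i> *\<^sub>C y)
    + \<i> *\<^sub>C gram (x + (- \<i>) *\<^sub>C y) (x + (- \<i>) *\<^sub>C y)"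
proof -
  have 4: "4 *\<^sub>C z = z + z + z + z" for z :: 'z
  proof -
    have "(4::complex) = 1 + 1 + 1 + 1" by simp
    then show ?thesis by (simp only: scaleC_add_left scaleC_one)
  qed
  show ?thesis
    unfolding 4 gram_add_scaleC[OF assms] by (simp add: scaleC_add_right algebra_simps)
qed

end

definition vnorm :: "('e \<Rightarrow> 'e \<Rightarrow> 'z) \<Rightarrow> ('z \<Rightarrow> real) \<Rightarrow> 'e \<Rightarrow> real" where
  "vnorm g p x = sqrt (p (g x x))"

locale VE_admissible = VE_space E gram
  for E :: "'e::complex_vector set" and gram :: "'e \<Rightarrow> 'e \<Rightarrow> 'z::admissible_space"

sublocale VH_space \<subseteq> VE_admissible
  by unfold_locales

context VE_admissible
begin

lemma vnorm_nonneg: "p \<in> cont_incr_seminorms \<Longrightarrow> 0 \<le> vnorm gram p x"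
  by (simp add: vnorm_def cis_nonneg)

lemma vnorm_sq: "p \<in> cont_incr_seminorms \<Longrightarrow> p (gram x x) = (vnorm gram p x)\<^sup>2"
  by (simp add: vnorm_def cis_nonneg)

lemma vnorm_scaleC:
  "p \<in> cont_incr_seminorms \<Longrightarrow> x \<in> E \<Longrightarrow> vnorm gram p (c *\<^sub>C x) = cmod c * vnorm gram p x"
  by (simp add: vnorm_def gram_simps scaleC_mem cis_scaleC real_sqrt_mult norm_mult
      flip: power2_eq_square mult.assoc)

lemma vnorm_minus: "p \<in> cont_incr_seminorms \<Longrightarrow> x \<in> E \<Longrightarrow> vnorm gram p (- x) = vnorm gram p x"
  using vnorm_scaleC[of p x "-1"] by simp

lemma vnorm_zero: "p \<in> cont_incr_seminorms \<Longrightarrow> vnorm gram p 0 = 0"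
  using zero_mem by (simp add: vnorm_def gram_zero_right cis_zero)

lemma vnorm_mono: "p \<le> q \<Longrightarrow> vnorm gram p x \<le> vnorm gram q x"
  by (simp add: vnorm_def le_fun_def)

text \<open>For \<open>t > 0\<close>, the positivity of the gramian of \<open>t x - t\<^sup>-\<^sup>1 y\<close> bounds the mixed terms of
  \<open>[x + y, x + y]\<close> by \<open>t\<^sup>2 [x, x] + t\<^sup>-\<^sup>2 [y, y]\<close>.\<close>

lemma gram_add_le:
  assumes "x \<in> E" "y \<in> E" "0 < t"
  shows "gram (x + y) (x + y)
    \<le> complex_of_real (1 + t\<^sup>2) *\<^sub>C gram x x + complex_of_real (1 + 1 / t\<^sup>2) *\<^sub>C gram y y"
proof -
  have "0 \<le> gram (complex_of_real t *\<^sub>C x - complex_of_real (1 / t) *\<^sub>C y)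
                (complex_of_real t *\<^sub>C x - complex_of_real (1 / t) *\<^sub>C y)"
    using assms by (simp add: gram_nonneg diff_mem scaleC_mem)
  also have "\<dots> = complex_of_real (t\<^sup>2) *\<^sub>C gram x x + complex_of_real (1 / t\<^sup>2) *\<^sub>C gram y y
      - gram x y - gram y x"
    using assms by (simp add: gram_simps scaleC_mem diff_mem complex_vector.scale_right_diff_distrib
        power2_eq_square flip: of_real_mult)
  finally show ?thesis using assms
    by (simp add: gram_simps add_mem scaleC_add_left algebra_simps)
qed

text \<open>The right-hand side of \<open>gram_add_le\<close> is smallest, with value \<open>(a + b)\<^sup>2\<close>, for \<open>t\<^sup>2 = b / a\<close>, where \<open>a\<close>
  and \<open>b\<close> are the seminorms of \<open>x\<close> and \<open>y\<close>; a small amount is added to both to keep them positive.\<close>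

lemma vnorm_add:
  assumes p: "p \<in> cont_incr_seminorms" and x: "x \<in> E" "y \<in> E"
  shows "vnorm gram p (x + y) \<le> vnorm gram p x + vnorm gram p y"
proof (rule field_le_epsilon)
  fix e :: real assume e: "0 < e"
  define a where "a = vnorm gram p x + e / 2"
  define b where "b = vnorm gram p y + e / 2"
  have pos: "0 < a" "0 < b"
    using e vnorm_nonneg[OF p] by (auto simp: a_def b_def intro: add_nonneg_pos)
  have ab: "p (gram x x) \<le> a\<^sup>2" "p (gram y y) \<le> b\<^sup>2"
    using e vnorm_nonneg[OF p] unfolding vnorm_sq[OF p] a_def b_def by (auto intro!: power_mono)
  define t where "t = sqrt (b / a)"
  have t: "0 < t" "t\<^sup>2 = b / a" using pos by (simp_all add: t_def)
  have "p (gram (x + y) (x + y))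
      \<le> p (complex_of_real (1 + t\<^sup>2) *\<^sub>C gram x x + complex_of_real (1 + 1 / t\<^sup>2) *\<^sub>C gram y y)"
    using x t by (intro cis_mono[OF p] gram_add_le gram_nonneg add_mem)
  also have "\<dots> \<le> cmod (complex_of_real (1 + t\<^sup>2)) * p (gram x x)
      + cmod (complex_of_real (1 + 1 / t\<^sup>2)) * p (gram y y)"
    using cis_add[OF p] by (simp only: cis_scaleC[OF p] flip: cis_scaleC[OF p])
  also have "\<dots> = (1 + t\<^sup>2) * p (gram x x) + (1 + 1 / t\<^sup>2) * p (gram y y)"
    by (simp only: norm_of_real) simp
  also have "\<dots> \<le> (1 + t\<^sup>2) * a\<^sup>2 + (1 + 1 / t\<^sup>2) * b\<^sup>2"
    using ab by (intro add_mono mult_left_mono) auto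
  also have "\<dots> = (a + b)\<^sup>2"
    using pos unfolding t by (simp add: field_simps power2_eq_square)
  finally have "vnorm gram p (x + y) \<le> a + b"
    unfolding vnorm_def using pos by (intro real_le_lsqrt) (auto simp: cis_nonneg[OF p])
  then show "vnorm gram p (x + y) \<le> vnorm gram p x + vnorm gram p y + e"
    by (simp add: a_def b_def)
qed

lemma vnorm_minus_commute:
  assumes "p \<in> cont_incr_seminorms" "x \<in> E" "y \<in> E"
  shows "vnorm gram p (x - y) = vnorm gram p (y - x)"
  using vnorm_minus[of p "x - y"] assms by (simp add: diff_mem)

lemma vnorm_triangle:
  assumes "p \<in> cont_incr_seminorms" "x \<in> E" "y \<in> E" "z \<in> E"
  shows "vnorm gram p (x - z) \<le> vnorm gram p (x - y) + vnorm gram p (y - z)"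
  using vnorm_add[of p "x - y" "y - z"] assms by (simp add: diff_mem)

lemma vnorm_add_unit:
  assumes p: "p \<in> cont_incr_seminorms" and x: "x \<in> E" "y \<in> E" and c: "cmod c = 1"
  shows "p (gram (x + c *\<^sub>C y) (x + c *\<^sub>C y)) \<le> (vnorm gram p x + vnorm gram p y)\<^sup>2"
  unfolding vnorm_sq[OF p] using vnorm_add[OF p x(1), of "c *\<^sub>C y"] x c
  by (intro power_mono) (auto simp: vnorm_scaleC[OF p] scaleC_mem vnorm_nonneg[OF p])

text \<open>Polarization writes \<open>4 [x,y]\<close> with four gramians of vectors \<open>x + c y\<close>, \<open>\<bar>c\<bar> = 1\<close>.\<close>

lemma gram_le_square_sum:
  assumes p: "p \<in> cont_incr_seminorms" and x: "x \<in> E" "y \<in> E"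
  shows "p (gram x y) \<le> (vnorm gram p x + vnorm gram p y)\<^sup>2"
proof -
  let ?r = "(vnorm gram p x + vnorm gram p y)\<^sup>2"
  have "4 * p (gram x y) = p (4 *\<^sub>C gram x y)" by (simp add: cis_scaleC[OF p])
  also have "\<dots> \<le> p (gram (x + 1 *\<^sub>C y) (x + 1 *\<^sub>C y)) + p (gram (x + (-1) *\<^sub>C y) (x + (-1) *\<^sub>C y))
    + p (gram (x + \<i> *\<^sub>C y) (x + \<i> *\<^sub>C y)) + p (gram (x + (- \<i>) *\<^sub>C y) (x + (- \<i>) *\<^sub>C y))"
  proof -
    have "p (a - b - \<i> *\<^sub>C c + \<i> *\<^sub>C d) \<le> p a + p b + p c + p d" for a b c d
      using cis_add[OF p, of "a - b - \<i> *\<^sub>C c" "\<i> *\<^sub>C d"] cis_diff[OF p, of "a - b" "\<i> *\<^sub>C c"]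
        cis_diff[OF p, of a b] by (simp add: cis_scaleC[OF p])
    then show ?thesis using polarization[OF x] by metis
  qed
  also have "\<dots> \<le> ?r + ?r + ?r + ?r"
    by (intro add_mono vnorm_add_unit p x) simp_all
  finally show ?thesis by simp
qed

text \<open>The gramian of \<open>x\<close> and \<open>y\<close> is that of \<open>s x\<close> and \<open>s\<^sup>-\<^sup>1 y\<close>. Polarization bounds it by the square of
  the sum of the seminorms, and \<open>s\<close> is chosen to make the two summands equal.\<close>

lemma schwarz:
  assumes p: "p \<in> cont_incr_seminorms" and x: "x \<in> E" "y \<in> E"
  shows "p (gram x y) \<le> 4 * vnorm gram p x * vnorm gram p y"
proof -
  define a b where "a = vnorm gram p x" and "b = vnorm gram p y"
  have ab: "0 \<le> a" "0 \<le> b" by (simp_all add: a_def b_def vnorm_nonneg[OF p])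
  have *: "p (gram x y) \<le> 4 * (a + e) * (b + e)" if e: "0 < e" for e
  proof -
    define s where "s = sqrt ((b + e) / (a + e))"
    have pos: "0 < a + e" "0 < b + e" using ab e by auto
    have s: "0 < s" "s * (a + e) = (b + e) / s"
      using pos by (simp_all add: s_def real_sqrt_divide field_simps)
    have "gram x y = gram (complex_of_real s *\<^sub>C x) (complex_of_real (1 / s) *\<^sub>C y)"
      using x s by (simp add: gram_simps scaleC_mem)
    then have "p (gram x y) \<le> (vnorm gram p (complex_of_real s *\<^sub>C x)
        + vnorm gram p (complex_of_real (1 / s) *\<^sub>C y))\<^sup>2"
      using gram_le_square_sum[OF p, of "complex_of_real s *\<^sub>C x" "complex_of_real (1 / s) *\<^sub>C y"] x
      by (simp only: scaleC_mem)
    also have "\<dots> = (s * a + b / s)\<^sup>2"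
      using x s by (simp add: vnorm_scaleC[OF p] a_def b_def norm_divide)
    also have "\<dots> \<le> (s * (a + e) + (b + e) / s)\<^sup>2"
      using s ab e by (intro power_mono add_mono mult_left_mono divide_right_mono) auto
    also have "\<dots> = 4 * (s * (a + e)) * ((b + e) / s)"
      unfolding s(2) by (simp only: power2_eq_square) algebra
    also have "\<dots> = 4 * (a + e) * (b + e)" using s(1) by simp
    finally show ?thesis .
  qed
  have "((\<lambda>e. 4 * (a + e) * (b + e)) \<longlongrightarrow> 4 * (a + 0) * (b + 0)) (at_right 0)"
    by (intro tendsto_intros)
  moreover have "eventually (\<lambda>e. p (gram x y) \<le> 4 * (a + e) * (b + e)) (at_right 0)"
    using * by (simp add: eventually_at_right_less eventually_mono[OF eventually_at_right_less])
  ultimately show ?thesis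
    using tendsto_lowerbound[of "\<lambda>e. 4 * (a + e) * (b + e)" _ "at_right 0" "p (gram x y)"]
    by (simp add: a_def b_def)
qed

lemma vnorm_eq_zero:
  assumes "x \<in> E" "\<And>p. p \<in> cont_incr_seminorms \<Longrightarrow> vnorm gram p x = 0" shows "x = 0"
proof -
  have "gram x x = 0" unfolding eq_zero_iff_seminorms by (auto simp: assms(2) vnorm_sq)
  then show ?thesis using assms(1) gram_eq_0_iff by blast
qed

lemma openin_ball:
  assumes "x \<in> E" "p \<in> cont_incr_seminorms" "0 < e"
  shows "openin (ve_topology E gram) {y \<in> E. vnorm gram p (y - x) < e}"
  unfolding ve_topology_def vnorm_def using assms by (intro topology_generated_by_Basis) blast

text \<open>The triangle inequality for \<open>vnorm\<close> makes the generating balls neighbourhoods of all their points,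
  and \<open>S(Z)\<close> is closed under addition, so that finite intersections of balls contain balls.\<close>

lemma openin_ve_topology:
  "openin (ve_topology E gram) U \<longleftrightarrow>
    U \<subseteq> E \<and> (\<forall>x\<in>U. \<exists>p\<in>cont_incr_seminorms. \<exists>e>0. {y \<in> E. vnorm gram p (y - x) < e} \<subseteq> U)"
    (is "_ \<longleftrightarrow> ?P U")
proof
  let ?B = "{{y \<in> E. sqrt (p (gram (y - x) (y - x))) < e} | x p e.
      x \<in> E \<and> p \<in> cont_incr_seminorms \<and> 0 < e}"
  assume "openin (ve_topology E gram) U"
  then have "generate_topology_on ?B U"
    unfolding ve_topology_def openin_topology_generated_by_iff .
  then show "?P U"
  proof induction
    case (Int a b)
    show ?case
    proof (intro conjI ballI)
      fix x assume x: "x \<in> a \<inter> b"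
      obtain p e where p: "p \<in> cont_incr_seminorms" "0 < e" "{y \<in> E. vnorm gram p (y - x) < e} \<subseteq> a"
        using Int x by blast
      obtain q d where q: "q \<in> cont_incr_seminorms" "0 < d" "{y \<in> E. vnorm gram q (y - x) < d} \<subseteq> b"
        using Int x by blast
      let ?r = "\<lambda>z. p z + q z"
      have "p \<le> ?r" "q \<le> ?r" using cis_nonneg p q by (auto simp: le_fun_def)
      then have le: "vnorm gram p y \<le> vnorm gram ?r y" "vnorm gram q y \<le> vnorm gram ?r y" for y
        by (simp_all add: vnorm_mono)
      have "y \<in> a \<inter> b" if "y \<in> E" "vnorm gram ?r (y - x) < min d e" for y
        using that le[of "y - x"] p(3) q(3) by (auto simp: subset_iff)
      then have "{y \<in> E. vnorm gram ?r (y - x) < min d e} \<subseteq> a \<inter> b" by blast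
      moreover have "?r \<in> cont_incr_seminorms" "0 < min d e" using p q by (auto intro: cis_plus)
      ultimately show "\<exists>p\<in>cont_incr_seminorms. \<exists>e>0. {y \<in> E. vnorm gram p (y - x) < e} \<subseteq> a \<inter> b"
        by blast
    qed (use Int in blast)
  next
    case (UN K)
    then show ?case by (meson Union_iff Union_least Union_upper order_trans)
  next
    case (Basis s)
    then obtain x p e where s: "s = {y \<in> E. vnorm gram p (y - x) < e}" and x: "x \<in> E"
      and p: "p \<in> cont_incr_seminorms" and e: "0 < e"
      by (auto simp: vnorm_def)
    show ?case
    proof (intro conjI ballI)
      fix y assume y: "y \<in> s"
      let ?d = "e - vnorm gram p (y - x)"
      have "{z \<in> E. vnorm gram p (z - y) < ?d} \<subseteq> s"
        using vnorm_triangle[OF p _ _ x, of _ y] y unfolding s by force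
      moreover have "0 < ?d" using y s by simp
      ultimately show "\<exists>p\<in>cont_incr_seminorms. \<exists>e>0. {z \<in> E. vnorm gram p (z - y) < e} \<subseteq> s"
        using p by blast
    qed (simp add: s)
  qed simp
next
  assume *: "?P U"
  have "\<exists>T. openin (ve_topology E gram) T \<and> x \<in> T \<and> T \<subseteq> U" if xU: "x \<in> U" for x
  proof -
    obtain p e where p: "p \<in> cont_incr_seminorms" "0 < e" "{y \<in> E. vnorm gram p (y - x) < e} \<subseteq> U"
      using bspec[OF conjunct2[OF *] xU] by (elim bexE exE conjE) (rule that)
    have x: "x \<in> E" using conjunct1[OF *] xU by (rule subsetD)
    have "x \<in> {y \<in> E. vnorm gram p (y - x) < e}" using x p by (simp add: vnorm_zero)
    with openin_ball[OF x p(1,2)] p(3) show ?thesis by blast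
  qed
  then show "openin (ve_topology E gram) U" by (intro openin_subopen[THEN iffD2]) blast
qed

lemma openin_ve_topologyE:
  assumes "openin (ve_topology E gram) U" "x \<in> U"
  obtains p e where "p \<in> cont_incr_seminorms" "0 < e" "{y \<in> E. vnorm gram p (y - x) < e} \<subseteq> U"
  using bspec[OF conjunct2[OF openin_ve_topology[THEN iffD1, OF assms(1)]] assms(2)]
  by (elim bexE exE conjE) (rule that)

lemma topspace_ve_topology: "topspace (ve_topology E gram) = E"
proof
  show "topspace (ve_topology E gram) \<subseteq> E"
    using openin_topspace[of "ve_topology E gram"] unfolding openin_ve_topology by (rule conjunct1)
  have "openin (ve_topology E gram) E"
    unfolding openin_ve_topology
    by (intro conjI ballI bexI[OF _ cis_const_zero] exI[of _ 1]) auto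
  then show "E \<subseteq> topspace (ve_topology E gram)" by (rule openin_subset)
qed

lemma in_closure_ve_topology:
  assumes "D \<subseteq> E"
  shows "x \<in> ve_topology E gram closure_of D \<longleftrightarrow>
    x \<in> E \<and> (\<forall>p\<in>cont_incr_seminorms. \<forall>e>0. \<exists>d\<in>D. vnorm gram p (d - x) < e)"
  unfolding in_closure_of topspace_ve_topology
proof (intro iffI conjI ballI allI impI; elim conjE)
  fix p :: "'z \<Rightarrow> real" and e :: real
  assume x: "x \<in> E" and cl: "\<forall>T. x \<in> T \<and> openin (ve_topology E gram) T \<longrightarrow> (\<exists>y. y \<in> D \<and> y \<in> T)"
    and p: "p \<in> cont_incr_seminorms" and e: "0 < e"
  have "x \<in> {y \<in> E. vnorm gram p (y - x) < e}" using x p e by (simp add: vnorm_zero)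
  with openin_ball[OF x p e] have "\<exists>y. y \<in> D \<and> y \<in> {y \<in> E. vnorm gram p (y - x) < e}"
    using cl[rule_format, of "{y \<in> E. vnorm gram p (y - x) < e}"] by (simp only: simp_thms)
  then show "\<exists>d\<in>D. vnorm gram p (d - x) < e" by blast
next
  fix T assume near: "\<forall>p\<in>cont_incr_seminorms. \<forall>e>0. \<exists>d\<in>D. vnorm gram p (d - x) < e"
    and T: "openin (ve_topology E gram) T" "x \<in> T"
  obtain p e where p: "p \<in> cont_incr_seminorms" "0 < e" "{y \<in> E. vnorm gram p (y - x) < e} \<subseteq> T"
    using openin_ve_topologyE[OF T] .
  obtain d where "d \<in> D" "vnorm gram p (d - x) < e" using near p(1,2) by blast
  then show "\<exists>y. y \<in> D \<and> y \<in> T" using p(3) assms by blast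
qed assumption+

end

definition ve_tendsto ::
    "('e::complex_vector \<Rightarrow> 'e \<Rightarrow> 'z::admissible_space) \<Rightarrow> ('i \<Rightarrow> 'e) \<Rightarrow> 'e \<Rightarrow> 'i filter \<Rightarrow> bool" where
  "ve_tendsto g u l F \<longleftrightarrow> (\<forall>p\<in>cont_incr_seminorms. ((\<lambda>i. vnorm g p (u i - l)) \<longlongrightarrow> 0) F)"

definition ve_cauchy ::
    "'e::complex_vector set \<Rightarrow> ('e \<Rightarrow> 'e \<Rightarrow> 'z::admissible_space) \<Rightarrow> ('i \<Rightarrow> 'e) \<Rightarrow> 'i filter \<Rightarrow> bool" where
  "ve_cauchy E g u F \<longleftrightarrow>
    (\<forall>p\<in>cont_incr_seminorms. \<forall>e>0. \<exists>a\<in>E. \<forall>\<^sub>F i in F. vnorm g p (u i - a) < e)"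

context VE_admissible
begin

lemma ve_tendsto_iff:
  "ve_tendsto gram u l F \<longleftrightarrow>
    (\<forall>p\<in>cont_incr_seminorms. \<forall>e>0. \<forall>\<^sub>F i in F. vnorm gram p (u i - l) < e)"
  unfolding ve_tendsto_def tendsto_iff by (simp add: vnorm_nonneg)

lemma limitin_ve_topology:
  "limitin (ve_topology E gram) u l F \<longleftrightarrow>
    l \<in> E \<and> (\<forall>p\<in>cont_incr_seminorms. \<forall>e>0. \<forall>\<^sub>F i in F. u i \<in> E \<and> vnorm gram p (u i - l) < e)"
  unfolding limitin_def topspace_ve_topology
proof (intro iffI conjI ballI allI impI; elim conjE)
  fix p :: "'z \<Rightarrow> real" and e :: real
  assume l: "l \<in> E" and lim: "\<forall>U. openin (ve_topology E gram) U \<and> l \<in> U \<longrightarrow> (\<forall>\<^sub>F i in F. u i \<in> U)"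
    and p: "p \<in> cont_incr_seminorms" and e: "0 < e"
  have "l \<in> {y \<in> E. vnorm gram p (y - l) < e}" using l p e by (simp add: vnorm_zero)
  with openin_ball[OF l p e] have "\<forall>\<^sub>F i in F. u i \<in> {y \<in> E. vnorm gram p (y - l) < e}"
    using lim[rule_format, of "{y \<in> E. vnorm gram p (y - l) < e}"] by (simp only: simp_thms)
  then show "\<forall>\<^sub>F i in F. u i \<in> E \<and> vnorm gram p (u i - l) < e" by simp
next
  fix U assume near: "\<forall>p\<in>cont_incr_seminorms. \<forall>e>0. \<forall>\<^sub>F i in F. u i \<in> E \<and> vnorm gram p (u i - l) < e"
    and U: "openin (ve_topology E gram) U" "l \<in> U"
  obtain p e where p: "p \<in> cont_incr_seminorms" "0 < e" "{y \<in> E. vnorm gram p (y - l) < e} \<subseteq> U"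
    using openin_ve_topologyE[OF U] .
  have "\<forall>\<^sub>F i in F. u i \<in> E \<and> vnorm gram p (u i - l) < e" using near p(1,2) by blast
  then show "\<forall>\<^sub>F i in F. u i \<in> U" by eventually_elim (use p in blast)
qed assumption+

lemma gram_diff_bound:
  assumes p: "p \<in> cont_incr_seminorms" and "a \<in> E" "b \<in> E" "u \<in> E" "v \<in> E"
  shows "p (gram u v - gram a b) \<le> 4 * vnorm gram p (u - a) * vnorm gram p v + 4 * vnorm gram p a * vnorm gram p (v - b)"
proof -
  have "gram u v - gram a b = gram (u - a) v + gram a (v - b)"
    using assms by (simp add: gram_simps)
  then have "p (gram u v - gram a b) \<le> p (gram (u - a) v) + p (gram a (v - b))"
    using cis_add[OF p, of "gram (u - a) v" "gram a (v - b)"] by simp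
  also have "\<dots> \<le> 4 * vnorm gram p (u - a) * vnorm gram p v + 4 * vnorm gram p a * vnorm gram p (v - b)"
    using assms by (intro add_mono schwarz p diff_mem)
  finally show ?thesis .
qed

lemma tendsto_gram:
  assumes u: "ve_tendsto gram u a F" "\<And>i. u i \<in> E" "a \<in> E"
    and v: "ve_tendsto gram v b F" "\<And>i. v i \<in> E" "b \<in> E"
  shows "((\<lambda>i. gram (u i) (v i)) \<longlongrightarrow> gram a b) F"
  unfolding tendsto_iff_seminorms
proof
  fix p :: "'z \<Rightarrow> real" assume p: "p \<in> cont_incr_seminorms"
  let ?n = "vnorm gram p"
  let ?B = "\<lambda>i. 4 * ?n (u i - a) * (?n (v i - b) + ?n b) + 4 * ?n a * ?n (v i - b)"
  have le: "p (gram (u i) (v i) - gram a b) \<le> ?B i" for i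
  proof -
    have "p (gram (u i) (v i) - gram a b) \<le> 4 * ?n (u i - a) * ?n (v i) + 4 * ?n a * ?n (v i - b)"
      by (rule gram_diff_bound[OF p u(3) v(3) u(2) v(2)])
    also have "\<dots> \<le> ?B i"
      using vnorm_add[OF p, of "v i - b" b] v
      by (intro add_mono mult_left_mono) (auto simp: diff_mem vnorm_nonneg[OF p])
    finally show ?thesis .
  qed
  have "(?B \<longlongrightarrow> 4 * 0 * (0 + ?n b) + 4 * ?n a * 0) F"
    using u(1) v(1) p unfolding ve_tendsto_def by (intro tendsto_intros) auto
  then have "(?B \<longlongrightarrow> 0) F" by simp
  then show "((\<lambda>i. p (gram (u i) (v i) - gram a b)) \<longlongrightarrow> 0) F"
    by (rule Lim_null_comparison[rotated]) (simp add: cis_nonneg[OF p] le)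
qed

lemma tendsto_vnorm:
  assumes "ve_tendsto gram u a F" "\<And>i. u i \<in> E" "a \<in> E" "p \<in> cont_incr_seminorms"
  shows "((\<lambda>i. vnorm gram p (u i)) \<longlongrightarrow> vnorm gram p a) F"
  unfolding vnorm_def
  by (intro tendsto_real_sqrt cis_tendsto assms(4) tendsto_gram assms(1-3))

text \<open>Closeness \<open>1\<close> suffices because \<open>S(Z)\<close> is closed under multiplication by positive numbers: distance
  less than \<open>e\<close> for \<open>p\<close> is distance less than \<open>1\<close> for \<open>e\<^sup>-\<^sup>2 p\<close>.\<close>

lemma ve_tendsto_seminorm_filter:
  assumes "\<And>q. q \<in> cont_incr_seminorms \<Longrightarrow> vnorm gram q (u q - x) < 1"
  shows "ve_tendsto gram u x seminorm_filter"
  unfolding ve_tendsto_iff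
proof (intro ballI allI impI)
  fix p :: "'z \<Rightarrow> real" and e :: real assume p: "p \<in> cont_incr_seminorms" and e: "0 < e"
  have "(\<lambda>z. 1 / e\<^sup>2 * p z) \<in> cont_incr_seminorms" using p e by (intro cis_scale) auto
  from eventually_le_seminorm_filter[OF this]
  show "\<forall>\<^sub>F q in seminorm_filter. vnorm gram p (u q - x) < e"
  proof eventually_elim
    case (elim q)
    then have "vnorm gram (\<lambda>z. 1 / e\<^sup>2 * p z) (u q - x) \<le> vnorm gram q (u q - x)"
      by (blast intro: vnorm_mono)
    also have "\<dots> < 1" using assms elim by blast
    finally show ?case using e by (simp add: vnorm_def real_sqrt_divide)
  qed
qed

lemma dense_net:
  assumes "D \<subseteq> E" "x \<in> ve_topology E gram closure_of D"
  obtains u :: "('z \<Rightarrow> real) \<Rightarrow> 'e" where "\<And>q. u q \<in> D" "ve_tendsto gram u x seminorm_filter"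
proof -
  have "\<exists>d\<in>D. q \<in> cont_incr_seminorms \<longrightarrow> vnorm gram q (d - x) < 1" for q
    using assms(2) cis_const_zero zero_less_one unfolding in_closure_ve_topology[OF assms(1)] by blast
  then obtain u where "\<And>q. u q \<in> D" "\<And>q. q \<in> cont_incr_seminorms \<Longrightarrow> vnorm gram q (u q - x) < 1"
    by metis
  then show thesis using that ve_tendsto_seminorm_filter by blast
qed

lemma ve_tendsto_unique:
  assumes "F \<noteq> bot" "ve_tendsto gram u a F" "ve_tendsto gram u b F"
    "\<And>i. u i \<in> E" "a \<in> E" "b \<in> E"
  shows "a = b"
proof -
  have "gram z a = gram z b" if z: "z \<in> E" for z
  proof -
    have const: "ve_tendsto gram (\<lambda>_. z) z F" unfolding ve_tendsto_def by (simp add: vnorm_zero)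
    have "((\<lambda>i. gram z (u i)) \<longlongrightarrow> gram z a) F"
      by (rule tendsto_gram[OF const z z assms(2) assms(4) assms(5)])
    moreover have "((\<lambda>i. gram z (u i)) \<longlongrightarrow> gram z b) F"
      by (rule tendsto_gram[OF const z z assms(3) assms(4) assms(6)])
    ultimately show ?thesis using tendsto_unique[OF assms(1)] by blast
  qed
  then show ?thesis by (intro gram_eqI assms)
qed

lemma ve_tendsto_imp_cauchy: "l \<in> E \<Longrightarrow> ve_tendsto gram u l F \<Longrightarrow> ve_cauchy E gram u F"
  unfolding ve_cauchy_def ve_tendsto_iff by blast

text \<open>From a Cauchy filter one picks, for every \<open>q\<close> in \<open>S(Z)\<close>, an element of the dense set \<open>D\<close> that is
  \<open>q\<close>-close to the tail of the filter. The limit of this net is also the limit of the filter, so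
  completeness has to be checked only for nets in \<open>D\<close> indexed by \<open>S(Z)\<close>.\<close>

lemma VH_spaceI:
  assumes D: "D \<subseteq> E" "E \<subseteq> ve_topology E gram closure_of D"
    and net: "\<And>u :: ('z \<Rightarrow> real) \<Rightarrow> 'e. (\<And>q. u q \<in> D) \<Longrightarrow> ve_cauchy E gram u seminorm_filter
       \<Longrightarrow> \<exists>l\<in>E. ve_tendsto gram u l seminorm_filter"
  shows "VH_space E gram"
proof (unfold_locales, unfold complete_in_def, intro allI impI, elim conjE)
  fix F :: "'e filter"
  assume F: "F \<noteq> bot" and FE: "F \<le> principal (topspace (ve_topology E gram))"
    and cauchy: "\<forall>U. openin (ve_topology E gram) U \<and> 0 \<in> U \<longrightarrow> (\<forall>\<^sub>F (x, y) in F \<times>\<^sub>F F. x - y \<in> U)"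
  have inE: "eventually (\<lambda>x. x \<in> E) F"
    using FE by (simp add: topspace_ve_topology le_principal)
  have near: "\<exists>d\<in>D. \<forall>\<^sub>F x in F. vnorm gram p (x - d) < e" if p: "p \<in> cont_incr_seminorms" "0 < e" for p e
  proof -
    have "openin (ve_topology E gram) {y \<in> E. vnorm gram p (y - 0) < e / 2}"
      using p by (intro openin_ball zero_mem) auto
    moreover have "0 \<in> {y \<in> E. vnorm gram p (y - 0) < e / 2}" using p by (simp add: zero_mem vnorm_zero)
    ultimately have "\<forall>\<^sub>F (x, y) in F \<times>\<^sub>F F. x - y \<in> {y \<in> E. vnorm gram p (y - 0) < e / 2}"
      using cauchy by blast
    then obtain P Q where PQ: "eventually P F" "eventually Q F"
      "\<And>x y. P x \<Longrightarrow> Q y \<Longrightarrow> vnorm gram p (x - y) < e / 2"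
      unfolding eventually_prod_filter by auto
    obtain y where y: "Q y" "y \<in> E"
      using eventually_happens'[OF F eventually_conj[OF PQ(2) inE]] by blast
    obtain d where d: "d \<in> D" "vnorm gram p (d - y) < e / 2"
      using subsetD[OF D(2) y(2), unfolded in_closure_ve_topology[OF D(1)]] p half_gt_zero[OF p(2)] by blast
    have "\<forall>\<^sub>F x in F. vnorm gram p (x - d) < e"
      using PQ(1) inE
    proof eventually_elim
      case (elim x)
      have "d \<in> E" using d D by blast
      with vnorm_triangle[OF p(1) elim(2) y(2), of d] vnorm_minus_commute[OF p(1) _ y(2), of d]
        PQ(3)[OF elim(1) y(1)] d show ?case by simp
    qed
    with d show ?thesis by blast
  qed
  have "\<exists>d\<in>D. q \<in> cont_incr_seminorms \<longrightarrow> (\<forall>\<^sub>F x in F. vnorm gram q (x - d) < 1)" for q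
    using near[of q 1] near[OF cis_const_zero, of 1] by auto
  then obtain u where uD: "\<And>q. u q \<in> D"
    and u: "\<And>q. q \<in> cont_incr_seminorms \<Longrightarrow> \<forall>\<^sub>F x in F. vnorm gram q (x - u q) < 1" by metis
  have uE: "u q \<in> E" for q using uD D by blast
  have close: "\<forall>\<^sub>F q in seminorm_filter. \<forall>\<^sub>F x in F. vnorm gram p (x - u q) < e"
    if p: "p \<in> cont_incr_seminorms" "0 < e" for p e
  proof -
    have "(\<lambda>z. 1 / e\<^sup>2 * p z) \<in> cont_incr_seminorms" using p by (intro cis_scale) auto
    from eventually_le_seminorm_filter[OF this] show ?thesis
    proof eventually_elim
      case (elim q)
      from u[of q] elim have "\<forall>\<^sub>F x in F. vnorm gram q (x - u q) < 1" by blast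
      then show ?case
      proof eventually_elim
        case (elim x)
        have "vnorm gram (\<lambda>z. 1 / e\<^sup>2 * p z) (x - u q) \<le> vnorm gram q (x - u q)"
          using \<open>q \<in> _ \<and> _\<close> by (blast intro: vnorm_mono)
        with elim have "vnorm gram (\<lambda>z. 1 / e\<^sup>2 * p z) (x - u q) < 1" by linarith
        then show ?case using p by (simp add: vnorm_def real_sqrt_divide)
      qed
    qed
  qed
  have "ve_cauchy E gram u seminorm_filter"
    unfolding ve_cauchy_def
  proof (intro ballI allI impI)
    fix p :: "'z \<Rightarrow> real" and e :: real assume p: "p \<in> cont_incr_seminorms" and e: "0 < e"
    obtain d where d: "d \<in> D" "\<forall>\<^sub>F x in F. vnorm gram p (x - d) < e / 2"
      using near[OF p, of "e / 2"] e by auto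
    have dE: "d \<in> E" using d D by blast
    have "\<forall>\<^sub>F q in seminorm_filter. \<forall>\<^sub>F x in F. vnorm gram p (x - u q) < e / 2"
      using close[OF p, of "e / 2"] e by auto
    then have "\<forall>\<^sub>F q in seminorm_filter. vnorm gram p (u q - d) < e"
    proof eventually_elim
      case (elim q)
      obtain x where x: "x \<in> E" "vnorm gram p (x - u q) < e / 2" "vnorm gram p (x - d) < e / 2"
        using eventually_happens'[OF F eventually_conj[OF inE eventually_conj[OF elim d(2)]]] by blast
      then show ?case
        using vnorm_triangle[OF p uE x(1) dE, of q] vnorm_minus_commute[OF p uE x(1), of q] by linarith
    qed
    then show "\<exists>a\<in>E. \<forall>\<^sub>F q in seminorm_filter. vnorm gram p (u q - a) < e" using dE by blast
  qed
  then have "\<exists>l\<in>E. ve_tendsto gram u l seminorm_filter" by (intro net uD)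
  then obtain l where l: "l \<in> E" "ve_tendsto gram u l seminorm_filter" ..
  have "limitin (ve_topology E gram) (\<lambda>x. x) l F"
    unfolding limitin_ve_topology
  proof (intro conjI ballI allI impI l)
    fix p :: "'z \<Rightarrow> real" and e :: real assume p: "p \<in> cont_incr_seminorms" and e: "0 < e"
    have e2: "0 < e / 2" using e by simp
    have "\<forall>\<^sub>F q in seminorm_filter. (\<forall>\<^sub>F x in F. vnorm gram p (x - u q) < e / 2) \<and> vnorm gram p (u q - l) < e / 2"
      using close[OF p e2] l(2)[unfolded ve_tendsto_iff, rule_format, OF p e2] by (rule eventually_conj)
    then obtain q where q: "\<forall>\<^sub>F x in F. vnorm gram p (x - u q) < e / 2" "vnorm gram p (u q - l) < e / 2"
      using eventually_happens'[OF seminorm_filter_neq_bot] by blast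
    from q(1) inE show "\<forall>\<^sub>F x in F. x \<in> E \<and> vnorm gram p (x - l) < e"
    proof eventually_elim
      case (elim x)
      then show ?case using vnorm_triangle[OF p elim(2) uE l(1), of q] q(2) by simp
    qed
  qed
  then show "\<exists>l. limitin (ve_topology E gram) (\<lambda>x. x) l F" ..
qed

end

lemma (in VH_space) cauchy_net_converges:
  assumes F: "F \<noteq> bot" and u: "\<And>i. u i \<in> E" and cauchy: "ve_cauchy E gram u F"
  obtains l where "l \<in> E" "ve_tendsto gram u l F"
proof -
  let ?G = "filtermap u F"
  have "\<exists>l. limitin (ve_topology E gram) (\<lambda>x. x) l ?G"
  proof (rule complete[unfolded complete_in_def, rule_format], intro conjI allI impI)
    show "?G \<noteq> bot" using F by (simp add: filtermap_bot_iff)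
    show "?G \<le> principal (topspace (ve_topology E gram))"
      using u by (simp add: topspace_ve_topology le_principal eventually_filtermap)
    fix U assume "openin (ve_topology E gram) U \<and> 0 \<in> U"
    then obtain p e where p: "p \<in> cont_incr_seminorms" and e: "0 < e"
      and U: "{y \<in> E. vnorm gram p (y - 0) < e} \<subseteq> U"
      by (elim conjE) (rule openin_ve_topologyE)
    obtain a where a: "a \<in> E" "\<forall>\<^sub>F i in F. vnorm gram p (u i - a) < e / 2"
      using cauchy[unfolded ve_cauchy_def, rule_format, OF p half_gt_zero[OF e]] by (elim bexE)
    have "x - y \<in> U" if "x \<in> E \<and> vnorm gram p (x - a) < e / 2" "y \<in> E \<and> vnorm gram p (y - a) < e / 2" for x y
      using that U vnorm_triangle[OF p _ a(1), of x y] vnorm_minus_commute[OF p a(1), of y]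
      by (auto simp: diff_mem)
    then show "\<forall>\<^sub>F (x, y) in ?G \<times>\<^sub>F ?G. x - y \<in> U"
      unfolding eventually_prod_filter eventually_filtermap using a(2) u
      by (intro exI[of _ "\<lambda>x. x \<in> E \<and> vnorm gram p (x - a) < e / 2"]) auto
  qed
  then obtain l where "limitin (ve_topology E gram) (\<lambda>x. x) l ?G" ..
  then have l: "l \<in> E" and lim: "\<forall>p\<in>cont_incr_seminorms. \<forall>e>0. \<forall>\<^sub>F i in F. u i \<in> E \<and> vnorm gram p (u i - l) < e"
    unfolding limitin_ve_topology eventually_filtermap by (rule conjunct1, rule conjunct2)
  have "ve_tendsto gram u l F" unfolding ve_tendsto_iff using lim u by simp
  with l show thesis by (rule that)
qed

lemma continuous_map_iff_bounded:
  fixes gE :: "'e::complex_vector \<Rightarrow> 'e \<Rightarrow> 'z::admissible_space"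
    and gF :: "'f::complex_vector \<Rightarrow> 'f \<Rightarrow> 'z"
  assumes E: "VE_admissible E gE" and F: "VE_admissible F gF" and T: "linear_op E F T"
  shows "continuous_map (ve_topology E gE) (ve_topology F gF) T \<longleftrightarrow>
    (\<forall>p\<in>cont_incr_seminorms. \<exists>q\<in>cont_incr_seminorms. \<exists>c\<ge>0. \<forall>x\<in>E.
       vnorm gF p (T x) \<le> c * vnorm gE q x)" (is "?L \<longleftrightarrow> ?R")
proof -
  interpret E: VE_admissible E gE by fact
  interpret F: VE_admissible F gF by fact
  have TF: "T x \<in> F" if "x \<in> E" for x using T that by (auto simp: linear_op_def)
  have Ts: "T (c *\<^sub>C x) = c *\<^sub>C T x" if "x \<in> E" for c x using T that by (simp add: linear_op_def)
  have Td: "T (x - y) = T x - T y" if "x \<in> E" "y \<in> E" for x y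
  proof -
    have "T (x - y + y) = T (x - y) + T y"
      using T that E.diff_mem unfolding linear_op_def by blast
    then show ?thesis by simp
  qed
  have T0: "T 0 = 0" using Td[OF E.zero_mem E.zero_mem] by simp
  show ?thesis
  proof
    assume L: ?L
    show ?R
    proof
      fix p :: "'z \<Rightarrow> real" assume p: "p \<in> cont_incr_seminorms"
      have "openin (ve_topology E gE) {x \<in> topspace (ve_topology E gE). T x \<in> {y \<in> F. vnorm gF p (y - 0) < 1}}"
        using L F.openin_ball[OF F.zero_mem p zero_less_one] by (simp only: continuous_map_def)
      moreover have "0 \<in> {x \<in> topspace (ve_topology E gE). T x \<in> {y \<in> F. vnorm gF p (y - 0) < 1}}"
        using p by (simp add: E.topspace_ve_topology E.zero_mem F.zero_mem T0 F.vnorm_zero)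
      ultimately obtain q e where q: "q \<in> cont_incr_seminorms" and e: "0 < e"
        and qe: "{x \<in> E. vnorm gE q (x - 0) < e} \<subseteq> {x. vnorm gF p (T x) < 1}"
      proof (rule E.openin_ve_topologyE)
        fix q and e :: real
        assume *: "q \<in> cont_incr_seminorms" "0 < e"
          "{x \<in> E. vnorm gE q (x - 0) < e}
            \<subseteq> {x \<in> topspace (ve_topology E gE). T x \<in> {y \<in> F. vnorm gF p (y - 0) < 1}}"
        then have "{x \<in> E. vnorm gE q (x - 0) < e} \<subseteq> {x. vnorm gF p (T x) < 1}" by auto
        with * show thesis by (intro that)
      qed
      have "vnorm gF p (T x) \<le> 1 / e * vnorm gE q x" if x: "x \<in> E" for x
      proof (rule field_le_epsilon)
        fix d :: real assume d: "0 < d"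
        define t where "t = vnorm gE q x + e * d"
        have t: "0 < t" "vnorm gE q x < t"
          using d e E.vnorm_nonneg[OF q, of x] by (auto simp: t_def add_nonneg_pos)
        have "vnorm gE q (complex_of_real (e / t) *\<^sub>C x) < e"
          unfolding E.vnorm_scaleC[OF q x] norm_of_real using t e by (simp add: field_simps)
        then have "vnorm gF p (T (complex_of_real (e / t) *\<^sub>C x)) < 1"
          using qe E.scaleC_mem[OF x] by auto
        then have "e / t * vnorm gF p (T x) < 1"
          unfolding Ts[OF x] F.vnorm_scaleC[OF p TF[OF x]] norm_of_real using t e by simp
        then have "vnorm gF p (T x) < t / e" using t e by (simp add: field_simps)
        also have "t / e = 1 / e * vnorm gE q x + d" using e by (simp add: t_def field_simps)
        finally show "vnorm gF p (T x) \<le> 1 / e * vnorm gE q x + d" by simp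
      qed
      moreover have "0 \<le> 1 / e" using e by simp
      ultimately show "\<exists>q\<in>cont_incr_seminorms. \<exists>c\<ge>0. \<forall>x\<in>E. vnorm gF p (T x) \<le> c * vnorm gE q x"
        using q by blast
    qed
  next
    assume R: ?R
    show ?L
      unfolding continuous_map_def E.topspace_ve_topology F.topspace_ve_topology
    proof (intro conjI allI impI)
      fix U assume U: "openin (ve_topology F gF) U"
      show "openin (ve_topology E gE) {x \<in> E. T x \<in> U}"
        unfolding E.openin_ve_topology
      proof (intro conjI ballI)
        fix x assume "x \<in> {x \<in> E. T x \<in> U}"
        then have x: "x \<in> E" "T x \<in> U" by auto
        obtain p e where p: "p \<in> cont_incr_seminorms" and e: "0 < e"
          and pe: "{y \<in> F. vnorm gF p (y - T x) < e} \<subseteq> U"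
          using F.openin_ve_topologyE[OF U x(2)] .
        obtain q c where q: "q \<in> cont_incr_seminorms" and c: "0 \<le> c"
          and qc: "\<And>x. x \<in> E \<Longrightarrow> vnorm gF p (T x) \<le> c * vnorm gE q x"
          using R[rule_format, OF p] by (elim bexE exE conjE) (rule that; blast)
        have "T y \<in> U" if y: "y \<in> E" "vnorm gE q (y - x) < e / (c + 1)" for y
        proof -
          have "vnorm gF p (T y - T x) \<le> c * vnorm gE q (y - x)"
            using qc[of "y - x"] x y by (simp add: Td E.diff_mem)
          also have "\<dots> \<le> (c + 1) * vnorm gE q (y - x)"
            using E.vnorm_nonneg[OF q] by (intro mult_right_mono) auto
          also have "\<dots> < e" using y c by (simp add: field_simps)
          finally show ?thesis using pe TF y by blast
        qed
        then have "{y \<in> E. vnorm gE q (y - x) < e / (c + 1)} \<subseteq> {x \<in> E. T x \<in> U}" by blast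
        moreover have "0 < e / (c + 1)" using c e by simp
        ultimately show "\<exists>p\<in>cont_incr_seminorms. \<exists>e>0. {y \<in> E. vnorm gE p (y - x) < e} \<subseteq> {x \<in> E. T x \<in> U}"
          using q by blast
      qed blast
    qed (use TF in auto)
  qed
qed

lemma continuous_ve_tendsto:
  fixes gE :: "'e::complex_vector \<Rightarrow> 'e \<Rightarrow> 'z::admissible_space"
    and gF :: "'f::complex_vector \<Rightarrow> 'f \<Rightarrow> 'z"
  assumes E: "VE_admissible E gE" and F: "VE_admissible F gF" and T: "linear_op E F T"
    and cont: "continuous_map (ve_topology E gE) (ve_topology F gF) T"
    and u: "ve_tendsto gE u a G" "\<And>i. u i \<in> E" "a \<in> E"
  shows "ve_tendsto gF (\<lambda>i. T (u i)) (T a) G"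
  unfolding ve_tendsto_def
proof
  fix p :: "'z \<Rightarrow> real" assume p: "p \<in> cont_incr_seminorms"
  interpret E: VE_admissible E gE by fact
  interpret F: VE_admissible F gF by fact
  obtain q c where q: "q \<in> cont_incr_seminorms"
    and qc: "\<And>x. x \<in> E \<Longrightarrow> vnorm gF p (T x) \<le> c * vnorm gE q x"
    using cont[unfolded continuous_map_iff_bounded[OF E F T], rule_format, OF p]
    by (elim bexE exE conjE) (rule that; blast)
  have "T (u i) - T a = T (u i - a)" for i
  proof -
    have "T (u i - a + a) = T (u i - a) + T a"
      using T u E.diff_mem unfolding linear_op_def by blast
    then show ?thesis by simp
  qed
  then have le: "vnorm gF p (T (u i) - T a) \<le> c * vnorm gE q (u i - a)" for i
    using qc[of "u i - a"] u by (simp add: E.diff_mem)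
  have "((\<lambda>i. c * vnorm gE q (u i - a)) \<longlongrightarrow> 0) G"
    using u(1) q unfolding ve_tendsto_def by (intro tendsto_mult_right_zero) blast
  then show "((\<lambda>i. vnorm gF p (T (u i) - T a)) \<longlongrightarrow> 0) G"
    by (rule Lim_null_comparison[rotated]) (simp add: F.vnorm_nonneg[OF p] le)
qed

section \<open>Adjointable operators\<close>

lemma linear_op_mem: "linear_op E F T \<Longrightarrow> x \<in> E \<Longrightarrow> T x \<in> F"
  unfolding linear_op_def by blast

lemma linear_op_add: "linear_op E F T \<Longrightarrow> x \<in> E \<Longrightarrow> y \<in> E \<Longrightarrow> T (x + y) = T x + T y"
  unfolding linear_op_def by blast

lemma linear_op_scaleC: "linear_op E F T \<Longrightarrow> x \<in> E \<Longrightarrow> T (c *\<^sub>C x) = c *\<^sub>C T x"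
  unfolding linear_op_def by blast

lemma linear_op_diff:
  assumes "linear_op E F T" "csubspace E" "x \<in> E" "y \<in> E"
  shows "T (x - y) = T x - T y"
  using linear_op_add[OF assms(1) complex_vector.subspace_diff[OF assms(2-4)] assms(4)] by simp

lemma linear_op_zero: "linear_op E F T \<Longrightarrow> csubspace E \<Longrightarrow> T 0 = 0"
  using linear_op_diff[of E F T 0 0] complex_vector.subspace_0[of E] by simp

lemma linear_op_sum:
  assumes "linear_op E F T" "csubspace E" "\<And>i. i \<in> I \<Longrightarrow> f i \<in> E"
  shows "T (sum f I) = (\<Sum>i\<in>I. T (f i))"
  using assms(3)
proof (induction I rule: infinite_finite_induct)
  case (insert i I)
  then show ?case
    using linear_op_add[OF assms(1), of "f i" "sum f I"] complex_vector.subspace_sum[OF assms(2), of I f]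
    by simp
qed (simp_all add: linear_op_zero[OF assms(1,2)])

lemma adjoint_op_eqI:
  assumes "VE_space E gE" "e' \<in> E" "\<And>e. e \<in> E \<Longrightarrow> gF (T e) f = gE e e'"
  shows "adjoint_op E gE F gF T f = e'"
  unfolding adjoint_op_def
proof (rule the_equality)
  fix e'' assume *: "e'' \<in> E \<and> (\<forall>e\<in>E. gF (T e) f = gE e e'')"
  show "e'' = e'"
  proof (rule VE_space.gram_eqI[OF assms(1) _ assms(2)])
    show "e'' \<in> E" using * ..
    show "gE z e'' = gE z e'" if "z \<in> E" for z using that * assms(3)[OF that] by metis
  qed
qed (use assms in auto)

context
  fixes E :: "'e::complex_vector set" and gE :: "'e \<Rightarrow> 'e \<Rightarrow> 'z::ordered_star_space"
    and F :: "'f::complex_vector set" and gF :: "'f \<Rightarrow> 'f \<Rightarrow> 'z" and T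
  assumes E: "VE_space E gE" and T: "adjointable E gE F gF T"
begin

lemma adjointable_linear: "linear_op E F T"
  using T unfolding adjointable_def by (rule conjunct1)

lemma adjoint_op_witness:
  "\<exists>T'. linear_op F E T' \<and> (\<forall>e\<in>E. \<forall>f\<in>F. gF (T e) f = gE e (T' f)) \<and>
     (\<forall>f\<in>F. adjoint_op E gE F gF T f = T' f)"
proof -
  obtain T' where T': "linear_op F E T'" "\<forall>e\<in>E. \<forall>f\<in>F. gF (T e) f = gE e (T' f)"
    using T unfolding adjointable_def by blast
  have "adjoint_op E gE F gF T f = T' f" if "f \<in> F" for f
    using that T' by (intro adjoint_op_eqI[OF E]) (auto intro: linear_op_mem)
  with T' show ?thesis by blast
qed

lemma adjoint_op_linear:
  assumes F: "csubspace F" shows "linear_op F E (adjoint_op E gE F gF T)"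
proof -
  obtain T' where T': "linear_op F E T'" "\<And>f. f \<in> F \<Longrightarrow> adjoint_op E gE F gF T f = T' f"
    using adjoint_op_witness by blast
  show ?thesis
    using T'(1) complex_vector.subspace_add[OF F] complex_vector.subspace_scale[OF F]
    unfolding linear_op_def by (auto simp: T'(2))
qed

lemma adjoint_op_eq: "e \<in> E \<Longrightarrow> f \<in> F \<Longrightarrow> gF (T e) f = gE e (adjoint_op E gE F gF T f)"
  using adjoint_op_witness by force

end

lemma cont_adjointable_opsI:
  fixes gE :: "'e::complex_vector \<Rightarrow> 'e \<Rightarrow> 'z::admissible_space"
    and gF :: "'f::complex_vector \<Rightarrow> 'f \<Rightarrow> 'z"
  assumes E: "VE_admissible E gE" and F: "VE_admissible F gF"
    and T: "linear_op E F T" and T': "linear_op F E T'"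
    and adj: "\<And>e f. e \<in> E \<Longrightarrow> f \<in> F \<Longrightarrow> gF (T e) f = gE e (T' f)"
    and bd: "\<And>p. p \<in> cont_incr_seminorms \<Longrightarrow> \<exists>q\<in>cont_incr_seminorms. \<exists>c\<ge>0. \<forall>x\<in>E.
       vnorm gF p (T x) \<le> c * vnorm gE q x"
    and bd': "\<And>p. p \<in> cont_incr_seminorms \<Longrightarrow> \<exists>q\<in>cont_incr_seminorms. \<exists>c\<ge>0. \<forall>x\<in>F.
       vnorm gE p (T' x) \<le> c * vnorm gF q x"
  shows "T \<in> cont_adjointable_ops E gE F gF"
    and "\<And>f. f \<in> F \<Longrightarrow> adjoint_op E gE F gF T f = T' f"
proof -
  have VE: "VE_space E gE" "VE_space F gF" using E F by (auto simp: VE_admissible_def)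
  show eq: "adjoint_op E gE F gF T f = T' f" if "f \<in> F" for f
    using that T' adj by (intro adjoint_op_eqI[OF VE(1)]) (auto intro: linear_op_mem)
  have ad: "adjointable E gE F gF T" using T T' adj unfolding adjointable_def by blast
  have "\<forall>p\<in>cont_incr_seminorms. \<exists>q\<in>cont_incr_seminorms. \<exists>c\<ge>0. \<forall>x\<in>F.
       vnorm gE p (adjoint_op E gE F gF T x) \<le> c * vnorm gF q x"
    using bd' by (simp add: eq)
  then have "continuous_map (ve_topology F gF) (ve_topology E gE) (adjoint_op E gE F gF T)"
    unfolding continuous_map_iff_bounded[OF F E adjoint_op_linear[OF VE(1) ad VE_space.subspace[OF VE(2)]]] .
  moreover have "continuous_map (ve_topology E gE) (ve_topology F gF) T"
    unfolding continuous_map_iff_bounded[OF E F T] using bd by blast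
  ultimately show "T \<in> cont_adjointable_ops E gE F gF"
    using ad by (simp add: cont_adjointable_ops_def)
qed

lemma cont_adjointable_ops_bounded:
  fixes gE :: "'e::complex_vector \<Rightarrow> 'e \<Rightarrow> 'z::admissible_space"
    and gF :: "'f::complex_vector \<Rightarrow> 'f \<Rightarrow> 'z"
  assumes E: "VE_admissible E gE" and F: "VE_admissible F gF"
    and T: "T \<in> cont_adjointable_ops E gE F gF" and p: "p \<in> cont_incr_seminorms"
  shows "\<exists>q\<in>cont_incr_seminorms. \<exists>c\<ge>0. \<forall>x\<in>E. vnorm gF p (T x) \<le> c * vnorm gE q x"
    and "\<exists>q\<in>cont_incr_seminorms. \<exists>c\<ge>0. \<forall>x\<in>F. vnorm gE p (adjoint_op E gE F gF T x) \<le> c * vnorm gF q x"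
proof -
  have VE: "VE_space E gE" "VE_space F gF" using E F by (auto simp: VE_admissible_def)
  have T': "adjointable E gE F gF T" "continuous_map (ve_topology E gE) (ve_topology F gF) T"
    "continuous_map (ve_topology F gF) (ve_topology E gE) (adjoint_op E gE F gF T)"
    using T by (auto simp: cont_adjointable_ops_def)
  show "\<exists>q\<in>cont_incr_seminorms. \<exists>c\<ge>0. \<forall>x\<in>E. vnorm gF p (T x) \<le> c * vnorm gE q x"
    using T'(2)[unfolded continuous_map_iff_bounded[OF E F adjointable_linear[OF VE(1) T'(1)]]] p by (rule bspec)
  show "\<exists>q\<in>cont_incr_seminorms. \<exists>c\<ge>0. \<forall>x\<in>F. vnorm gE p (adjoint_op E gE F gF T x) \<le> c * vnorm gF q x"
    using T'(3)[unfolded continuous_map_iff_bounded[OF F E adjoint_op_linear[OF VE(1) T'(1) VE_space.subspace[OF VE(2)]]]] p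
    by (rule bspec)
qed

lemma (in VE_space) gram_sum_sum:
  assumes "\<And>i. i \<in> I \<Longrightarrow> f i \<in> E"
  shows "gram (sum f I) (sum f I) = (\<Sum>i\<in>I. \<Sum>j\<in>I. gram (f i) (f j))"
proof -
  have "gram (sum f I) (sum f I) = (\<Sum>i\<in>I. gram (f i) (sum f I))"
    using assms by (intro gram_sum_left sum_mem) auto
  also have "\<dots> = (\<Sum>i\<in>I. \<Sum>j\<in>I. gram (f i) (f j))"
    using assms by (intro sum.cong refl gram_sum_right) auto
  finally show ?thesis .
qed

lemma (in VE_admissible) square_bound:
  assumes p: "p \<in> cont_incr_seminorms" and q: "q \<in> cont_incr_seminorms" and c: "0 \<le> c"
    and "vnorm g' p y \<le> c * vnorm gram q x"
  shows "p (g' y y) \<le> c\<^sup>2 * q (gram x x)"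
proof -
  have "p (g' y y) = (vnorm g' p y)\<^sup>2" by (simp add: vnorm_def cis_nonneg[OF p])
  also have "\<dots> \<le> (c * vnorm gram q x)\<^sup>2"
    using assms by (intro power_mono) (auto simp: vnorm_def cis_nonneg[OF p])
  also have "\<dots> = c\<^sup>2 * q (gram x x)" by (simp add: power_mult_distrib vnorm_sq[OF q])
  finally show ?thesis .
qed

section \<open>Kernels with a linearisation\<close>

locale VH_kernel = H: VH_space UNIV gH
  for gH :: "'h::complex_vector \<Rightarrow> 'h \<Rightarrow> 'z::admissible_space" +
  fixes k :: "'x \<Rightarrow> 'x \<Rightarrow> 'h \<Rightarrow> 'h"
  assumes kernel_ops: "k x y \<in> cont_adjointable_ops UNIV gH UNIV gH"
begin

lemma H_admissible: "VE_admissible UNIV gH"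
  by (rule H.VE_admissible_axioms)

lemma kernel_adjointable: "adjointable UNIV gH UNIV gH (k x y)"
  using kernel_ops by (simp add: cont_adjointable_ops_def)

lemmas kernel_linear = adjointable_linear[OF H.VE_space_axioms kernel_adjointable]

end

locale linearised_kernel = VH_kernel gH k + K: VH_space K gK
  for gH :: "'h::complex_vector \<Rightarrow> 'h \<Rightarrow> 'z::admissible_space"
    and k :: "'x \<Rightarrow> 'x \<Rightarrow> 'h \<Rightarrow> 'h"
    and K :: "'k::complex_vector set" and gK :: "'k \<Rightarrow> 'k \<Rightarrow> 'z" +
  fixes V :: "'x \<Rightarrow> 'h \<Rightarrow> 'k"
  assumes V_ops: "V x \<in> cont_adjointable_ops UNIV gH K gK"
    and kernel_factor: "k x y h = adjoint_op UNIV gH K gK (V x) (V y h)"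
begin

abbreviation Vs :: "'x \<Rightarrow> 'k \<Rightarrow> 'h" where "Vs x \<equiv> adjoint_op UNIV gH K gK (V x)"

lemma V_adjointable: "adjointable UNIV gH K gK (V x)"
  using V_ops by (simp add: cont_adjointable_ops_def)

lemmas V_linear = adjointable_linear[OF H.VE_space_axioms V_adjointable]
lemmas Vs_linear = adjoint_op_linear[OF H.VE_space_axioms V_adjointable K.subspace]

lemma V_mem: "V x h \<in> K"
  using V_linear by (rule linear_op_mem) simp

lemma gram_V_left: "f \<in> K \<Longrightarrow> gK (V x h) f = gH h (Vs x f)"
  by (rule adjoint_op_eq[OF H.VE_space_axioms V_adjointable]) simp_all

lemma gram_V_right: "f \<in> K \<Longrightarrow> gK f (V x h) = gH (Vs x f) h"
  using gram_V_left[of f x h] K.gram_star[of f "V x h"] H.gram_star[of "Vs x f" h] V_mem by simp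

lemma gram_kernel: "gH (k x y h) g = gK (V y h) (V x g)"
  by (simp add: kernel_factor gram_V_right V_mem)

text \<open>The reason why the kernel conditions are necessary: their double sums are gramians of one vector.\<close>

lemma gram_kernel_sum:
  fixes n :: nat
  defines "w \<equiv> \<lambda>x h. \<Sum>i<n. V (x i) (h i)"
  shows "(\<Sum>i<n. \<Sum>j<n. gH (k (x i) (x j) (h j)) (h i)) = gK (w x h) (w x h)"
    and "w x h \<in> K"
proof -
  show "w x h \<in> K" by (simp add: w_def K.sum_mem V_mem)
  have "(\<Sum>i<n. \<Sum>j<n. gH (k (x i) (x j) (h j)) (h i)) = (\<Sum>j<n. \<Sum>i<n. gK (V (x j) (h j)) (V (x i) (h i)))"
    unfolding gram_kernel by (rule sum.swap)
  also have "\<dots> = gK (w x h) (w x h)"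
    unfolding w_def by (rule K.gram_sum_sum[symmetric]) (rule V_mem)
  finally show "(\<Sum>i<n. \<Sum>j<n. gH (k (x i) (x j) (h j)) (h i)) = gK (w x h) (w x h)" .
qed

lemma hermitian: "hermitian_kernel gH k"
  unfolding hermitian_kernel_def
proof (intro allI ext)
  fix x y h
  have "gH (k y x e) h = gH e (k x y h)" for e
    using K.gram_star[of "V x e" "V y h"] H.gram_star[of e "k x y h"] V_mem
    by (simp add: gram_kernel)
  then show "k x y h = adjoint_op UNIV gH UNIV gH (k y x) h"
    by (intro adjoint_op_eqI[OF H.VE_space_axioms, symmetric]) auto
qed

lemma psd: "psd_kernel gH k"
  unfolding psd_kernel_def gram_kernel_sum(1) using gram_kernel_sum(2) K.gram_nonneg by blast

lemma b2: "cond_b2 gH k"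
  unfolding cond_b2_def
proof (intro allI ballI)
  fix x :: 'x and p :: "'z \<Rightarrow> real" assume p: "p \<in> cont_incr_seminorms"
  from cont_adjointable_ops_bounded(2)[OF H_admissible K.VE_admissible_axioms V_ops p, of x]
  obtain q c where q: "q \<in> cont_incr_seminorms" and c: "0 \<le> c"
    and qc: "\<And>f. f \<in> K \<Longrightarrow> vnorm gH p (Vs x f) \<le> c * vnorm gK q f"
    by (elim bexE exE conjE) (rule that; blast)
  have "p (\<Sum>i<n. \<Sum>j<n. gH (k x (y i) (h i)) (k x (y j) (h j)))
      \<le> c\<^sup>2 * q (\<Sum>i<n. \<Sum>j<n. gH (k (y j) (y i) (h i)) (h j))" for n :: nat and y h
  proof -
    let ?w = "\<Sum>i<n. V (y i) (h i)"
    have Vw: "Vs x ?w = (\<Sum>i<n. k x (y i) (h i))"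
      by (simp add: linear_op_sum[OF Vs_linear K.subspace] V_mem kernel_factor)
    have "(\<Sum>i<n. \<Sum>j<n. gH (k x (y i) (h i)) (k x (y j) (h j))) = gH (Vs x ?w) (Vs x ?w)"
      unfolding Vw by (rule H.gram_sum_sum[symmetric]) simp
    moreover have "(\<Sum>i<n. \<Sum>j<n. gH (k (y j) (y i) (h i)) (h j)) = gK ?w ?w"
      by (subst sum.swap) (rule gram_kernel_sum(1))
    ultimately show ?thesis
      using K.square_bound[OF p q c qc[OF gram_kernel_sum(2)[where x = y and h = h and n = n]]]
      by simp
  qed
  then show "\<exists>q\<in>cont_incr_seminorms. \<exists>c\<ge>0. \<forall>(n::nat) y h.
      p (\<Sum>i<n. \<Sum>j<n. gH (k x (y i) (h i)) (k x (y j) (h j)))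
      \<le> c * q (\<Sum>i<n. \<Sum>j<n. gH (k (y j) (y i) (h i)) (h j))"
    using q by (intro bexI[of _ q] exI[of _ "c\<^sup>2"]) auto
qed

context
  fixes act :: "'g::star_semigroup \<Rightarrow> 'x \<Rightarrow> 'x" and \<pi> :: "'g \<Rightarrow> 'k \<Rightarrow> 'k"
  assumes rep: "star_representation K gK \<pi>" and equivariant: "V (act \<xi> x) h = \<pi> \<xi> (V x h)"
begin

lemma rep_ops: "\<pi> \<xi> \<in> cont_adjointable_ops K gK K gK"
  using rep by (simp add: star_representation_def)

lemma rep_adjointable: "adjointable K gK K gK (\<pi> \<xi>)"
  using rep_ops by (simp add: cont_adjointable_ops_def)

lemmas rep_linear = adjointable_linear[OF K.VE_space_axioms rep_adjointable]

lemma gram_rep: "f \<in> K \<Longrightarrow> g \<in> K \<Longrightarrow> gK (\<pi> \<xi> f) g = gK f (\<pi> (star \<xi>) g)"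
  using adjoint_op_eq[OF K.VE_space_axioms rep_adjointable] rep by (simp add: star_representation_def)

text \<open>\<open>V(x)\<^sup>* \<pi>(\<xi>) = (\<pi>(\<xi>\<^sup>*) V(x))\<^sup>* = V(\<xi>\<^sup>* x)\<^sup>*\<close>. For a reproducing kernel space, where \<open>V(x)\<^sup>*\<close> is
  evaluation, this determines the representation.\<close>

lemma Vs_rep: "f \<in> K \<Longrightarrow> Vs x (\<pi> \<xi> f) = Vs (act (star \<xi>) x) f"
proof (rule H.gram_eqI)
  fix h assume f: "f \<in> K"
  have "gH h (Vs x (\<pi> \<xi> f)) = gK (V x h) (\<pi> (star (star \<xi>)) f)"
    using f by (simp add: gram_V_left[symmetric] linear_op_mem[OF rep_linear] star_star)
  also have "\<dots> = gK (V (act (star \<xi>) x) h) f"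
    unfolding equivariant by (rule gram_rep[symmetric, OF V_mem f])
  also have "\<dots> = gH h (Vs (act (star \<xi>) x) f)" using f by (rule gram_V_left)
  finally show "gH h (Vs x (\<pi> \<xi> f)) = gH h (Vs (act (star \<xi>) x) f)" .
qed simp_all

lemma invariant: "invariant_kernel act k"
  unfolding invariant_kernel_def by (auto simp: fun_eq_iff kernel_factor equivariant Vs_rep V_mem)

lemma b1: "cond_b1 act gH k"
  unfolding cond_b1_def
proof (intro allI ballI)
  fix \<xi> :: 'g and p :: "'z \<Rightarrow> real" assume p: "p \<in> cont_incr_seminorms"
  from cont_adjointable_ops_bounded(1)[OF K.VE_admissible_axioms K.VE_admissible_axioms rep_ops p, of \<xi>]
  obtain q c where q: "q \<in> cont_incr_seminorms" and c: "0 \<le> c"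
    and qc: "\<And>f. f \<in> K \<Longrightarrow> vnorm gK p (\<pi> \<xi> f) \<le> c * vnorm gK q f"
    by (elim bexE exE conjE) (rule that; blast)
  have "p (\<Sum>i<n. \<Sum>j<n. gH (k (act \<xi> (x i)) (act \<xi> (x j)) (h j)) (h i))
      \<le> c\<^sup>2 * q (\<Sum>i<n. \<Sum>j<n. gH (k (x i) (x j) (h j)) (h i))" for n :: nat and h x
  proof -
    let ?w = "\<Sum>i<n. V (x i) (h i)"
    have "\<pi> \<xi> ?w = (\<Sum>i<n. V (act \<xi> (x i)) (h i))"
      by (simp add: linear_op_sum[OF rep_linear K.subspace] V_mem equivariant)
    with K.square_bound[OF p q c qc[OF gram_kernel_sum(2)[where x = x and h = h and n = n]]]
    show ?thesis unfolding gram_kernel_sum(1) by simp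
  qed
  then show "\<exists>q\<in>cont_incr_seminorms. \<exists>c\<ge>0. \<forall>(n::nat) h x.
      p (\<Sum>i<n. \<Sum>j<n. gH (k (act \<xi> (x i)) (act \<xi> (x j)) (h j)) (h i))
      \<le> c * q (\<Sum>i<n. \<Sum>j<n. gH (k (x i) (x j) (h j)) (h i))"
    using q by (intro bexI[of _ q] exI[of _ "c\<^sup>2"]) auto
qed

end

end

lemma (in VH_kernel) linearised_kernel_iff:
  "linearisation gH k K gK V \<longleftrightarrow> linearised_kernel gH k K gK V"
proof
  assume "linearisation gH k K gK V"
  then have "VH_space K gK" "\<And>x. V x \<in> cont_adjointable_ops UNIV gH K gK"
    "\<And>x y h. k x y h = adjoint_op UNIV gH K gK (V x) (V y h)"
    by (simp_all add: linearisation_def)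
  then show "linearised_kernel gH k K gK V"
    by (intro linearised_kernel.intro linearised_kernel_axioms.intro VH_kernel_axioms)
next
  assume "linearised_kernel gH k K gK V"
  then interpret linearised_kernel gH k K gK V .
  show "linearisation gH k K gK V"
    unfolding linearisation_def using K.VH_space_axioms V_ops kernel_factor by simp
qed

lemma (in VH_kernel) invariant_linearisation_imp_positivity:
  assumes "invariant_linearisation act gH k K gK \<pi> V"
  shows "psd_kernel gH k \<and> invariant_kernel act k \<and> cond_b1 act gH k \<and> cond_b2 gH k"
proof -
  interpret linearised_kernel gH k K gK V
    using assms by (simp add: invariant_linearisation_def linearised_kernel_iff)
  have "star_representation K gK \<pi>" "\<And>\<xi> x h. V (act \<xi> x) h = \<pi> \<xi> (V x h)"
    using assms by (simp_all add: invariant_linearisation_def)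
  then show ?thesis using psd b2 invariant b1 by blast
qed

section \<open>Reproducing kernel spaces\<close>

locale rk_space = VH_kernel gH k + R: VH_space R gR
  for gH :: "'h::complex_vector \<Rightarrow> 'h \<Rightarrow> 'z::admissible_space"
    and k :: "'x \<Rightarrow> 'x \<Rightarrow> 'h \<Rightarrow> 'h"
    and R :: "('x \<Rightarrow> 'h) set" and gR :: "('x \<Rightarrow> 'h) \<Rightarrow> ('x \<Rightarrow> 'h) \<Rightarrow> 'z" +
  assumes section_mem: "kernel_section k x h \<in> R"
    and reproducing: "f \<in> R \<Longrightarrow> gH (f x) h = gR f (kernel_section k x h)"
    and continuous_eval: "continuous_map (ve_topology R gR) (ve_topology UNIV gH) (\<lambda>f. f x)"
begin

lemma eval_linear: "linear_op R UNIV (\<lambda>f. f x)"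
  by (simp add: linear_op_def scaleC_fun_def)

lemma section_linear: "linear_op UNIV R (kernel_section k x)"
  using section_mem linear_op_add[OF kernel_linear] linear_op_scaleC[OF kernel_linear]
  by (auto simp: linear_op_def kernel_section_def fun_eq_iff scaleC_fun_def)

lemma section_adjoint: "f \<in> R \<Longrightarrow> gR (kernel_section k x h) f = gH h (f x)"
  using reproducing[of f x h] R.gram_star[of "kernel_section k x h" f] H.gram_star[of h "f x"] section_mem
  by simp

lemma eval_bounded:
  "p \<in> cont_incr_seminorms \<Longrightarrow> \<exists>q\<in>cont_incr_seminorms. \<exists>c\<ge>0. \<forall>f\<in>R. vnorm gH p (f x) \<le> c * vnorm gR q f"
  using continuous_eval[unfolded continuous_map_iff_bounded[OF R.VE_admissible_axioms H_admissible eval_linear]]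
  by (rule bspec)

text \<open>\<open>[k\<^sub>x h, k\<^sub>x h] = [k(x,x) h, h]\<close>, so the continuity of \<open>k(x,x)\<close> and the Schwarz inequality give the bound.\<close>

lemma section_bounded:
  assumes p: "p \<in> cont_incr_seminorms"
  shows "\<exists>q\<in>cont_incr_seminorms. \<exists>c\<ge>0. \<forall>h\<in>UNIV. vnorm gR p (kernel_section k x h) \<le> c * vnorm gH q h"
proof -
  from cont_adjointable_ops_bounded(1)[OF H_admissible H_admissible kernel_ops p, of x x]
  obtain q c where q: "q \<in> cont_incr_seminorms" and c: "0 \<le> c"
    and qc: "\<And>h. vnorm gH p (k x x h) \<le> c * vnorm gH q h"
    by (elim bexE exE conjE) (rule that; blast)
  let ?r = "\<lambda>z. p z + q z"
  have r: "?r \<in> cont_incr_seminorms" using p q by (rule cis_plus)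
  have "p \<le> ?r" "q \<le> ?r" using cis_nonneg p q by (auto simp: le_fun_def)
  then have le: "vnorm gH p h \<le> vnorm gH ?r h" "vnorm gH q h \<le> vnorm gH ?r h" for h
    by (simp_all add: H.vnorm_mono)
  have "vnorm gR p (kernel_section k x h) \<le> sqrt (4 * c) * vnorm gH ?r h" for h
  proof -
    have "p (gR (kernel_section k x h) (kernel_section k x h)) = p (gH (k x x h) h)"
      by (simp add: reproducing[symmetric] section_mem) (simp add: kernel_section_def)
    also have "\<dots> \<le> 4 * vnorm gH p (k x x h) * vnorm gH p h"
      using p by (intro H.schwarz) auto
    also have "\<dots> \<le> 4 * (c * vnorm gH q h) * vnorm gH p h"
      using qc[of h] H.vnorm_nonneg[OF p, of h] by (intro mult_right_mono) auto
    also have "\<dots> \<le> 4 * (c * vnorm gH ?r h) * vnorm gH ?r h"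
      using le[of h] c H.vnorm_nonneg[OF p, of h] H.vnorm_nonneg[OF q, of h] H.vnorm_nonneg[OF r, of h]
      by (intro mult_mono mult_left_mono) auto
    also have "\<dots> = 4 * c * (vnorm gH ?r h)\<^sup>2" by (simp add: power2_eq_square)
    finally have "vnorm gR p (kernel_section k x h) \<le> sqrt (4 * c * (vnorm gH ?r h)\<^sup>2)"
      unfolding vnorm_def[of gR] by (rule real_sqrt_le_mono)
    then show ?thesis using H.vnorm_nonneg[OF r, of h] by (simp add: real_sqrt_mult)
  qed
  moreover have "0 \<le> sqrt (4 * c)" using c by simp
  ultimately show ?thesis using r by blast
qed

lemma section_ops: "kernel_section k x \<in> cont_adjointable_ops UNIV gH R gR"
  by (rule cont_adjointable_opsI(1)[OF H_admissible R.VE_admissible_axioms section_linear[of x] eval_linear[of x]])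
    (rule section_adjoint section_bounded eval_bounded, assumption)+

lemma section_adjoint_op: "f \<in> R \<Longrightarrow> adjoint_op UNIV gH R gR (kernel_section k x) f = f x"
  by (rule cont_adjointable_opsI(2)[OF H_admissible R.VE_admissible_axioms section_linear[of x] eval_linear[of x]])
    (rule section_adjoint section_bounded eval_bounded, assumption | assumption)+

sublocale linearised_kernel gH k R gR "kernel_section k"
  by unfold_locales
    (simp_all add: section_ops section_adjoint_op section_mem, simp add: kernel_section_def)

end

lemma (in VH_kernel) rk_space_iff:
  "reproducing_kernel_VH_space gH k R gR \<longleftrightarrow> rk_space gH k R gR"
proof
  assume "reproducing_kernel_VH_space gH k R gR"
  then show "rk_space gH k R gR"
    unfolding reproducing_kernel_VH_space_def
    by (intro rk_space.intro rk_space_axioms.intro VH_kernel_axioms) simp_all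
next
  assume "rk_space gH k R gR"
  then interpret rk_space gH k R gR .
  show "reproducing_kernel_VH_space gH k R gR"
    unfolding reproducing_kernel_VH_space_def
    using hermitian R.VH_space_axioms section_mem reproducing continuous_eval by blast
qed

lemma (in VH_kernel) rk_pair_invariant_linearisation:
  assumes "invariant_rk_pair act gH k R gR \<rho>"
  shows "invariant_linearisation act gH k R gR \<rho> (kernel_section k)"
proof -
  interpret rk_space gH k R gR
    using assms by (simp add: invariant_rk_pair_def rk_space_iff)
  show ?thesis
    using assms linearised_kernel_axioms
    by (simp add: invariant_rk_pair_def invariant_linearisation_def linearised_kernel_iff)
qed

lemma (in VH_kernel) rk_pair_representation:
  assumes "invariant_rk_pair act gH k R gR \<rho>" and f: "f \<in> R"
  shows "\<rho> \<xi> f = (\<lambda>x. f (act (star \<xi>) x))"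
proof
  fix x
  interpret rk_space gH k R gR
    using assms by (simp add: invariant_rk_pair_def rk_space_iff)
  have rep: "star_representation R gR \<rho>"
    and eq: "\<And>\<xi> x h. kernel_section k (act \<xi> x) h = \<rho> \<xi> (kernel_section k x h)"
    using assms by (simp_all add: invariant_rk_pair_def)
  show "\<rho> \<xi> f x = f (act (star \<xi>) x)"
    using Vs_rep[OF rep eq f, of x \<xi>] linear_op_mem[OF rep_linear[OF rep eq] f] f
    by (simp add: section_adjoint_op)
qed

text \<open>Centres inside \<open>D\<close> allow the Cauchy property to be transferred between two spaces whose gramians agree
  only on \<open>D\<close>.\<close>

lemma ve_cauchy_center:
  assumes VE: "VE_admissible E g" and F: "F \<noteq> bot" and u: "\<And>i. u i \<in> D" "D \<subseteq> E"
    and c: "ve_cauchy E g u F" and p: "p \<in> cont_incr_seminorms" and e: "0 < e"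
  shows "\<exists>a\<in>D. \<forall>\<^sub>F i in F. vnorm g p (u i - a) < e"
proof -
  interpret VE_admissible E g by fact
  have uE: "u i \<in> E" for i using u by blast
  obtain a where a: "a \<in> E" "\<forall>\<^sub>F i in F. vnorm g p (u i - a) < e / 2"
    using c[unfolded ve_cauchy_def, rule_format, OF p half_gt_zero[OF e]] by (elim bexE)
  obtain j where j: "vnorm g p (u j - a) < e / 2" using eventually_happens'[OF F a(2)] by blast
  from a(2) have "\<forall>\<^sub>F i in F. vnorm g p (u i - u j) < e"
  proof eventually_elim
    case (elim i)
    then show ?case
      using vnorm_triangle[OF p uE a(1) uE, of i j] vnorm_minus_commute[OF p uE a(1), of j] j by linarith
  qed
  then show ?thesis using u(1) by blast
qed

locale two_rk_spaces = R: rk_space gH k R gR + R': rk_space gH k R' gR'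
  for gH :: "'h::complex_vector \<Rightarrow> 'h \<Rightarrow> 'z::admissible_space"
    and k :: "'x \<Rightarrow> 'x \<Rightarrow> 'h \<Rightarrow> 'h" and R gR R' gR'
begin

abbreviation "D \<equiv> cspan {kernel_section k x h | x h. True}"

lemma D_subset: "D \<subseteq> R" "D \<subseteq> R'"
  by (rule complex_vector.span_minimal[OF _ R.R.subspace], use R.section_mem in blast)
    (rule complex_vector.span_minimal[OF _ R'.R.subspace], use R'.section_mem in blast)

text \<open>Only one argument has to lie in the span: both gramians are then given by the values of \<open>f\<close>.\<close>

lemma gram_agree_D:
  assumes f: "f \<in> R" "f \<in> R'" and b: "b \<in> D" shows "gR f b = gR' f b"
proof -
  let ?S = "{b. b \<in> R \<and> b \<in> R' \<and> gR f b = gR' f b}"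
  have "D \<subseteq> ?S"
  proof (rule complex_vector.span_minimal)
    show "{kernel_section k x h | x h. True} \<subseteq> ?S"
      using R.section_mem R'.section_mem R.reproducing[OF f(1)] R'.reproducing[OF f(2)] by auto
    show "csubspace ?S"
      using f by (intro complex_vector.subspaceI)
        (auto simp: R.R.zero_mem R'.R.zero_mem R.R.gram_zero_right R'.R.gram_zero_right
          R.R.add_mem R'.R.add_mem R.R.gram_add_right R'.R.gram_add_right
          R.R.scaleC_mem R'.R.scaleC_mem R.R.gram_scaleC_right R'.R.gram_scaleC_right)
  qed
  then show ?thesis using b by blast
qed

lemma vnorm_agree_D: "a \<in> D \<Longrightarrow> b \<in> D \<Longrightarrow> vnorm gR p (a - b) = vnorm gR' p (a - b)"
  unfolding vnorm_def using gram_agree_D[OF subsetD[OF D_subset(1)] subsetD[OF D_subset(2)], of "a - b" "a - b"]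
  by (simp add: complex_vector.span_diff)

context
  assumes dense: "ve_topology R gR closure_of D = R"
begin

text \<open>The net that approximates \<open>f\<close> in \<open>R\<close> is Cauchy in \<open>R'\<close>; its limit there is \<open>f\<close> again, since both limits
  are pointwise limits.\<close>

lemma approximation:
  assumes f: "f \<in> R"
  obtains u :: "('z \<Rightarrow> real) \<Rightarrow> 'x \<Rightarrow> 'h" where "\<And>q. u q \<in> D" "ve_tendsto gR u f seminorm_filter"
    "ve_tendsto gR' u f seminorm_filter" "f \<in> R'"
proof -
  have "f \<in> ve_topology R gR closure_of D" using f dense by simp
  then obtain u :: "('z \<Rightarrow> real) \<Rightarrow> 'x \<Rightarrow> 'h"
    where u: "\<And>q. u q \<in> D" and uf: "ve_tendsto gR u f seminorm_filter"
    by (rule R.R.dense_net[OF D_subset(1)]) (rule that; simp)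
  have uR: "u q \<in> R" "u q \<in> R'" for q using subsetD[OF D_subset(1) u] subsetD[OF D_subset(2) u] by blast+
  have "ve_cauchy R' gR' u seminorm_filter"
    unfolding ve_cauchy_def
  proof (intro ballI allI impI)
    fix p :: "'z \<Rightarrow> real" and e :: real assume p: "p \<in> cont_incr_seminorms" and e: "0 < e"
    obtain a where a: "a \<in> D" "\<forall>\<^sub>F q in seminorm_filter. vnorm gR p (u q - a) < e"
      using ve_cauchy_center[OF R.R.VE_admissible_axioms seminorm_filter_neq_bot u D_subset(1)
          R.R.ve_tendsto_imp_cauchy[OF f uf] p e] by (elim bexE)
    then show "\<exists>a\<in>R'. \<forall>\<^sub>F q in seminorm_filter. vnorm gR' p (u q - a) < e"
      by (intro bexI[OF _ subsetD[OF D_subset(2) a(1)]]) (simp add: vnorm_agree_D[OF u a(1)])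
  qed
  then obtain f' where f': "f' \<in> R'" "ve_tendsto gR' u f' seminorm_filter"
    by (rule R'.R.cauchy_net_converges[OF seminorm_filter_neq_bot uR(2)])
  have "f x = f' x" for x
    using continuous_ve_tendsto[OF R.R.VE_admissible_axioms R.H_admissible R.eval_linear R.continuous_eval uf uR(1) f]
      continuous_ve_tendsto[OF R'.R.VE_admissible_axioms R.H_admissible R'.eval_linear R'.continuous_eval f'(2) uR(2) f'(1)]
    by (rule R.H.ve_tendsto_unique[OF seminorm_filter_neq_bot]) simp_all
  then have "f = f'" ..
  with u uf f' show thesis by (intro that[of u]) simp_all
qed

lemma minimal_subset: "R \<subseteq> R'"
  by (rule subsetI) (erule approximation)

lemma minimal_gram:
  assumes f: "f \<in> R" and g: "g \<in> R" shows "gR f g = gR' f g"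
proof -
  obtain u :: "('z \<Rightarrow> real) \<Rightarrow> 'x \<Rightarrow> 'h" where u: "\<And>q. u q \<in> D" "ve_tendsto gR u f seminorm_filter" "ve_tendsto gR' u f seminorm_filter"
    by (rule approximation[OF f]) (rule that; simp)
  obtain v :: "('z \<Rightarrow> real) \<Rightarrow> 'x \<Rightarrow> 'h" where v: "\<And>q. v q \<in> D" "ve_tendsto gR v g seminorm_filter" "ve_tendsto gR' v g seminorm_filter"
    by (rule approximation[OF g]) (rule that; simp)
  have uv: "u q \<in> R" "u q \<in> R'" "v q \<in> R" "v q \<in> R'" for q
    using subsetD[OF D_subset(1) u(1)] subsetD[OF D_subset(2) u(1)]
      subsetD[OF D_subset(1) v(1)] subsetD[OF D_subset(2) v(1)] by blast+
  have fg: "f \<in> R'" "g \<in> R'" using subsetD[OF minimal_subset] f g by blast+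
  have agree: "gR (u q) (v q) = gR' (u q) (v q)" for q
    using uv v by (intro gram_agree_D)
  have "((\<lambda>q. gR (u q) (v q)) \<longlongrightarrow> gR f g) seminorm_filter"
    using u(2) uv(1) f v(2) uv(3) g by (rule R.R.tendsto_gram)
  then have "((\<lambda>q. gR' (u q) (v q)) \<longlongrightarrow> gR f g) seminorm_filter" unfolding agree .
  moreover have "((\<lambda>q. gR' (u q) (v q)) \<longlongrightarrow> gR' f g) seminorm_filter"
    using u(3) uv(2) fg(1) v(3) uv(4) fg(2) by (rule R'.R.tendsto_gram)
  ultimately show ?thesis by (rule tendsto_unique[OF seminorm_filter_neq_bot])
qed

end

end

section \<open>Uniqueness of minimal linearisations\<close>

context VH_space
begin

context
  fixes \<Phi> :: "'e \<Rightarrow> 'f::complex_vector"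
  assumes lin: "linear_op E UNIV \<Phi>" and inj: "inj_on \<Phi> E"
begin

definition image_gram :: "'f \<Rightarrow> 'f \<Rightarrow> 'z" where
  "image_gram a b = gram (inv_into E \<Phi> a) (inv_into E \<Phi> b)"

lemma image_gram: "f \<in> E \<Longrightarrow> g \<in> E \<Longrightarrow> image_gram (\<Phi> f) (\<Phi> g) = gram f g"
  by (simp add: image_gram_def inv_into_f_f[OF inj])

lemma image_vnorm_diff:
  assumes "f \<in> E" "g \<in> E" shows "vnorm image_gram p (\<Phi> f - \<Phi> g) = vnorm gram p (f - g)"
  using assms by (simp add: vnorm_def image_gram diff_mem flip: linear_op_diff[OF lin subspace])

lemma image_VE_space: "VE_space (\<Phi> ` E) image_gram"
proof
  show "csubspace (\<Phi> ` E)"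
  proof (rule complex_vector.subspaceI)
    show "0 \<in> \<Phi> ` E" using linear_op_zero[OF lin subspace] zero_mem by (metis imageI)
    show "x + y \<in> \<Phi> ` E" if xy: "x \<in> \<Phi> ` E" "y \<in> \<Phi> ` E" for x y
    proof -
      obtain f g where "f \<in> E" "g \<in> E" "x = \<Phi> f" "y = \<Phi> g" using xy by blast
      then show ?thesis using linear_op_add[OF lin] add_mem by (metis imageI)
    qed
    show "c *\<^sub>C x \<in> \<Phi> ` E" if x: "x \<in> \<Phi> ` E" for c x
    proof -
      obtain f where "f \<in> E" "x = \<Phi> f" using x by blast
      then show ?thesis using linear_op_scaleC[OF lin] scaleC_mem by (metis imageI)
    qed
  qed
next
  fix x y z assume "x \<in> \<Phi> ` E" "y \<in> \<Phi> ` E" "z \<in> \<Phi> ` E"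
  then obtain f g h where fgh: "f \<in> E" "x = \<Phi> f" "g \<in> E" "y = \<Phi> g" "h \<in> E" "z = \<Phi> h" by blast
  then show "image_gram x (y + z) = image_gram x y + image_gram x z"
    by (simp add: image_gram add_mem gram_add_right flip: linear_op_add[OF lin])
next
  fix x y c assume "x \<in> \<Phi> ` E" "y \<in> \<Phi> ` E"
  then obtain f g where fg: "f \<in> E" "x = \<Phi> f" "g \<in> E" "y = \<Phi> g" by blast
  then show "image_gram x (c *\<^sub>C y) = c *\<^sub>C image_gram x y"
    by (simp add: image_gram scaleC_mem gram_scaleC_right flip: linear_op_scaleC[OF lin])
  show "image_gram x y = star (image_gram y x)"
    using fg gram_star[of f g] by (simp add: image_gram)
next
  fix x assume "x \<in> \<Phi> ` E"
  then obtain f where f: "f \<in> E" "x = \<Phi> f" by blast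
  then show "0 \<le> image_gram x x" by (simp add: image_gram gram_nonneg)
  have "\<Phi> f = 0 \<longleftrightarrow> f = 0"
    using inj_on_eq_iff[OF inj f(1) zero_mem] linear_op_zero[OF lin subspace] by simp
  then show "image_gram x x = 0 \<longleftrightarrow> x = 0" using f by (simp add: image_gram gram_eq_0_iff)
qed

lemma image_VH_space: "VH_space (\<Phi> ` E) image_gram"
proof -
  interpret I: VE_admissible "\<Phi> ` E" image_gram by (intro VE_admissible.intro image_VE_space)
  show ?thesis
  proof (rule I.VH_spaceI[OF order_refl])
    show "\<Phi> ` E \<subseteq> ve_topology (\<Phi> ` E) image_gram closure_of \<Phi> ` E"
      by (rule closure_of_subset) (simp add: I.topspace_ve_topology)
    fix u :: "('z \<Rightarrow> real) \<Rightarrow> 'f"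
    assume u: "\<And>q. u q \<in> \<Phi> ` E" and c: "ve_cauchy (\<Phi> ` E) image_gram u seminorm_filter"
    define v where "v q = inv_into E \<Phi> (u q)" for q
    have v: "v q \<in> E" "u q = \<Phi> (v q)" for q
      using u[of q] by (simp_all add: v_def inv_into_into f_inv_into_f)
    have "ve_cauchy E gram v seminorm_filter"
      unfolding ve_cauchy_def
    proof (intro ballI allI impI)
      fix p :: "'z \<Rightarrow> real" and e :: real assume p: "p \<in> cont_incr_seminorms" "0 < e"
      obtain a where a: "a \<in> \<Phi> ` E" "\<forall>\<^sub>F q in seminorm_filter. vnorm image_gram p (u q - a) < e"
        using c[unfolded ve_cauchy_def, rule_format, OF p] by (elim bexE)
      from a(1) obtain b where "b \<in> E" "a = \<Phi> b" by blast
      with a(2) show "\<exists>a\<in>E. \<forall>\<^sub>F q in seminorm_filter. vnorm gram p (v q - a) < e"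
        by (intro bexI[of _ b]) (simp_all add: v image_vnorm_diff)
    qed
    then obtain l where l: "l \<in> E" "ve_tendsto gram v l seminorm_filter"
      by (rule cauchy_net_converges[OF seminorm_filter_neq_bot v(1)])
    then have "ve_tendsto image_gram u (\<Phi> l) seminorm_filter"
      unfolding ve_tendsto_def by (simp add: v image_vnorm_diff)
    with l show "\<exists>l\<in>\<Phi> ` E. ve_tendsto image_gram u l seminorm_filter" by blast
  qed
qed

end

end

context linearised_kernel
begin

text \<open>For a minimal linearisation, this is an embedding onto the minimal reproducing kernel space.\<close>

definition feature :: "'k \<Rightarrow> 'x \<Rightarrow> 'h" where
  "feature f = (\<lambda>x. Vs x f)"

lemma feature_linear: "linear_op K UNIV feature"
  using linear_op_add[OF Vs_linear] linear_op_scaleC[OF Vs_linear]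
  by (auto simp: linear_op_def feature_def fun_eq_iff scaleC_fun_def)

lemma feature_V: "feature (V x h) = kernel_section k x h"
  by (simp add: feature_def kernel_section_def kernel_factor)

context
  assumes dense: "ve_topology K gK closure_of cspan {V x h | x h. True} = K"
begin

lemma span_V_subset: "cspan {V x h | x h. True} \<subseteq> K"
  using V_mem by (intro complex_vector.span_minimal K.subspace) auto

text \<open>If \<open>V(x)\<^sup>* f = 0\<close> for all \<open>x\<close>, then \<open>f\<close> is orthogonal to the span of the vectors \<open>V(x) h\<close>, which is
  dense, hence to itself.\<close>

lemma feature_inj: "inj_on feature K"
proof -
  have zero: "f = 0" if f: "f \<in> K" and f0: "feature f = 0" for f
  proof -
    have "cspan {V x h | x h. True} \<subseteq> {g. g \<in> K \<and> gK f g = 0}"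
    proof (rule complex_vector.span_minimal)
      have "Vs x f = 0" for x using f0 by (simp add: feature_def fun_eq_iff)
      then show "{V x h | x h. True} \<subseteq> {g. g \<in> K \<and> gK f g = 0}"
        using f by (auto simp: V_mem gram_V_right H.gram_zero_left)
      show "csubspace {g. g \<in> K \<and> gK f g = 0}"
        using f by (intro complex_vector.subspaceI)
          (auto simp: K.zero_mem K.add_mem K.scaleC_mem K.gram_zero_right K.gram_add_right K.gram_scaleC_right)
    qed
    then have orth: "gK f g = 0" if "g \<in> cspan {V x h | x h. True}" for g using that by blast
    have "f \<in> ve_topology K gK closure_of cspan {V x h | x h. True}" using dense f by simp
    then obtain u :: "('z \<Rightarrow> real) \<Rightarrow> 'k" where u: "\<And>q. u q \<in> cspan {V x h | x h. True}"
      and uf: "ve_tendsto gK u f seminorm_filter"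
      by (rule K.dense_net[OF span_V_subset]) (rule that; simp)
    have uK: "u q \<in> K" for q using u span_V_subset by blast
    have "ve_tendsto gK (\<lambda>_. f) f seminorm_filter" unfolding ve_tendsto_def by (simp add: K.vnorm_zero)
    from K.tendsto_gram[OF this f f uf uK f]
    have "((\<lambda>_. 0) \<longlongrightarrow> gK f f) (seminorm_filter :: ('z \<Rightarrow> real) filter)"
      by (simp only: orth[OF u])
    from tendsto_unique[OF seminorm_filter_neq_bot this tendsto_const] have "gK f f = 0" .
    then show ?thesis using f K.gram_eq_0_iff by blast
  qed
  show ?thesis
  proof (rule inj_onI)
    fix f g assume fg: "f \<in> K" "g \<in> K" "feature f = feature g"
    then have "feature (f - g) = 0" by (simp add: linear_op_diff[OF feature_linear K.subspace])
    then show "f = g" using zero[of "f - g"] fg by (simp add: K.diff_mem)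
  qed
qed

definition feature_gram :: "('x \<Rightarrow> 'h) \<Rightarrow> ('x \<Rightarrow> 'h) \<Rightarrow> 'z" where
  "feature_gram = K.image_gram feature"

lemma feature_gram: "f \<in> K \<Longrightarrow> g \<in> K \<Longrightarrow> feature_gram (feature f) (feature g) = gK f g"
  unfolding feature_gram_def by (rule K.image_gram[OF feature_linear feature_inj])

lemma feature_rk_space: "rk_space gH k (feature ` K) feature_gram"
proof -
  interpret F: VH_space "feature ` K" feature_gram
    unfolding feature_gram_def by (rule K.image_VH_space[OF feature_linear feature_inj])
  show ?thesis
  proof
    show "kernel_section k x h \<in> feature ` K" for x h
      using V_mem[of x h] feature_V[of x h] by (metis imageI)
    show "gH (f x) h = feature_gram f (kernel_section k x h)" if "f \<in> feature ` K" for f x h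
    proof -
      from that obtain g where "g \<in> K" "f = feature g" by blast
      then show ?thesis
        by (simp add: feature_gram gram_V_right V_mem flip: feature_V) (simp add: feature_def)
    qed
    fix x
    have lin: "linear_op (feature ` K) UNIV (\<lambda>f. f x)" by (simp add: linear_op_def scaleC_fun_def)
    show "continuous_map (ve_topology (feature ` K) feature_gram) (ve_topology UNIV gH) (\<lambda>f. f x)"
      unfolding continuous_map_iff_bounded[OF F.VE_admissible_axioms H_admissible lin]
    proof
      fix p :: "'z \<Rightarrow> real" assume p: "p \<in> cont_incr_seminorms"
      from cont_adjointable_ops_bounded(2)[OF H_admissible K.VE_admissible_axioms V_ops p, of x]
      obtain q c where q: "q \<in> cont_incr_seminorms" and c: "0 \<le> c"
        and qc: "\<And>f. f \<in> K \<Longrightarrow> vnorm gH p (Vs x f) \<le> c * vnorm gK q f"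
        by (elim bexE exE conjE) (rule that; blast)
      have "\<forall>f\<in>feature ` K. vnorm gH p (f x) \<le> c * vnorm feature_gram q f"
        using qc by (auto simp: feature_def[of _] vnorm_def[of feature_gram] feature_gram[unfolded feature_def]
            vnorm_def[of gK])
      with q c show "\<exists>q\<in>cont_incr_seminorms. \<exists>c\<ge>0. \<forall>f\<in>feature ` K. vnorm gH p (f x) \<le> c * vnorm feature_gram q f"
        by blast
    qed
  qed
qed

lemma feature_dense:
  "ve_topology (feature ` K) feature_gram closure_of cspan {kernel_section k x h | x h. True} = feature ` K"
proof -
  interpret F: rk_space gH k "feature ` K" feature_gram by (rule feature_rk_space)
  let ?D = "cspan {kernel_section k x h | x h. True}" and ?C = "cspan {V x h | x h. True}"
  have D: "?D \<subseteq> feature ` K"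
    using F.section_mem by (intro complex_vector.span_minimal F.R.subspace) auto
  have "?C \<subseteq> {g. g \<in> K \<and> feature g \<in> ?D}"
  proof (rule complex_vector.span_minimal)
    show "{V x h | x h. True} \<subseteq> {g. g \<in> K \<and> feature g \<in> ?D}"
      by (auto simp: V_mem feature_V intro!: complex_vector.span_base) blast
    show "csubspace {g. g \<in> K \<and> feature g \<in> ?D}"
      by (intro complex_vector.subspaceI)
        (auto simp: K.zero_mem K.add_mem K.scaleC_mem linear_op_zero[OF feature_linear K.subspace]
          linear_op_add[OF feature_linear] linear_op_scaleC[OF feature_linear]
          intro: complex_vector.span_zero complex_vector.span_add complex_vector.span_scale)
  qed
  then have C: "g \<in> K" "feature g \<in> ?D" if "g \<in> ?C" for g using that by blast+
  have "feature f \<in> ve_topology (feature ` K) feature_gram closure_of ?D" if f: "f \<in> K" for f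
    unfolding F.R.in_closure_ve_topology[OF D]
  proof (intro conjI ballI allI impI)
    fix p :: "'z \<Rightarrow> real" and e :: real assume p: "p \<in> cont_incr_seminorms" "0 < e"
    have "f \<in> ve_topology K gK closure_of ?C" using dense f by simp
    then obtain d where d: "d \<in> ?C" "vnorm gK p (d - f) < e"
      using p unfolding K.in_closure_ve_topology[OF span_V_subset] by blast
    have "vnorm feature_gram p (feature d - feature f) = vnorm gK p (d - f)"
      unfolding feature_gram_def using C(1)[OF d(1)] f
      by (rule K.image_vnorm_diff[OF feature_linear feature_inj])
    with d show "\<exists>d\<in>?D. vnorm feature_gram p (d - feature f) < e"
      using C(2)[OF d(1)] by (metis (lifting))
  qed (use f in blast)
  moreover have "ve_topology (feature ` K) feature_gram closure_of ?D \<subseteq> feature ` K"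
    using closure_of_subset_topspace F.R.topspace_ve_topology by metis
  ultimately show ?thesis by blast
qed

end

end

text \<open>Both spaces embed onto the same reproducing kernel space with the same gramian; the unitary operator
  is one embedding followed by the inverse of the other.\<close>

lemma (in VH_kernel) minimal_linearisations_unitary_equivalent:
  assumes L: "minimal_invariant_linearisation act gH k K gK \<pi> V"
    and L': "minimal_invariant_linearisation act gH k K' gK' \<pi>' V'"
  shows "unitary_equivalent K gK \<pi> V K' gK' \<pi>' V'"
proof -
  interpret L: linearised_kernel gH k K gK V
    using L by (simp add: minimal_invariant_linearisation_def minimal_linearisation_def linearised_kernel_iff)
  interpret L': linearised_kernel gH k K' gK' V'
    using L' by (simp add: minimal_invariant_linearisation_def minimal_linearisation_def linearised_kernel_iff)
  have dense: "ve_topology K gK closure_of cspan {V x h | x h. True} = K"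
    and rep: "star_representation K gK \<pi>" and eq: "\<And>\<xi> x h. V (act \<xi> x) h = \<pi> \<xi> (V x h)"
    using L by (simp_all add: minimal_invariant_linearisation_def minimal_linearisation_def
        invariant_linearisation_def)
  have dense': "ve_topology K' gK' closure_of cspan {V' x h | x h. True} = K'"
    and rep': "star_representation K' gK' \<pi>'" and eq': "\<And>\<xi> x h. V' (act \<xi> x) h = \<pi>' \<xi> (V' x h)"
    using L' by (simp_all add: minimal_invariant_linearisation_def minimal_linearisation_def
        invariant_linearisation_def)
  interpret A: two_rk_spaces gH k "L.feature ` K" "L.feature_gram" "L'.feature ` K'" "L'.feature_gram"
    by (intro two_rk_spaces.intro L.feature_rk_space[OF dense] L'.feature_rk_space[OF dense'])
  interpret B: two_rk_spaces gH k "L'.feature ` K'" "L'.feature_gram" "L.feature ` K" "L.feature_gram"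
    by (intro two_rk_spaces.intro L.feature_rk_space[OF dense] L'.feature_rk_space[OF dense'])
  have same: "L.feature ` K = L'.feature ` K'"
    using A.minimal_subset[OF L.feature_dense[OF dense]] B.minimal_subset[OF L'.feature_dense[OF dense']]
    by (rule antisym)
  note inj = L.feature_inj[OF dense] and inj' = L'.feature_inj[OF dense']
  define U where "U f = inv_into K' L'.feature (L.feature f)" for f
  have U: "U f \<in> K'" "L'.feature (U f) = L.feature f" if "f \<in> K" for f
  proof -
    have "L.feature f \<in> L'.feature ` K'" using that same by blast
    then show "U f \<in> K'" "L'.feature (U f) = L.feature f"
      unfolding U_def by (rule inv_into_into, rule f_inv_into_f)
  qed
  have U_eqI: "U f = g" if "f \<in> K" "g \<in> K'" "L.feature f = L'.feature g" for f g
    using inj_onD[OF inj' _ U(1)[OF that(1)] that(2)] U(2)[OF that(1)] that(3) by simp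
  have lin: "linear_op K K' U"
    unfolding linear_op_def
  proof (intro conjI ballI allI)
    show "U ` K \<subseteq> K'" using U by blast
    fix f g assume f: "f \<in> K" and g: "g \<in> K"
    show "U (f + g) = U f + U g"
      using f g by (intro U_eqI) (simp_all add: L.K.add_mem L'.K.add_mem U
          linear_op_add[OF L.feature_linear] linear_op_add[OF L'.feature_linear])
  next
    fix c f assume f: "f \<in> K"
    show "U (c *\<^sub>C f) = c *\<^sub>C U f"
      using f by (intro U_eqI) (simp_all add: L.K.scaleC_mem L'.K.scaleC_mem U
          linear_op_scaleC[OF L.feature_linear] linear_op_scaleC[OF L'.feature_linear])
  qed
  have bij: "bij_betw U K K'"
  proof (rule bij_betw_imageI)
    show "inj_on U K"
    proof (rule inj_onI)
      fix f g assume fg: "f \<in> K" "g \<in> K" "U f = U g"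
      then have "L.feature f = L.feature g" using U(2)[of f] U(2)[of g] by simp
      then show "f = g" using inj_onD[OF inj] fg by blast
    qed
    have "g \<in> U ` K" if g: "g \<in> K'" for g
    proof -
      have "L'.feature g \<in> L.feature ` K" using g same by blast
      then obtain f where f: "f \<in> K" "L'.feature g = L.feature f" by blast
      then have "U f = g" using g by (intro U_eqI) simp_all
      with f show ?thesis by blast
    qed
    then show "U ` K = K'" using U by blast
  qed
  have gram: "gK' (U f) (U g) = gK f g" if f: "f \<in> K" and g: "g \<in> K" for f g
  proof -
    have "gK f g = L.feature_gram (L.feature f) (L.feature g)"
      using f g by (rule L.feature_gram[OF dense, symmetric])
    also have "\<dots> = L'.feature_gram (L.feature f) (L.feature g)"
      using f g by (intro A.minimal_gram[OF L.feature_dense[OF dense]]) auto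
    also have "\<dots> = L'.feature_gram (L'.feature (U f)) (L'.feature (U g))"
      using f g by (simp add: U)
    also have "\<dots> = gK' (U f) (U g)"
      using f g by (intro L'.feature_gram[OF dense'] U)
    finally show ?thesis ..
  qed
  have "U (V x h) = V' x h" for x h
    by (intro U_eqI) (simp_all add: L.V_mem L'.V_mem L.feature_V L'.feature_V)
  moreover have "U (\<pi> \<xi> f) = \<pi>' \<xi> (U f)" if f: "f \<in> K" for \<xi> f
  proof (rule U_eqI)
    show "\<pi> \<xi> f \<in> K" by (rule linear_op_mem[OF L.rep_linear[OF rep eq] f])
    show "\<pi>' \<xi> (U f) \<in> K'" by (rule linear_op_mem[OF L'.rep_linear[OF rep' eq'] U(1)[OF f]])
    have "L.feature (\<pi> \<xi> f) = (\<lambda>x. L.feature f (act (star \<xi>) x))"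
      unfolding L.feature_def using L.Vs_rep[OF rep eq f] by simp
    also have "\<dots> = (\<lambda>x. L'.feature (U f) (act (star \<xi>) x))" using U(2)[OF f] by simp
    also have "\<dots> = L'.feature (\<pi>' \<xi> (U f))"
      unfolding L'.feature_def using L'.Vs_rep[OF rep' eq' U(1)[OF f]] by simp
    finally show "L.feature (\<pi> \<xi> f) = L'.feature (\<pi>' \<xi> (U f))" .
  qed
  ultimately show ?thesis
    unfolding unitary_equivalent_def unitary_op_def using lin bij gram by blast
qed

section \<open>The representation on a minimal reproducing kernel space\<close>

text \<open>With this function as \<open>\<rho>(\<xi>)\<close>, invariance of the kernel is equivalent to \<open>\<rho>(\<xi>) k\<^sub>x h = k\<^bsub>\<xi>x\<^esub> h\<close>.\<close>

definition translation :: "('g::star_semigroup \<Rightarrow> 'x \<Rightarrow> 'x) \<Rightarrow> 'g \<Rightarrow> ('x \<Rightarrow> 'h) \<Rightarrow> 'x \<Rightarrow> 'h" where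
  "translation act \<xi> f = (\<lambda>x. f (act (star \<xi>) x))"

context VH_kernel
begin

abbreviation sections :: "('x \<Rightarrow> 'h) set" where
  "sections \<equiv> {kernel_section k x h | x h. True}"

lemma scaleC_section: "c *\<^sub>C kernel_section k x h = kernel_section k x (c *\<^sub>C h)"
  by (simp add: kernel_section_def scaleC_fun_def linear_op_scaleC[OF kernel_linear])

lemma span_sections:
  assumes "f \<in> cspan sections"
  obtains n :: nat and x h where "f = (\<Sum>i<n. kernel_section k (x i) (h i))"
proof -
  obtain t r where t: "finite t" "t \<subseteq> sections" and f: "f = (\<Sum>a\<in>t. r a *\<^sub>C a)"
    using assms unfolding complex_vector.span_explicit by blast
  have "\<forall>a\<in>t. \<exists>x h. a = kernel_section k x h" using t(2) by blast
  then obtain X H where XH: "\<And>a. a \<in> t \<Longrightarrow> a = kernel_section k (X a) (H a)" by metis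
  obtain b where b: "bij_betw b {..<card t} t"
    using ex_bij_betw_nat_finite[OF t(1)] by (auto simp: atLeast0LessThan)
  have "f = (\<Sum>a\<in>t. kernel_section k (X a) (r a *\<^sub>C H a))"
    unfolding f by (intro sum.cong refl) (metis XH scaleC_section)
  also have "\<dots> = (\<Sum>i<card t. kernel_section k (X (b i)) (r (b i) *\<^sub>C H (b i)))"
    by (rule sum.reindex_bij_betw[OF b, symmetric])
  finally show thesis by (rule that)
qed

lemma translation_section:
  "invariant_kernel act k \<Longrightarrow> translation act \<xi> (kernel_section k x h) = kernel_section k (act \<xi> x) h"
  unfolding translation_def kernel_section_def invariant_kernel_def by simp

end

lemma translation_linear: "linear_op UNIV UNIV (translation act \<xi>)"
  by (simp add: linear_op_def translation_def fun_eq_iff scaleC_fun_def)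

context rk_space
begin

context
  fixes act :: "'g::star_semigroup \<Rightarrow> 'x \<Rightarrow> 'x"
  assumes action: "is_action act" and inv: "invariant_kernel act k" and b1: "cond_b1 act gH k"
    and dense: "ve_topology R gR closure_of cspan sections = R"
begin

lemma span_subset: "cspan sections \<subseteq> R"
  by (rule complex_vector.span_minimal[OF _ R.subspace]) (use section_mem in auto)

lemma translation_span: "f \<in> cspan sections \<Longrightarrow> translation act \<xi> f \<in> cspan sections"
proof -
  assume "f \<in> cspan sections"
  then obtain n :: nat and x h where f: "f = (\<Sum>i<n. kernel_section k (x i) (h i))" by (rule span_sections)
  have "translation act \<xi> f = (\<Sum>i<n. kernel_section k (act \<xi> (x i)) (h i))"
    unfolding f by (simp add: linear_op_sum[OF translation_linear] translation_section[OF inv])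
  then show ?thesis by (simp only:) (rule complex_vector.span_sum, rule complex_vector.span_base, blast)
qed

lemma translation_bounded_span:
  assumes p: "p \<in> cont_incr_seminorms"
  obtains q c where "q \<in> cont_incr_seminorms" "0 \<le> c"
    "\<And>f. f \<in> cspan sections \<Longrightarrow> vnorm gR p (translation act \<xi> f) \<le> c * vnorm gR q f"
proof -
  obtain q c where q: "q \<in> cont_incr_seminorms" and c: "0 \<le> c"
    and qc: "\<forall>(n::nat) h x. p (\<Sum>i<n. \<Sum>j<n. gH (k (act \<xi> (x i)) (act \<xi> (x j)) (h j)) (h i))
            \<le> c * q (\<Sum>i<n. \<Sum>j<n. gH (k (x i) (x j) (h j)) (h i))"
    using b1[unfolded cond_b1_def, rule_format, OF p, of \<xi>] by (elim bexE exE conjE) (rule that)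
  have "vnorm gR p (translation act \<xi> f) \<le> sqrt c * vnorm gR q f" if f: "f \<in> cspan sections" for f
  proof -
    from f obtain n :: nat and x h where f: "f = (\<Sum>i<n. kernel_section k (x i) (h i))" by (rule span_sections)
    have "translation act \<xi> f = (\<Sum>i<n. kernel_section k (act \<xi> (x i)) (h i))"
      unfolding f by (simp add: linear_op_sum[OF translation_linear] translation_section[OF inv])
    then have "p (gR (translation act \<xi> f) (translation act \<xi> f)) \<le> c * q (gR f f)"
      using spec[OF spec[OF spec[OF qc, of n], of h], of x] unfolding gram_kernel_sum(1) f by simp
    then show ?thesis unfolding vnorm_def by (metis real_sqrt_le_mono real_sqrt_mult)
  qed
  moreover have "0 \<le> sqrt c" using c by simp
  ultimately show thesis using q by (intro that)
qed

text \<open>Translates of a convergent net in the span are Cauchy by the bound on the span. Their limit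
  in \<open>R\<close> can be read off pointwise, so it is the translate of \<open>f\<close>, which therefore lies in \<open>R\<close>.\<close>

lemma translation_limit:
  assumes f: "f \<in> R" and u: "\<And>q. u q \<in> cspan sections" "ve_tendsto gR u f seminorm_filter"
  shows "translation act \<xi> f \<in> R"
    "ve_tendsto gR (\<lambda>q. translation act \<xi> (u q)) (translation act \<xi> f) seminorm_filter"
proof -
  have uR: "u q \<in> R" "translation act \<xi> (u q) \<in> R" for q
    using subsetD[OF span_subset u(1)] subsetD[OF span_subset translation_span[OF u(1)]] by blast+
  have "ve_cauchy R gR (\<lambda>q. translation act \<xi> (u q)) seminorm_filter"
    unfolding ve_cauchy_def
  proof (intro ballI allI impI)
    fix p :: "'z \<Rightarrow> real" and e :: real assume p: "p \<in> cont_incr_seminorms" and e: "0 < e"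
    obtain r c where r: "r \<in> cont_incr_seminorms" and c: "0 \<le> c"
      and rc: "\<And>f. f \<in> cspan sections \<Longrightarrow> vnorm gR p (translation act \<xi> f) \<le> c * vnorm gR r f"
      by (rule translation_bounded_span[OF p]) (rule that; blast)
    have "0 < e / (c + 1)" using c e by simp
    from ve_cauchy_center[OF R.VE_admissible_axioms seminorm_filter_neq_bot u(1) span_subset
        R.ve_tendsto_imp_cauchy[OF f u(2)] r this]
    obtain a where a: "a \<in> cspan sections" "\<forall>\<^sub>F q in seminorm_filter. vnorm gR r (u q - a) < e / (c + 1)"
      by (elim bexE)
    from a(2) have "\<forall>\<^sub>F q in seminorm_filter. vnorm gR p (translation act \<xi> (u q) - translation act \<xi> a) < e"
    proof eventually_elim
      case (elim q)
      have "vnorm gR p (translation act \<xi> (u q) - translation act \<xi> a) \<le> c * vnorm gR r (u q - a)"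
        using rc[OF complex_vector.span_diff[OF u(1) a(1)], of q]
        by (simp add: linear_op_diff[OF translation_linear])
      also have "\<dots> \<le> (c + 1) * vnorm gR r (u q - a)"
        using R.vnorm_nonneg[OF r] by (intro mult_right_mono) auto
      also have "\<dots> < e" using elim c by (simp add: field_simps)
      finally show ?case .
    qed
    then show "\<exists>a\<in>R. \<forall>\<^sub>F q in seminorm_filter. vnorm gR p (translation act \<xi> (u q) - a) < e"
      by (rule bexI[OF _ subsetD[OF span_subset translation_span[OF a(1)]]])
  qed
  then obtain g where g: "g \<in> R" "ve_tendsto gR (\<lambda>q. translation act \<xi> (u q)) g seminorm_filter"
    by (rule R.cauchy_net_converges[OF seminorm_filter_neq_bot uR(2)])
  have "translation act \<xi> f x = g x" for x
  proof (rule H.ve_tendsto_unique[OF seminorm_filter_neq_bot])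
    show "ve_tendsto gH (\<lambda>q. translation act \<xi> (u q) x) (g x) seminorm_filter"
      by (rule continuous_ve_tendsto[OF R.VE_admissible_axioms H_admissible eval_linear continuous_eval g(2) uR(2) g(1)])
    show "ve_tendsto gH (\<lambda>q. translation act \<xi> (u q) x) (translation act \<xi> f x) seminorm_filter"
      unfolding translation_def
      by (rule continuous_ve_tendsto[OF R.VE_admissible_axioms H_admissible eval_linear continuous_eval u(2) uR(1) f])
  qed simp_all
  then have "translation act \<xi> f = g" ..
  with g show "translation act \<xi> f \<in> R"
    "ve_tendsto gR (\<lambda>q. translation act \<xi> (u q)) (translation act \<xi> f) seminorm_filter" by simp_all
qed

lemma section_net:
  assumes "f \<in> R"
  obtains u :: "('z \<Rightarrow> real) \<Rightarrow> 'x \<Rightarrow> 'h"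
  where "\<And>q. u q \<in> cspan sections" "ve_tendsto gR u f seminorm_filter"
proof -
  have "f \<in> ve_topology R gR closure_of cspan sections" using assms dense by simp
  then show thesis by (rule R.dense_net[OF span_subset]) (rule that; simp)
qed

lemma translation_mem:
  assumes f: "f \<in> R" shows "translation act \<xi> f \<in> R"
proof -
  obtain u :: "('z \<Rightarrow> real) \<Rightarrow> 'x \<Rightarrow> 'h"
    where u: "\<And>q. u q \<in> cspan sections" "ve_tendsto gR u f seminorm_filter"
    by (rule section_net[OF f]) (rule that; simp)
  show ?thesis by (rule translation_limit(1)[OF f u])
qed

lemma translation_linear_R: "linear_op R R (translation act \<xi>)"
  using translation_mem by (auto simp: linear_op_def translation_def fun_eq_iff scaleC_fun_def)

lemma translation_bounded:
  assumes p: "p \<in> cont_incr_seminorms"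
  shows "\<exists>q\<in>cont_incr_seminorms. \<exists>c\<ge>0. \<forall>f\<in>R. vnorm gR p (translation act \<xi> f) \<le> c * vnorm gR q f"
proof -
  obtain r c where r: "r \<in> cont_incr_seminorms" and c: "0 \<le> c"
    and rc: "\<And>f. f \<in> cspan sections \<Longrightarrow> vnorm gR p (translation act \<xi> f) \<le> c * vnorm gR r f"
    by (rule translation_bounded_span[OF p]) (rule that; blast)
  have "vnorm gR p (translation act \<xi> f) \<le> c * vnorm gR r f" if f: "f \<in> R" for f
  proof -
    obtain u :: "('z \<Rightarrow> real) \<Rightarrow> 'x \<Rightarrow> 'h"
      where u: "\<And>q. u q \<in> cspan sections" "ve_tendsto gR u f seminorm_filter"
      by (rule section_net[OF f]) (rule that; simp)
    have uR: "u q \<in> R" for q by (rule subsetD[OF span_subset u(1)])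
    show ?thesis
    proof (rule tendsto_le[OF seminorm_filter_neq_bot])
      show "((\<lambda>q. c * vnorm gR r (u q)) \<longlongrightarrow> c * vnorm gR r f) seminorm_filter"
        by (intro tendsto_intros R.tendsto_vnorm u uR f r)
      show "((\<lambda>q. vnorm gR p (translation act \<xi> (u q))) \<longlongrightarrow> vnorm gR p (translation act \<xi> f)) seminorm_filter"
        by (intro R.tendsto_vnorm translation_limit[OF f u] translation_mem uR f p)
      show "\<forall>\<^sub>F q in seminorm_filter. vnorm gR p (translation act \<xi> (u q)) \<le> c * vnorm gR r (u q)"
        by (intro always_eventually allI rc u)
    qed
  qed
  with r c show ?thesis by blast
qed

text \<open>For \<open>g = k\<^sub>x h\<close> both sides are \<open>[f(\<xi>\<^sup>* x), h]\<close>; the general case follows by linearity and density.\<close>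

lemma translation_adjoint:
  assumes f: "f \<in> R" and g: "g \<in> R"
  shows "gR (translation act \<xi> f) g = gR f (translation act (star \<xi>) g)"
proof -
  note tf = translation_mem[OF f]
  have sec: "gR (translation act \<xi> f) (kernel_section k x h) = gR f (translation act (star \<xi>) (kernel_section k x h))" for x h
  proof -
    have "gR (translation act \<xi> f) (kernel_section k x h) = gH (f (act (star \<xi>) x)) h"
      by (simp add: reproducing[OF tf, symmetric]) (simp add: translation_def)
    also have "\<dots> = gR f (translation act (star \<xi>) (kernel_section k x h))"
      by (simp add: translation_section[OF inv] reproducing[OF f])
    finally show ?thesis .
  qed
  obtain v :: "('z \<Rightarrow> real) \<Rightarrow> 'x \<Rightarrow> 'h"
    where v: "\<And>q. v q \<in> cspan sections" "ve_tendsto gR v g seminorm_filter"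
    by (rule section_net[OF g]) (rule that; simp)
  have vR: "v q \<in> R" for q by (rule subsetD[OF span_subset v(1)])
  have agree: "gR (translation act \<xi> f) (v q) = gR f (translation act (star \<xi>) (v q))" for q
  proof -
    obtain n :: nat and x h where vq: "v q = (\<Sum>i<n. kernel_section k (x i) (h i))"
      by (rule span_sections[OF v(1)])
    show ?thesis
      unfolding vq linear_op_sum[OF translation_linear_R R.subspace section_mem]
      by (simp add: R.gram_sum_right tf f section_mem translation_mem sec)
  qed
  have const: "ve_tendsto gR (\<lambda>_. f') f' seminorm_filter" for f'
    unfolding ve_tendsto_def by (simp add: R.vnorm_zero)
  have "((\<lambda>q. gR (translation act \<xi> f) (v q)) \<longlongrightarrow> gR (translation act \<xi> f) g) seminorm_filter"
    by (rule R.tendsto_gram[OF const tf tf v(2) vR g])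
  then have "((\<lambda>q. gR f (translation act (star \<xi>) (v q))) \<longlongrightarrow> gR (translation act \<xi> f) g) seminorm_filter"
    unfolding agree .
  moreover have "((\<lambda>q. gR f (translation act (star \<xi>) (v q))) \<longlongrightarrow> gR f (translation act (star \<xi>) g)) seminorm_filter"
    by (rule R.tendsto_gram[OF const f f translation_limit(2)[OF g v] translation_mem[OF vR] translation_mem[OF g]])
  ultimately show ?thesis by (rule tendsto_unique[OF seminorm_filter_neq_bot])
qed

lemma translation_ops: "translation act \<xi> \<in> cont_adjointable_ops R gR R gR"
  by (rule cont_adjointable_opsI(1)[OF R.VE_admissible_axioms R.VE_admissible_axioms
        translation_linear_R translation_linear_R translation_adjoint translation_bounded translation_bounded])

lemma translation_adjoint_op:
  "f \<in> R \<Longrightarrow> adjoint_op R gR R gR (translation act \<xi>) f = translation act (star \<xi>) f"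
  by (rule cont_adjointable_opsI(2)[OF R.VE_admissible_axioms R.VE_admissible_axioms
        translation_linear_R translation_linear_R translation_adjoint translation_bounded translation_bounded])

lemma translation_minimal_rk_pair: "minimal_invariant_rk_pair act gH k R gR (translation act)"
proof -
  have "translation act (\<xi> * \<eta>) f = translation act \<xi> (translation act \<eta> f)" for \<xi> \<eta> and f :: "'x \<Rightarrow> 'h"
    using action by (simp add: translation_def is_action_def star_mult)
  then have "star_representation R gR (translation act)"
    by (simp add: star_representation_def translation_ops translation_adjoint_op)
  moreover have "reproducing_kernel_VH_space gH k R gR"
    unfolding rk_space_iff by (rule rk_space_axioms)
  ultimately show ?thesis
    using dense by (simp add: minimal_invariant_rk_pair_def invariant_rk_pair_def translation_section[OF inv])
qed

end

end

section \<open>Gramians of Cauchy nets\<close>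

context VE_admissible
begin

lemma ve_cauchy_add:
  assumes u: "ve_cauchy E gram u F" "\<And>i. u i \<in> E" and v: "ve_cauchy E gram v F" "\<And>i. v i \<in> E"
  shows "ve_cauchy E gram (\<lambda>i. u i + v i) F"
  unfolding ve_cauchy_def
proof (intro ballI allI impI)
  fix p :: "'z \<Rightarrow> real" and e :: real assume p: "p \<in> cont_incr_seminorms" and e: "0 < e"
  obtain a where a: "a \<in> E" "\<forall>\<^sub>F i in F. vnorm gram p (u i - a) < e / 2"
    using u(1)[unfolded ve_cauchy_def, rule_format, OF p half_gt_zero[OF e]] by (elim bexE)
  obtain b where b: "b \<in> E" "\<forall>\<^sub>F i in F. vnorm gram p (v i - b) < e / 2"
    using v(1)[unfolded ve_cauchy_def, rule_format, OF p half_gt_zero[OF e]] by (elim bexE)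
  from a(2) b(2) have "\<forall>\<^sub>F i in F. vnorm gram p (u i + v i - (a + b)) < e"
  proof eventually_elim
    case (elim i)
    have eq: "u i + v i - (a + b) = (u i - a) + (v i - b)" by simp
    show ?case
      unfolding eq using vnorm_add[OF p diff_mem[OF u(2) a(1)] diff_mem[OF v(2) b(1)], of i i] elim by linarith
  qed
  then show "\<exists>a\<in>E. \<forall>\<^sub>F i in F. vnorm gram p (u i + v i - a) < e"
    by (rule bexI[OF _ add_mem[OF a(1) b(1)]])
qed

lemma ve_cauchy_scaleC:
  assumes u: "ve_cauchy E gram u F" "\<And>i. u i \<in> E"
  shows "ve_cauchy E gram (\<lambda>i. c *\<^sub>C u i) F"
  unfolding ve_cauchy_def
proof (intro ballI allI impI)
  fix p :: "'z \<Rightarrow> real" and e :: real assume p: "p \<in> cont_incr_seminorms" and e: "0 < e"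
  have c: "0 < cmod c + 1" by (simp add: add_nonneg_pos)
  then have "0 < e / (cmod c + 1)" using e by simp
  then obtain a where a: "a \<in> E" "\<forall>\<^sub>F i in F. vnorm gram p (u i - a) < e / (cmod c + 1)"
    using u(1)[unfolded ve_cauchy_def, rule_format, OF p] by (elim bexE[rotated])
  from a(2) have "\<forall>\<^sub>F i in F. vnorm gram p (c *\<^sub>C u i - c *\<^sub>C a) < e"
  proof eventually_elim
    case (elim i)
    have "vnorm gram p (c *\<^sub>C u i - c *\<^sub>C a) = cmod c * vnorm gram p (u i - a)"
      using vnorm_scaleC[OF p diff_mem[OF u(2) a(1)], of c i]
      by (simp add: complex_vector.scale_right_diff_distrib)
    also have "\<dots> \<le> (cmod c + 1) * vnorm gram p (u i - a)"
      using vnorm_nonneg[OF p] by (intro mult_right_mono) auto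
    also have "\<dots> < e" using elim c by (simp add: field_simps)
    finally show ?case .
  qed
  then show "\<exists>a\<in>E. \<forall>\<^sub>F i in F. vnorm gram p (c *\<^sub>C u i - a) < e"
    by (rule bexI[OF _ scaleC_mem[OF a(1)]])
qed

lemma ve_cauchy_bounded:
  assumes u: "ve_cauchy E gram u F" "\<And>i. u i \<in> E" and p: "p \<in> cont_incr_seminorms"
  obtains M where "0 < M" "\<forall>\<^sub>F i in F. vnorm gram p (u i) \<le> M"
proof -
  obtain a where a: "a \<in> E" "\<forall>\<^sub>F i in F. vnorm gram p (u i - a) < 1"
    using u(1)[unfolded ve_cauchy_def, rule_format, OF p zero_less_one] by (elim bexE)
  from a(2) have "\<forall>\<^sub>F i in F. vnorm gram p (u i) \<le> 1 + vnorm gram p a"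
  proof eventually_elim
    case (elim i)
    then show ?case using vnorm_add[OF p diff_mem[OF u(2) a(1)] a(1), of i] by simp
  qed
  moreover have "0 < 1 + vnorm gram p a" using vnorm_nonneg[OF p, of a] by linarith
  ultimately show thesis by (rule that[rotated])
qed

text \<open>The radius around \<open>b\<close> depends on the seminorm of \<open>a\<close>, so \<open>a\<close> is chosen first.\<close>

lemma gram_cauchy_converges:
  assumes F: "F \<noteq> bot" and u: "ve_cauchy E gram u F" "\<And>i. u i \<in> E" and v: "ve_cauchy E gram v F" "\<And>i. v i \<in> E"
  obtains w where "((\<lambda>i. gram (u i) (v i)) \<longlongrightarrow> w) F"
proof (rule complete_admissible[OF F])
  fix p :: "'z \<Rightarrow> real" and e :: real assume p: "p \<in> cont_incr_seminorms" and e: "0 < e"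
  obtain M where M: "0 < M" "\<forall>\<^sub>F i in F. vnorm gram p (v i) \<le> M"
    by (rule ve_cauchy_bounded[OF v p])
  define d where "d = e / (8 * M)"
  have d: "0 < d" using e M by (simp add: d_def)
  obtain a where a: "a \<in> E" "\<forall>\<^sub>F i in F. vnorm gram p (u i - a) < d"
    using u(1)[unfolded ve_cauchy_def, rule_format, OF p d] by (elim bexE)
  define N where "N = vnorm gram p a + 1"
  have N: "0 < N" "vnorm gram p a \<le> N" using vnorm_nonneg[OF p, of a] by (simp_all add: N_def add_nonneg_pos)
  define d' where "d' = e / (8 * N)"
  have d': "0 < d'" using e N by (simp add: d'_def)
  obtain b where b: "b \<in> E" "\<forall>\<^sub>F i in F. vnorm gram p (v i - b) < d'"
    using v(1)[unfolded ve_cauchy_def, rule_format, OF p d'] by (elim bexE)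
  from M(2) a(2) b(2) have "\<forall>\<^sub>F i in F. p (gram (u i) (v i) - gram a b) < e"
  proof eventually_elim
    case (elim i)
    have "4 * vnorm gram p (u i - a) * vnorm gram p (v i) \<le> 4 * vnorm gram p (u i - a) * M"
      using elim(1) vnorm_nonneg[OF p, of "u i - a"] by (intro mult_left_mono) auto
    also have "\<dots> < 4 * d * M" using elim(2) M(1) by simp
    also have "\<dots> = e / 2" using M(1) by (simp add: d_def)
    finally have 1: "4 * vnorm gram p (u i - a) * vnorm gram p (v i) < e / 2" .
    have "4 * vnorm gram p a * vnorm gram p (v i - b) \<le> 4 * N * vnorm gram p (v i - b)"
      using N(2) vnorm_nonneg[OF p, of "v i - b"] by (intro mult_right_mono) auto
    also have "\<dots> < 4 * N * d'" using elim(3) N(1) by simp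
    also have "\<dots> = e / 2" using N(1) by (simp add: d'_def)
    finally have 2: "4 * vnorm gram p a * vnorm gram p (v i - b) < e / 2" .
    show ?case using gram_diff_bound[OF p a(1) b(1) u(2) v(2), of i i] 1 2 by linarith
  qed
  then show "\<exists>z. \<forall>\<^sub>F i in F. p (gram (u i) (v i) - z) < e" by (rule exI)
qed (rule that)

lemma gram_equivalent_nets:
  assumes u: "ve_cauchy E gram u F" "\<And>i. u i \<in> E" "\<And>i. u' i \<in> E" and v: "ve_cauchy E gram v F" "\<And>i. v i \<in> E" "\<And>i. v' i \<in> E"
    and u0: "ve_tendsto gram (\<lambda>i. u' i - u i) 0 F" and v0: "ve_tendsto gram (\<lambda>i. v' i - v i) 0 F"
    and lim: "((\<lambda>i. gram (u i) (v i)) \<longlongrightarrow> w) F"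
  shows "((\<lambda>i. gram (u' i) (v' i)) \<longlongrightarrow> w) F"
proof -
  have "((\<lambda>i. gram (u' i) (v' i) - gram (u i) (v i)) \<longlongrightarrow> 0) F"
    unfolding tendsto_iff_seminorms
  proof
    fix p :: "'z \<Rightarrow> real" assume p: "p \<in> cont_incr_seminorms"
    obtain M where M: "0 < M" "\<forall>\<^sub>F i in F. vnorm gram p (u i) \<le> M" by (rule ve_cauchy_bounded[OF u(1,2) p])
    obtain N where N: "0 < N" "\<forall>\<^sub>F i in F. vnorm gram p (v i) \<le> N" by (rule ve_cauchy_bounded[OF v(1,2) p])
    let ?B = "\<lambda>i. 4 * vnorm gram p (u' i - u i) * (vnorm gram p (v' i - v i) + N) + 4 * M * vnorm gram p (v' i - v i)"
    have lims: "((\<lambda>i. vnorm gram p (u' i - u i)) \<longlongrightarrow> 0) F" "((\<lambda>i. vnorm gram p (v' i - v i)) \<longlongrightarrow> 0) F"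
      using u0 v0 p by (simp_all add: ve_tendsto_def)
    have "(?B \<longlongrightarrow> 4 * 0 * (0 + N) + 4 * M * 0) F" by (intro tendsto_intros lims)
    then have B: "(?B \<longlongrightarrow> 0) F" by simp
    from M(2) N(2) have "\<forall>\<^sub>F i in F. norm (p (gram (u' i) (v' i) - gram (u i) (v i) - 0)) \<le> ?B i"
    proof eventually_elim
      case (elim i)
      have "vnorm gram p (v' i) \<le> vnorm gram p (v' i - v i) + N"
        using vnorm_add[OF p diff_mem[OF v(3) v(2)] v(2), of i i i] elim by simp
      then have "4 * vnorm gram p (u' i - u i) * vnorm gram p (v' i)
          \<le> 4 * vnorm gram p (u' i - u i) * (vnorm gram p (v' i - v i) + N)"
        using vnorm_nonneg[OF p, of "u' i - u i"] by (intro mult_left_mono) auto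
      moreover have "4 * vnorm gram p (u i) * vnorm gram p (v' i - v i) \<le> 4 * M * vnorm gram p (v' i - v i)"
        using elim vnorm_nonneg[OF p, of "v' i - v i"] by (intro mult_right_mono) auto
      ultimately show ?case
        using gram_diff_bound[OF p u(2) v(2) u(3) v(3), of i i i i] cis_nonneg[OF p] by simp
    qed
    then show "((\<lambda>i. p (gram (u' i) (v' i) - gram (u i) (v i) - 0)) \<longlongrightarrow> 0) F"
      by (rule Lim_null_comparison) (rule B)
  qed
  from tendsto_add[OF this lim] show ?thesis by simp
qed

end

text \<open>Applied with \<open>A\<close> and \<open>B\<close> the two mixed terms of a sesquilinear form, this turns selfadjointness of the
  diagonal values into symmetry of the form.\<close>

lemma selfadjoint_imp_hermitian:
  fixes A B :: "'z::ordered_star_space"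
  assumes 1: "star (A + B) = A + B" and 2: "star (\<i> *\<^sub>C A - \<i> *\<^sub>C B) = \<i> *\<^sub>C A - \<i> *\<^sub>C B"
  shows "A = star B"
proof -
  have d: "star (x - y) = star x - star y" for x y :: 'z
    using star_add[of "x - y" y] by simp
  have "- \<i> *\<^sub>C star A + \<i> *\<^sub>C star B = \<i> *\<^sub>C A - \<i> *\<^sub>C B"
    using 2 by (simp add: d star_scaleC)
  then have "\<i> *\<^sub>C (star B - star A) = \<i> *\<^sub>C (A - B)"
    by (simp add: complex_vector.scale_right_diff_distrib)
  then have "star B - star A = A - B" by (simp add: complex_vector.scale_left_imp_eq)
  moreover have "star A + star B = A + B" using 1 by (simp add: star_add)
  ultimately have "(star B - star A) + (star A + star B) = (A - B) + (A + B)" by (simp only:)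
  then have "star B + star B = A + A" by (simp add: algebra_simps)
  then have "(1 + 1) *\<^sub>C star B = (1 + 1) *\<^sub>C A"
    by (simp only: scaleC_add_left scaleC_one)
  then show ?thesis by simp
qed

section \<open>Completion of a space of functions with bounded evaluations\<close>

locale pre_rk_space = VH_kernel gH k + P: VE_admissible P gP
  for gH :: "'h::complex_vector \<Rightarrow> 'h \<Rightarrow> 'z::admissible_space"
    and k :: "'x \<Rightarrow> 'x \<Rightarrow> 'h \<Rightarrow> 'h"
    and P :: "('x \<Rightarrow> 'h) set" and gP :: "('x \<Rightarrow> 'h) \<Rightarrow> ('x \<Rightarrow> 'h) \<Rightarrow> 'z" +
  assumes P_span: "P = cspan sections"
    and P_reproducing: "f \<in> P \<Longrightarrow> gP f (kernel_section k x h) = gH (f x) h"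
    and P_eval: "p \<in> cont_incr_seminorms \<Longrightarrow>
      \<exists>q\<in>cont_incr_seminorms. \<exists>c\<ge>0. \<forall>f\<in>P. vnorm gH p (f x) \<le> c * vnorm gP q f"
begin

text \<open>The elements of the completion are the pointwise limits of Cauchy nets. All nets have the index set of
  \<open>seminorm_filter\<close>, so nets for two functions can be added and paired index by index.\<close>

definition approximates :: "(('z \<Rightarrow> real) \<Rightarrow> 'x \<Rightarrow> 'h) \<Rightarrow> ('x \<Rightarrow> 'h) \<Rightarrow> bool" where
  "approximates u f \<longleftrightarrow> (\<forall>q. u q \<in> P) \<and> ve_cauchy P gP u seminorm_filter \<and>
     (\<forall>x. ve_tendsto gH (\<lambda>q. u q x) (f x) seminorm_filter)"

lemma approximatesD:
  assumes "approximates u f"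
  shows "u q \<in> P" "ve_cauchy P gP u seminorm_filter" "ve_tendsto gH (\<lambda>q. u q x) (f x) seminorm_filter"
  using assms by (simp_all add: approximates_def)

lemma section_in_P: "kernel_section k x h \<in> P"
  unfolding P_span by (rule complex_vector.span_base) blast

lemma approximates_const: "f \<in> P \<Longrightarrow> approximates (\<lambda>_. f) f"
proof -
  assume f: "f \<in> P"
  have "ve_cauchy P gP (\<lambda>_. f) seminorm_filter"
    unfolding ve_cauchy_def using f by (intro ballI allI impI bexI[of _ f]) (simp_all add: P.vnorm_zero)
  then show ?thesis using f by (simp add: approximates_def ve_tendsto_def H.vnorm_zero)
qed

lemma approximates_add:
  assumes u: "approximates u f" and v: "approximates v g"
  shows "approximates (\<lambda>q. u q + v q) (f + g)"
  unfolding approximates_def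
proof (intro conjI allI)
  show "u q + v q \<in> P" for q using approximatesD(1)[OF u] approximatesD(1)[OF v] by (rule P.add_mem)
  show "ve_cauchy P gP (\<lambda>q. u q + v q) seminorm_filter"
    by (intro P.ve_cauchy_add approximatesD[OF u] approximatesD[OF v])
  fix x
  show "ve_tendsto gH (\<lambda>q. (u q + v q) x) ((f + g) x) seminorm_filter"
    unfolding ve_tendsto_def
  proof
    fix p :: "'z \<Rightarrow> real" assume p: "p \<in> cont_incr_seminorms"
    have "((\<lambda>q. vnorm gH p (u q x - f x)) \<longlongrightarrow> 0) seminorm_filter"
      "((\<lambda>q. vnorm gH p (v q x - g x)) \<longlongrightarrow> 0) seminorm_filter"
      using approximatesD(3)[OF u, of x] approximatesD(3)[OF v, of x] p by (simp_all add: ve_tendsto_def)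
    from tendsto_add[OF this]
    have "((\<lambda>q. vnorm gH p (u q x - f x) + vnorm gH p (v q x - g x)) \<longlongrightarrow> 0) seminorm_filter" by simp
    moreover have "vnorm gH p ((u q + v q) x - (f + g) x) \<le> vnorm gH p (u q x - f x) + vnorm gH p (v q x - g x)" for q
      using H.vnorm_add[OF p, of "u q x - f x" "v q x - g x"] by (simp add: add_diff_add)
    ultimately show "((\<lambda>q. vnorm gH p ((u q + v q) x - (f + g) x)) \<longlongrightarrow> 0) seminorm_filter"
      by (elim Lim_null_comparison[rotated]) (simp add: H.vnorm_nonneg[OF p])
  qed
qed

lemma approximates_scaleC:
  assumes u: "approximates u f" shows "approximates (\<lambda>q. c *\<^sub>C u q) (c *\<^sub>C f)"
  unfolding approximates_def
proof (intro conjI allI)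
  show "c *\<^sub>C u q \<in> P" for q using approximatesD(1)[OF u] by (rule P.scaleC_mem)
  show "ve_cauchy P gP (\<lambda>q. c *\<^sub>C u q) seminorm_filter"
    by (intro P.ve_cauchy_scaleC approximatesD[OF u])
  fix x
  show "ve_tendsto gH (\<lambda>q. (c *\<^sub>C u q) x) ((c *\<^sub>C f) x) seminorm_filter"
    unfolding ve_tendsto_def
  proof
    fix p :: "'z \<Rightarrow> real" assume p: "p \<in> cont_incr_seminorms"
    have "vnorm gH p ((c *\<^sub>C u q) x - (c *\<^sub>C f) x) = cmod c * vnorm gH p (u q x - f x)" for q
      using H.vnorm_scaleC[OF p, of "u q x - f x" c]
      by (simp add: scaleC_fun_def complex_vector.scale_right_diff_distrib)
    moreover have "((\<lambda>q. cmod c * vnorm gH p (u q x - f x)) \<longlongrightarrow> 0) seminorm_filter"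
      using approximatesD(3)[OF u, of x] p unfolding ve_tendsto_def by (intro tendsto_mult_right_zero) auto
    ultimately show "((\<lambda>q. vnorm gH p ((c *\<^sub>C u q) x - (c *\<^sub>C f) x)) \<longlongrightarrow> 0) seminorm_filter" by simp
  qed
qed

lemma approximates_diff:
  assumes u: "approximates u f" and v: "approximates v g"
  shows "approximates (\<lambda>q. u q - v q) (f - g)"
  using approximates_add[OF u approximates_scaleC[OF v, of "-1"]] by simp

lemma approximates_gram_section:
  assumes u: "approximates u f"
  shows "((\<lambda>q. gP (u q) (kernel_section k x h)) \<longlongrightarrow> gH (f x) h) seminorm_filter"
proof -
  have const: "ve_tendsto gH (\<lambda>_. h) h seminorm_filter" by (simp add: ve_tendsto_def H.vnorm_zero)
  have "((\<lambda>q. gH (u q x) h) \<longlongrightarrow> gH (f x) h) seminorm_filter"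
    by (rule H.tendsto_gram[OF approximatesD(3)[OF u] UNIV_I UNIV_I const UNIV_I UNIV_I])
  then show ?thesis by (simp add: P_reproducing approximatesD(1)[OF u])
qed

lemma approximates_zero_gram:
  assumes u: "approximates u 0" and b: "b \<in> P"
  shows "((\<lambda>q. gP (u q) b) \<longlongrightarrow> 0) seminorm_filter"
proof -
  obtain n :: nat and x h where bs: "b = (\<Sum>i<n. kernel_section k (x i) (h i))"
    by (rule span_sections) (use b P_span in auto)
  have "((\<lambda>q. \<Sum>i<n. gP (u q) (kernel_section k (x i) (h i))) \<longlongrightarrow> (\<Sum>i<n. gH ((0 :: 'x \<Rightarrow> 'h) (x i)) (h i))) seminorm_filter"
    by (intro tendsto_sum approximates_gram_section u)
  then show ?thesis
    unfolding bs by (simp add: P.gram_sum_right approximatesD(1)[OF u] section_in_P H.gram_zero_left)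
qed

text \<open>This makes the pointwise limit determine the class of the Cauchy net: two nets with the same pointwise
  limit have the same gramian limits.\<close>

lemma approximates_zero:
  assumes u: "approximates u 0"
  shows "ve_tendsto gP u 0 seminorm_filter"
  unfolding P.ve_tendsto_iff
proof (intro ballI allI impI)
  fix p :: "'z \<Rightarrow> real" and e :: real assume p: "p \<in> cont_incr_seminorms" and e: "0 < e"
  note uP = approximatesD(1)[OF u]
  obtain M where M: "0 < M" "\<forall>\<^sub>F q in seminorm_filter. vnorm gP p (u q) \<le> M"
    by (rule P.ve_cauchy_bounded[OF approximatesD(2,1)[OF u] p])
  \<comment> \<open>The Schwarz inequality contributes a factor \<open>4 M\<close>, so this radius bounds \<open>[u, u - a]\<close> by \<open>e\<^sup>2 / 2\<close>.\<close>
  define d where "d = e\<^sup>2 / (8 * M)"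
  have d: "0 < d" using e M by (simp add: d_def)
  obtain a where a: "a \<in> P" "\<forall>\<^sub>F q in seminorm_filter. vnorm gP p (u q - a) < d"
    using approximatesD(2)[OF u, unfolded ve_cauchy_def, rule_format, OF p d] by (elim bexE)
  have "((\<lambda>q. p (gP (u q) a)) \<longlongrightarrow> p 0) seminorm_filter"
    by (rule cis_tendsto[OF p approximates_zero_gram[OF u a(1)]])
  then have "\<forall>\<^sub>F q in seminorm_filter. p (gP (u q) a) < e\<^sup>2 / 2"
    using e by (intro order_tendstoD(2)) (auto simp: cis_zero[OF p])
  with M(2) a(2) show "\<forall>\<^sub>F q in seminorm_filter. vnorm gP p (u q - 0) < e"
  proof eventually_elim
    case (elim q)
    have "gP (u q) (u q) = gP (u q) (u q - a) + gP (u q) a"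
      using uP a(1) by (simp add: P.gram_diff_right)
    then have "p (gP (u q) (u q)) \<le> p (gP (u q) (u q - a)) + p (gP (u q) a)"
      using cis_add[OF p, of "gP (u q) (u q - a)" "gP (u q) a"] by simp
    also have "p (gP (u q) (u q - a)) \<le> 4 * vnorm gP p (u q) * vnorm gP p (u q - a)"
      by (intro P.schwarz p uP P.diff_mem a)
    also have "\<dots> \<le> 4 * M * d"
      using elim M P.vnorm_nonneg[OF p] by (intro mult_mono) auto
    also have "\<dots> = e\<^sup>2 / 2" using M by (simp add: d_def)
    also have "e\<^sup>2 / 2 + p (gP (u q) a) < e\<^sup>2 / 2 + e\<^sup>2 / 2" using elim by simp
    finally have "p (gP (u q) (u q)) < e\<^sup>2" by simp
    then have "vnorm gP p (u q) < sqrt (e\<^sup>2)" unfolding vnorm_def by (rule real_sqrt_less_mono)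
    then show ?case using e by simp
  qed
qed

lemma approximates_equivalent:
  assumes u: "approximates u f" "approximates u' f"
  shows "ve_tendsto gP (\<lambda>q. u' q - u q) 0 seminorm_filter"
  using approximates_zero approximates_diff[OF u(2,1)] by simp

definition carrier :: "('x \<Rightarrow> 'h) set" where
  "carrier = {f. \<exists>u. approximates u f}"

text \<open>Lemma \<open>tendsto_gram_limit\<close> shows that the choice of the two nets does not matter.\<close>

definition gram_limit :: "('x \<Rightarrow> 'h) \<Rightarrow> ('x \<Rightarrow> 'h) \<Rightarrow> 'z" where
  "gram_limit f g = Lim seminorm_filter
     (\<lambda>q. gP ((SOME u. approximates u f) q) ((SOME v. approximates v g) q))"

lemma approximates_carrier: "approximates u f \<Longrightarrow> f \<in> carrier"
  by (auto simp: carrier_def)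

lemma carrier_approximates:
  assumes "f \<in> carrier" obtains u where "approximates u f"
  using assms by (auto simp: carrier_def)

lemma tendsto_gram_limit:
  assumes u: "approximates u f" and v: "approximates v g"
  shows "((\<lambda>q. gP (u q) (v q)) \<longlongrightarrow> gram_limit f g) seminorm_filter"
proof -
  define u0 v0 where "u0 = (SOME u. approximates u f)" and "v0 = (SOME v. approximates v g)"
  have u0: "approximates u0 f" and v0: "approximates v0 g"
    unfolding u0_def v0_def using someI[of "\<lambda>u. approximates u f", OF u] someI[of "\<lambda>v. approximates v g", OF v]
    by simp_all
  obtain w where w: "((\<lambda>q. gP (u0 q) (v0 q)) \<longlongrightarrow> w) seminorm_filter"
    by (rule P.gram_cauchy_converges[OF seminorm_filter_neq_bot approximatesD(2,1)[OF u0] approximatesD(2,1)[OF v0]])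
  have "gram_limit f g = w"
    unfolding gram_limit_def u0_def[symmetric] v0_def[symmetric]
    using seminorm_filter_neq_bot w by (rule tendsto_Lim)
  with P.gram_equivalent_nets[OF approximatesD(2,1)[OF u0] approximatesD(1)[OF u] approximatesD(2,1)[OF v0]
      approximatesD(1)[OF v] approximates_equivalent[OF u0 u] approximates_equivalent[OF v0 v] w]
  show ?thesis by simp
qed

lemma gram_limit_eqI:
  assumes "approximates u f" "approximates v g" "((\<lambda>q. gP (u q) (v q)) \<longlongrightarrow> w) seminorm_filter"
  shows "gram_limit f g = w"
  by (rule tendsto_unique[OF seminorm_filter_neq_bot tendsto_gram_limit[OF assms(1,2)] assms(3)])

lemma gram_limit_P: "f \<in> P \<Longrightarrow> g \<in> P \<Longrightarrow> gram_limit f g = gP f g"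
  by (rule gram_limit_eqI[OF approximates_const approximates_const tendsto_const])

lemma P_carrier: "P \<subseteq> carrier"
  using approximates_const approximates_carrier by blast

lemma vnorm_limit:
  assumes u: "approximates u f" and p: "p \<in> cont_incr_seminorms"
  shows "((\<lambda>q. vnorm gP p (u q)) \<longlongrightarrow> vnorm gram_limit p f) seminorm_filter"
  unfolding vnorm_def by (intro tendsto_real_sqrt cis_tendsto p tendsto_gram_limit u)

lemma gram_limit_add_right:
  assumes "f \<in> carrier" "g \<in> carrier" "h \<in> carrier"
  shows "gram_limit f (g + h) = gram_limit f g + gram_limit f h"
proof -
  obtain u v w where u: "approximates u f" and v: "approximates v g" and w: "approximates w h"
    using assms by (auto simp: carrier_def)
  have "((\<lambda>q. gP (u q) (v q) + gP (u q) (w q)) \<longlongrightarrow> gram_limit f g + gram_limit f h) seminorm_filter"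
    by (intro tendsto_add tendsto_gram_limit u v w)
  then show ?thesis
    by (intro gram_limit_eqI[OF u approximates_add[OF v w]])
      (simp add: P.gram_add_right approximatesD(1)[OF u] approximatesD(1)[OF v] approximatesD(1)[OF w])
qed

lemma gram_limit_add_left:
  assumes "f \<in> carrier" "g \<in> carrier" "h \<in> carrier"
  shows "gram_limit (f + g) h = gram_limit f h + gram_limit g h"
proof -
  obtain u v w where u: "approximates u f" and v: "approximates v g" and w: "approximates w h"
    using assms by (auto simp: carrier_def)
  have "((\<lambda>q. gP (u q) (w q) + gP (v q) (w q)) \<longlongrightarrow> gram_limit f h + gram_limit g h) seminorm_filter"
    by (intro tendsto_add tendsto_gram_limit u v w)
  then show ?thesis
    by (intro gram_limit_eqI[OF approximates_add[OF u v] w])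
      (simp add: P.gram_add_left approximatesD(1)[OF u] approximatesD(1)[OF v] approximatesD(1)[OF w])
qed

lemma gram_limit_scaleC_right:
  assumes "f \<in> carrier" "g \<in> carrier"
  shows "gram_limit f (c *\<^sub>C g) = c *\<^sub>C gram_limit f g"
proof -
  obtain u v where u: "approximates u f" and v: "approximates v g"
    using assms by (auto simp: carrier_def)
  have "((\<lambda>q. c *\<^sub>C gP (u q) (v q)) \<longlongrightarrow> c *\<^sub>C gram_limit f g) seminorm_filter"
    by (intro tendsto_scaleC tendsto_const tendsto_gram_limit u v)
  then show ?thesis
    by (intro gram_limit_eqI[OF u approximates_scaleC[OF v]])
      (simp add: P.gram_scaleC_right approximatesD(1)[OF u] approximatesD(1)[OF v])
qed

lemma gram_limit_scaleC_left:
  assumes "f \<in> carrier" "g \<in> carrier"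
  shows "gram_limit (c *\<^sub>C f) g = cnj c *\<^sub>C gram_limit f g"
proof -
  obtain u v where u: "approximates u f" and v: "approximates v g"
    using assms by (auto simp: carrier_def)
  have "((\<lambda>q. cnj c *\<^sub>C gP (u q) (v q)) \<longlongrightarrow> cnj c *\<^sub>C gram_limit f g) seminorm_filter"
    by (intro tendsto_scaleC tendsto_const tendsto_gram_limit u v)
  then show ?thesis
    by (intro gram_limit_eqI[OF approximates_scaleC[OF u] v])
      (simp add: P.gram_scaleC_left approximatesD(1)[OF u] approximatesD(1)[OF v])
qed

lemma gram_limit_nonneg:
  assumes "f \<in> carrier" shows "0 \<le> gram_limit f f"
proof -
  obtain u where u: "approximates u f" using assms by (auto simp: carrier_def)
  show ?thesis
    using tendsto_gram_limit[OF u u] P.gram_nonneg[OF approximatesD(1)[OF u]]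
    by (intro nonneg_limit[OF seminorm_filter_neq_bot always_eventually]) auto
qed

lemma carrier_subspace: "csubspace carrier"
proof (rule complex_vector.subspaceI)
  show "0 \<in> carrier" using P.zero_mem P_carrier by blast
  show "f + g \<in> carrier" if "f \<in> carrier" "g \<in> carrier" for f g
    using that by (elim carrier_approximates) (rule approximates_carrier[OF approximates_add])
  show "c *\<^sub>C f \<in> carrier" if "f \<in> carrier" for c f
    using that by (elim carrier_approximates) (rule approximates_carrier[OF approximates_scaleC])
qed

text \<open>The involution of \<open>Z\<close> need not be continuous, so the symmetry of the limit gramian does not
  follow from that of \<open>gP\<close>; it follows from the positivity, which the closed cone preserves.\<close>

lemma gram_limit_star:
  assumes f: "f \<in> carrier" and g: "g \<in> carrier"
  shows "gram_limit f g = star (gram_limit g f)"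
proof (rule selfadjoint_imp_hermitian)
  note mem = complex_vector.subspace_add[OF carrier_subspace] complex_vector.subspace_scale[OF carrier_subspace]
  have sa: "star (gram_limit h h) = gram_limit h h" if "h \<in> carrier" for h
    using that gram_limit_nonneg nonneg_selfadjoint by blast
  have "gram_limit f g + gram_limit g f = gram_limit (f + g) (f + g) - gram_limit f f - gram_limit g g"
    using f g by (simp add: gram_limit_add_left gram_limit_add_right mem)
  moreover have ds: "star (x - y) = star x - star y" for x y :: 'z
    using star_add[of "x - y" y] by simp
  ultimately show "star (gram_limit f g + gram_limit g f) = gram_limit f g + gram_limit g f"
    using f g by (simp add: sa mem)
  have "\<i> *\<^sub>C gram_limit f g - \<i> *\<^sub>C gram_limit g f
      = gram_limit (f + \<i> *\<^sub>C g) (f + \<i> *\<^sub>C g) - gram_limit f f - gram_limit g g"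
    using f g by (simp add: gram_limit_add_left gram_limit_add_right gram_limit_scaleC_left gram_limit_scaleC_right mem
        scaleC_add_right complex_vector.scale_right_diff_distrib)
  then show "star (\<i> *\<^sub>C gram_limit f g - \<i> *\<^sub>C gram_limit g f) = \<i> *\<^sub>C gram_limit f g - \<i> *\<^sub>C gram_limit g f"
    using f g by (simp add: sa mem ds)
qed

lemma carrier_eval_bounded:
  assumes p: "p \<in> cont_incr_seminorms"
  shows "\<exists>q\<in>cont_incr_seminorms. \<exists>c\<ge>0. \<forall>f\<in>carrier. vnorm gH p (f x) \<le> c * vnorm gram_limit q f"
proof -
  obtain q c where q: "q \<in> cont_incr_seminorms" and c: "0 \<le> c"
    and qc: "\<And>f. f \<in> P \<Longrightarrow> vnorm gH p (f x) \<le> c * vnorm gP q f"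
    using P_eval[OF p, of x] by (elim bexE exE conjE) (rule that; blast)
  have "vnorm gH p (f x) \<le> c * vnorm gram_limit q f" if f: "f \<in> carrier" for f
  proof -
    obtain u where u: "approximates u f" using f by (auto simp: carrier_def)
    show ?thesis
    proof (rule tendsto_le[OF seminorm_filter_neq_bot])
      show "((\<lambda>r. c * vnorm gP q (u r)) \<longlongrightarrow> c * vnorm gram_limit q f) seminorm_filter"
        by (intro tendsto_intros vnorm_limit u q)
      show "((\<lambda>r. vnorm gH p (u r x)) \<longlongrightarrow> vnorm gH p (f x)) seminorm_filter"
        by (intro H.tendsto_vnorm approximatesD(3)[OF u] UNIV_I p)
      show "\<forall>\<^sub>F r in seminorm_filter. vnorm gH p (u r x) \<le> c * vnorm gP q (u r)"
        by (intro always_eventually allI qc approximatesD(1)[OF u])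
    qed
  qed
  with q c show ?thesis by blast
qed

lemma carrier_VE_space: "VE_space carrier gram_limit"
proof
  show "csubspace carrier" by (rule carrier_subspace)
  fix f assume f: "f \<in> carrier"
  show "0 \<le> gram_limit f f" using f by (rule gram_limit_nonneg)
  show "gram_limit f f = 0 \<longleftrightarrow> f = 0"
  proof
    assume 0: "gram_limit f f = 0"
    have "f x = 0" for x
    proof (rule H.vnorm_eq_zero)
      fix p :: "'z \<Rightarrow> real" assume p: "p \<in> cont_incr_seminorms"
      obtain q c where q: "q \<in> cont_incr_seminorms" and qc: "vnorm gH p (f x) \<le> c * vnorm gram_limit q f"
        using carrier_eval_bounded[OF p, of x] f by blast
      then show "vnorm gH p (f x) = 0"
        using H.vnorm_nonneg[OF p, of "f x"] 0 by (simp add: vnorm_def[of gram_limit] cis_zero)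
    qed simp
    then show "f = 0" by auto
  qed (use gram_limit_P[OF P.zero_mem P.zero_mem] P.gram_zero_left[OF P.zero_mem] in simp)
qed (fact gram_limit_add_right gram_limit_scaleC_right gram_limit_star)+

sublocale C: VE_admissible carrier gram_limit
  by (intro VE_admissible.intro carrier_VE_space)

lemma vnorm_P: "f \<in> P \<Longrightarrow> vnorm gram_limit p f = vnorm gP p f"
  by (simp add: vnorm_def gram_limit_P)

text \<open>For \<open>a\<close> in \<open>P\<close> close to the tail of the net, passing to the limit bounds the distance of \<open>f\<close> to
  \<open>a\<close>, hence that of \<open>f\<close> to the tail.\<close>

lemma approximates_tendsto:
  assumes u: "approximates u f"
  shows "ve_tendsto gram_limit u f seminorm_filter"
  unfolding C.ve_tendsto_iff
proof (intro ballI allI impI)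
  fix p :: "'z \<Rightarrow> real" and e :: real assume p: "p \<in> cont_incr_seminorms" and e: "0 < e"
  have f: "f \<in> carrier" using u by (rule approximates_carrier)
  have uC: "u q \<in> carrier" for q using approximatesD(1)[OF u] P_carrier by blast
  obtain a where a: "a \<in> P" "\<forall>\<^sub>F q in seminorm_filter. vnorm gP p (u q - a) < e / 2"
    using approximatesD(2)[OF u, unfolded ve_cauchy_def, rule_format, OF p half_gt_zero[OF e]] by (elim bexE)
  have aC: "a \<in> carrier" using a P_carrier by blast
  have "vnorm gram_limit p (f - a) \<le> e / 2"
    using vnorm_limit[OF approximates_diff[OF u approximates_const[OF a(1)]] p]
  proof (rule tendsto_upperbound)
    show "\<forall>\<^sub>F q in seminorm_filter. vnorm gP p (u q - a) \<le> e / 2"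
      using a(2) by (rule eventually_mono) simp
  qed (rule seminorm_filter_neq_bot)
  moreover have "vnorm gram_limit p (u q - a) = vnorm gP p (u q - a)" for q
    by (intro vnorm_P P.diff_mem approximatesD(1)[OF u] a)
  ultimately have le: "vnorm gram_limit p (u q - f) \<le> vnorm gP p (u q - a) + e / 2" for q
    using C.vnorm_triangle[OF p uC aC f, of q] C.vnorm_minus_commute[OF p aC f] by simp
  from a(2) show "\<forall>\<^sub>F q in seminorm_filter. vnorm gram_limit p (u q - f) < e"
  proof eventually_elim
    case (elim q)
    then show ?case using le[of q] by linarith
  qed
qed

lemma carrier_dense: "ve_topology carrier gram_limit closure_of P = carrier"
proof
  show "ve_topology carrier gram_limit closure_of P \<subseteq> carrier"
    using closure_of_subset_topspace[of "ve_topology carrier gram_limit" P] by (simp add: C.topspace_ve_topology)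
  show "carrier \<subseteq> ve_topology carrier gram_limit closure_of P"
  proof
    fix f assume f: "f \<in> carrier"
    obtain u where u: "approximates u f" using f by (auto simp: carrier_def)
    show "f \<in> ve_topology carrier gram_limit closure_of P"
      unfolding C.in_closure_ve_topology[OF P_carrier]
    proof (intro conjI ballI allI impI f)
      fix p :: "'z \<Rightarrow> real" and e :: real assume p: "p \<in> cont_incr_seminorms" and e: "0 < e"
      have "\<forall>\<^sub>F q in seminorm_filter. vnorm gram_limit p (u q - f) < e"
        using approximates_tendsto[OF u, unfolded C.ve_tendsto_iff] p e by blast
      from eventually_happens'[OF seminorm_filter_neq_bot this]
      show "\<exists>d\<in>P. vnorm gram_limit p (d - f) < e" using approximatesD(1)[OF u] by blast
    qed
  qed
qed

lemma eval_net_cauchy: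
  assumes u: "\<And>q. u q \<in> P" and c: "ve_cauchy P gP u F"
  shows "ve_cauchy UNIV gH (\<lambda>q. u q x) F"
  unfolding ve_cauchy_def
proof (intro ballI allI impI)
  fix p :: "'z \<Rightarrow> real" and e :: real assume p: "p \<in> cont_incr_seminorms" and e: "0 < e"
  obtain r d where r: "r \<in> cont_incr_seminorms" and d: "0 \<le> d"
    and rd: "\<And>f. f \<in> P \<Longrightarrow> vnorm gH p (f x) \<le> d * vnorm gP r f"
    using P_eval[OF p, of x] by (elim bexE exE conjE) (rule that; blast)
  have "0 < e / (d + 1)" using d e by simp
  from c[unfolded ve_cauchy_def, rule_format, OF r this]
  obtain a where a: "a \<in> P" "\<forall>\<^sub>F q in F. vnorm gP r (u q - a) < e / (d + 1)" by (elim bexE)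
  from a(2) have "\<forall>\<^sub>F q in F. vnorm gH p (u q x - a x) < e"
  proof eventually_elim
    case (elim q)
    have "vnorm gH p (u q x - a x) \<le> d * vnorm gP r (u q - a)"
      using rd[OF P.diff_mem[OF u a(1)], of q] by simp
    also have "\<dots> \<le> (d + 1) * vnorm gP r (u q - a)"
      using P.vnorm_nonneg[OF r] by (intro mult_right_mono) auto
    also have "\<dots> < e" using elim d by (simp add: field_simps)
    finally show ?case .
  qed
  then show "\<exists>a\<in>UNIV. \<forall>\<^sub>F q in F. vnorm gH p (u q x - a) < e" by blast
qed

lemma carrier_VH_space: "VH_space carrier gram_limit"
proof (rule C.VH_spaceI[OF P_carrier])
  show "carrier \<subseteq> ve_topology carrier gram_limit closure_of P" by (simp add: carrier_dense)
  fix u :: "('z \<Rightarrow> real) \<Rightarrow> 'x \<Rightarrow> 'h"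
  assume u: "\<And>q. u q \<in> P" and c: "ve_cauchy carrier gram_limit u seminorm_filter"
  have cP: "ve_cauchy P gP u seminorm_filter"
    unfolding ve_cauchy_def
  proof (intro ballI allI impI)
    fix p :: "'z \<Rightarrow> real" and e :: real assume p: "p \<in> cont_incr_seminorms" and e: "0 < e"
    obtain a where a: "a \<in> P" "\<forall>\<^sub>F q in seminorm_filter. vnorm gram_limit p (u q - a) < e"
      using ve_cauchy_center[OF C.VE_admissible_axioms seminorm_filter_neq_bot u P_carrier c p e] by (elim bexE)
    have "vnorm gram_limit p (u q - a) = vnorm gP p (u q - a)" for q
      by (intro vnorm_P P.diff_mem u a)
    with a show "\<exists>a\<in>P. \<forall>\<^sub>F q in seminorm_filter. vnorm gP p (u q - a) < e" by (intro bexI[of _ a]) simp_all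
  qed
  have "\<exists>l. ve_tendsto gH (\<lambda>q. u q x) l seminorm_filter" for x
    by (rule H.cauchy_net_converges[OF seminorm_filter_neq_bot UNIV_I eval_net_cauchy[OF u cP]])
      (rule exI)
  then obtain f where "\<And>x. ve_tendsto gH (\<lambda>q. u q x) (f x) seminorm_filter" by metis
  then have "approximates u f" using u cP by (simp add: approximates_def)
  then show "\<exists>l\<in>carrier. ve_tendsto gram_limit u l seminorm_filter"
    using approximates_carrier approximates_tendsto by (intro bexI[of _ f])
qed

lemma carrier_rk_space: "rk_space gH k carrier gram_limit"
proof (intro rk_space.intro rk_space_axioms.intro VH_kernel_axioms carrier_VH_space)
  show "kernel_section k x h \<in> carrier" for x h using section_in_P P_carrier by blast
  show "gH (f x) h = gram_limit f (kernel_section k x h)" if f: "f \<in> carrier" for f x h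
  proof -
    obtain u where u: "approximates u f" using f by (auto simp: carrier_def)
    from gram_limit_eqI[OF u approximates_const[OF section_in_P] approximates_gram_section[OF u]]
    show ?thesis by simp
  qed
  fix x
  have lin: "linear_op carrier UNIV (\<lambda>f. f x)" by (simp add: linear_op_def scaleC_fun_def)
  show "continuous_map (ve_topology carrier gram_limit) (ve_topology UNIV gH) (\<lambda>f. f x)"
    unfolding continuous_map_iff_bounded[OF C.VE_admissible_axioms H_admissible lin]
    using carrier_eval_bounded by blast
qed

end

section \<open>From a positive semidefinite kernel to its minimal reproducing kernel space\<close>

context VH_kernel
begin

lemma sum_fun_apply: "(\<Sum>i\<in>I. F i) z = (\<Sum>i\<in>I. F i z :: 'h)" for F :: "'i \<Rightarrow> 'x \<Rightarrow> 'h"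
  by (rule linear_op_sum[of UNIV UNIV "\<lambda>f. f z"]) (simp_all add: linear_op_def scaleC_fun_def)

lemma sum_sections_apply: "(\<Sum>i\<in>I. kernel_section k (x i) (h i)) z = (\<Sum>i\<in>I. k z (x i) (h i))"
  unfolding sum_fun_apply by (simp add: kernel_section_def)

text \<open>Two points \<open>x\<close>, \<open>y\<close> with vectors \<open>h\<close>, \<open>g\<close> give a selfadjoint sum of mixed terms, and replacing \<open>g\<close> by
  \<open>\<i> g\<close> gives a second one; together they force symmetry.\<close>

lemma psd_kernel_hermitian:
  assumes psd: "psd_kernel gH k"
  shows "gH (k y x h) g = gH h (k x y g)"
proof -
  have sa: "star (\<Sum>i<n. \<Sum>j<n. gH (k (u i) (u j) (v j)) (v i)) = (\<Sum>i<n. \<Sum>j<n. gH (k (u i) (u j) (v j)) (v i))"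
    for n :: nat and u v
    using psd nonneg_selfadjoint unfolding psd_kernel_def by blast
  have diag: "star (gH (k u u v) v) = gH (k u u v) v" for u v
    using sa[of "\<lambda>_. u" "\<lambda>_. v" 1] by simp
  have pair: "star (gH (k y x h) g + gH (k x y g) h) = gH (k y x h) g + gH (k x y g) h" for g
    using sa[of "\<lambda>i. if i = 0 then x else y" "\<lambda>i. if i = 0 then h else g" 2]
    by (simp add: numeral_2_eq_2 star_add diag algebra_simps)
  have "gH (k y x h) (\<i> *\<^sub>C g) + gH (k x y (\<i> *\<^sub>C g)) h = \<i> *\<^sub>C gH (k y x h) g - \<i> *\<^sub>C gH (k x y g) h"
    by (simp add: linear_op_scaleC[OF kernel_linear] H.gram_simps)
  with pair[of "\<i> *\<^sub>C g"]
  have "star (\<i> *\<^sub>C gH (k y x h) g - \<i> *\<^sub>C gH (k x y g) h) = \<i> *\<^sub>C gH (k y x h) g - \<i> *\<^sub>C gH (k x y g) h"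
    by simp
  with pair have "gH (k y x h) g = star (gH (k x y g) h)" by (rule selfadjoint_imp_hermitian)
  also have "\<dots> = gH h (k x y g)" by (rule H.gram_star[symmetric]) simp_all
  finally show ?thesis .
qed

text \<open>\<open>[f, \<Sum> k\<^bsub>x\<^sub>i\<^esub> h\<^sub>i] = \<Sum> [f(x\<^sub>i), h\<^sub>i]\<close>, for an arbitrary representation of the second argument.\<close>

definition section_gram :: "('x \<Rightarrow> 'h) \<Rightarrow> ('x \<Rightarrow> 'h) \<Rightarrow> 'z" where
  "section_gram f g = (SOME w. \<exists>(n::nat) x h. g = (\<Sum>i<n. kernel_section k (x i) (h i)) \<and>
     w = (\<Sum>i<n. gH (f (x i)) (h i)))"

context
  assumes psd: "psd_kernel gH k"
begin

text \<open>The right-hand side involves only the values of \<open>g\<close>, so the left-hand side does not depend on the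
  representation of \<open>g\<close>.\<close>

lemma section_gram_independent:
  fixes m n :: nat
  assumes f: "f = (\<Sum>j<m. kernel_section k (y j) (v j))" and g: "g = (\<Sum>i<n. kernel_section k (x i) (h i))"
  shows "(\<Sum>i<n. gH (f (x i)) (h i)) = (\<Sum>j<m. gH (v j) (g (y j)))"
proof -
  have "(\<Sum>i<n. gH (f (x i)) (h i)) = (\<Sum>i<n. \<Sum>j<m. gH (k (x i) (y j) (v j)) (h i))"
    unfolding f sum_sections_apply by (simp add: H.gram_sum_left)
  also have "\<dots> = (\<Sum>j<m. \<Sum>i<n. gH (k (x i) (y j) (v j)) (h i))" by (rule sum.swap)
  also have "\<dots> = (\<Sum>j<m. \<Sum>i<n. gH (v j) (k (y j) (x i) (h i)))"
    by (simp only: psd_kernel_hermitian[OF psd])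
  also have "\<dots> = (\<Sum>j<m. gH (v j) (g (y j)))"
    unfolding g sum_sections_apply by (simp add: H.gram_sum_right)
  finally show ?thesis .
qed

lemma section_gram_right:
  fixes m :: nat
  assumes f: "f = (\<Sum>j<m. kernel_section k (y j) (v j))" and g: "g \<in> cspan sections"
  shows "section_gram f g = (\<Sum>j<m. gH (v j) (g (y j)))"
proof -
  let ?R = "\<lambda>w. \<exists>(n::nat) x h. g = (\<Sum>i<n. kernel_section k (x i) (h i)) \<and> w = (\<Sum>i<n. gH (f (x i)) (h i))"
  obtain n :: nat and x h where "g = (\<Sum>i<n. kernel_section k (x i) (h i))" by (rule span_sections[OF g])
  then have "?R (\<Sum>i<n. gH (f (x i)) (h i))" by blast
  then have "?R (section_gram f g)" unfolding section_gram_def by (rule someI)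
  then obtain n :: nat and x h where "g = (\<Sum>i<n. kernel_section k (x i) (h i))"
    "section_gram f g = (\<Sum>i<n. gH (f (x i)) (h i))" by blast
  with section_gram_independent[OF f this(1)] show ?thesis by simp
qed

lemma section_gram_left:
  fixes n :: nat
  assumes f: "f \<in> cspan sections" and g: "g = (\<Sum>i<n. kernel_section k (x i) (h i))"
  shows "section_gram f g = (\<Sum>i<n. gH (f (x i)) (h i))"
proof -
  obtain m :: nat and y v where fr: "f = (\<Sum>j<m. kernel_section k (y j) (v j))" by (rule span_sections[OF f])
  have "g \<in> cspan sections"
    unfolding g by (rule complex_vector.span_sum, rule complex_vector.span_base, blast)
  from section_gram_right[OF fr this] section_gram_independent[OF fr g] show ?thesis by simp
qed

lemma section_gram_section: "f \<in> cspan sections \<Longrightarrow> section_gram f (kernel_section k x h) = gH (f x) h"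
  using section_gram_left[where n = 1 and x = "\<lambda>_. x" and h = "\<lambda>_. h" and f = f] by simp

lemma section_gram_diagonal:
  fixes n :: nat
  assumes f: "f = (\<Sum>i<n. kernel_section k (x i) (h i))"
  shows "section_gram f f = (\<Sum>i<n. \<Sum>j<n. gH (k (x i) (x j) (h j)) (h i))"
proof -
  have "f \<in> cspan sections"
    unfolding f by (rule complex_vector.span_sum, rule complex_vector.span_base, blast)
  then have "section_gram f f = (\<Sum>i<n. gH (f (x i)) (h i))" using f by (rule section_gram_left)
  also have "\<dots> = (\<Sum>i<n. \<Sum>j<n. gH (k (x i) (x j) (h j)) (h i))"
    unfolding f sum_sections_apply by (simp add: H.gram_sum_left)
  finally show ?thesis .
qed

lemma section_eval_bounded:
  assumes b2: "cond_b2 gH k" and p: "p \<in> cont_incr_seminorms"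
  shows "\<exists>q\<in>cont_incr_seminorms. \<exists>c\<ge>0. \<forall>f\<in>cspan sections. vnorm gH p (f x) \<le> c * vnorm section_gram q f"
proof -
  obtain q c where q: "q \<in> cont_incr_seminorms" and c: "0 \<le> c"
    and qc: "\<forall>(n::nat) y h. p (\<Sum>i<n. \<Sum>j<n. gH (k x (y i) (h i)) (k x (y j) (h j)))
        \<le> c * q (\<Sum>i<n. \<Sum>j<n. gH (k (y j) (y i) (h i)) (h j))"
    using b2[unfolded cond_b2_def, rule_format, OF p, of x] by (elim bexE exE conjE) (rule that)
  have "vnorm gH p (f x) \<le> sqrt c * vnorm section_gram q f" if f: "f \<in> cspan sections" for f
  proof -
    obtain n :: nat and y h where f: "f = (\<Sum>i<n. kernel_section k (y i) (h i))"
      using f by (rule span_sections)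
    have "gH (f x) (f x) = (\<Sum>i<n. \<Sum>j<n. gH (k x (y i) (h i)) (k x (y j) (h j)))"
      unfolding f sum_sections_apply by (rule H.gram_sum_sum) simp
    moreover have "section_gram f f = (\<Sum>i<n. \<Sum>j<n. gH (k (y j) (y i) (h i)) (h j))"
      unfolding section_gram_diagonal[OF f] by (rule sum.swap)
    ultimately have "p (gH (f x) (f x)) \<le> c * q (section_gram f f)"
      using spec[OF spec[OF spec[OF qc, of n], of y], of h] by simp
    then show ?thesis unfolding vnorm_def by (metis real_sqrt_le_mono real_sqrt_mult)
  qed
  moreover have "0 \<le> sqrt c" using c by simp
  ultimately show ?thesis using q by blast
qed

text \<open>Definiteness comes from the bound on evaluations: a vector with gramian \<open>0\<close> vanishes at every point.\<close>

lemma section_VE_space: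
  assumes b2: "cond_b2 gH k"
  shows "VE_space (cspan sections) section_gram"
proof
  show "csubspace (cspan sections)" by (rule complex_vector.subspace_span)
  fix f g assume f: "f \<in> cspan sections" and g: "g \<in> cspan sections"
  obtain n :: nat and x h where fr: "f = (\<Sum>i<n. kernel_section k (x i) (h i))" by (rule span_sections[OF f])
  show "section_gram f (g + g') = section_gram f g + section_gram f g'" if g': "g' \<in> cspan sections" for g'
    using section_gram_right[OF fr] g g' complex_vector.span_add[OF g g']
    by (simp add: H.gram_add_right sum.distrib)
  show "section_gram f (c *\<^sub>C g) = c *\<^sub>C section_gram f g" for c
    using section_gram_right[OF fr] g complex_vector.span_scale[OF g]
    by (simp add: scaleC_fun_def H.gram_scaleC_right complex_vector.scale_sum_right)
  have "star (section_gram g f) = (\<Sum>i<n. star (gH (g (x i)) (h i)))"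
    unfolding section_gram_left[OF g fr] by (induction n) (simp_all add: star_zero star_add)
  also have "\<dots> = section_gram f g"
    unfolding section_gram_right[OF fr g] by (intro sum.cong refl H.gram_star[symmetric]) simp_all
  finally show "section_gram f g = star (section_gram g f)" ..
next
  fix f assume f: "f \<in> cspan sections"
  obtain n :: nat and x h where fr: "f = (\<Sum>i<n. kernel_section k (x i) (h i))" by (rule span_sections[OF f])
  show "0 \<le> section_gram f f"
    unfolding section_gram_diagonal[OF fr] using psd unfolding psd_kernel_def by blast
  show "section_gram f f = 0 \<longleftrightarrow> f = 0"
  proof
    assume 0: "section_gram f f = 0"
    have "f y = 0" for y
    proof (rule H.vnorm_eq_zero)
      fix p :: "'z \<Rightarrow> real" assume p: "p \<in> cont_incr_seminorms"
      obtain q c where q: "q \<in> cont_incr_seminorms" and qc: "vnorm gH p (f y) \<le> c * vnorm section_gram q f"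
        using section_eval_bounded[OF b2 p, of y] f by blast
      then show "vnorm gH p (f y) = 0"
        using H.vnorm_nonneg[OF p, of "f y"] 0 by (simp add: vnorm_def[of section_gram] cis_zero)
    qed simp
    then show "f = 0" by auto
  next
    assume "f = 0"
    then show "section_gram f f = 0"
      using section_gram_right[OF fr f] by (simp add: H.gram_zero_right)
  qed
qed

lemma section_pre_rk_space:
  assumes b2: "cond_b2 gH k"
  shows "pre_rk_space gH k (cspan sections) section_gram"
  by (intro pre_rk_space.intro pre_rk_space_axioms.intro VH_kernel_axioms VE_admissible.intro
      section_VE_space[OF b2] refl section_gram_section section_eval_bounded[OF b2])

end

lemma minimal_rk_pair_exists:
  assumes "is_action act" "psd_kernel gH k" "invariant_kernel act k" "cond_b1 act gH k" "cond_b2 gH k"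
  shows "\<exists>R gR \<rho>. minimal_invariant_rk_pair act gH k R gR \<rho>"
proof -
  interpret pre: pre_rk_space gH k "cspan sections" section_gram
    by (rule section_pre_rk_space[OF assms(2,5)])
  interpret rk: rk_space gH k pre.carrier pre.gram_limit by (rule pre.carrier_rk_space)
  show ?thesis
    using rk.translation_minimal_rk_pair[OF assms(1,3,4) pre.carrier_dense] by blast
qed

lemma rk_pair_imp_rk_space: "invariant_rk_pair act gH k R gR \<rho> \<Longrightarrow> rk_space gH k R gR"
  by (simp add: invariant_rk_pair_def rk_space_iff)

lemma minimal_rk_pair_least:
  assumes m: "minimal_invariant_rk_pair act gH k R gR \<rho>" and i: "invariant_rk_pair act gH k R' gR' \<rho>'"
  shows "R \<subseteq> R'" "\<And>f g. f \<in> R \<Longrightarrow> g \<in> R \<Longrightarrow> gR f g = gR' f g"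
proof -
  interpret two_rk_spaces gH k R gR R' gR'
    using m i by (intro two_rk_spaces.intro rk_pair_imp_rk_space) (auto simp: minimal_invariant_rk_pair_def)
  have dense: "ve_topology R gR closure_of cspan sections = R"
    using m by (simp add: minimal_invariant_rk_pair_def)
  show "R \<subseteq> R'" by (rule minimal_subset[OF dense])
  show "gR f g = gR' f g" if "f \<in> R" "g \<in> R" for f g using that by (rule minimal_gram[OF dense])
qed

end

theorem theorem2p10:
  fixes act :: "'g::star_semigroup \<Rightarrow> 'x \<Rightarrow> 'x"
    and gH :: "'h::complex_vector \<Rightarrow> 'h \<Rightarrow> 'z::admissible_space"
    and k :: "'x \<Rightarrow> 'x \<Rightarrow> 'h \<Rightarrow> 'h"
  assumes action: "is_action act"
    and H: "VH_space UNIV gH"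
    and k: "\<And>x y. k x y \<in> cont_adjointable_ops UNIV gH UNIV gH"
  defines "assertion1 \<equiv>
      psd_kernel gH k \<and> invariant_kernel act k \<and> cond_b1 act gH k \<and> cond_b2 gH k"
    and "assertion2 \<equiv> has_invariant_linearisation TYPE('x \<Rightarrow> 'h) act gH k"
    and "assertion2_any \<equiv> has_invariant_linearisation TYPE('k::complex_vector) act gH k"
    and "assertion3 \<equiv> (\<exists>R gR \<rho>. invariant_rk_pair act gH k R gR \<rho>)"
  shows "(assertion1 \<longleftrightarrow> assertion2) \<and> (assertion2_any \<longrightarrow> assertion1) \<and>
      (assertion1 \<longleftrightarrow> assertion3) \<and>
      (assertion1 \<or> assertion2 \<or> assertion2_any \<or> assertion3 \<longrightarrow>
        (\<exists>(K :: ('x \<Rightarrow> 'h) set) gK \<pi> V. minimal_invariant_linearisation act gH k K gK \<pi> V) \<and>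
        (\<forall>(K :: 'k set) gK \<pi> V (K' :: 'l::complex_vector set) gK' \<pi>' V'.
           minimal_invariant_linearisation act gH k K gK \<pi> V \<and>
           minimal_invariant_linearisation act gH k K' gK' \<pi>' V' \<longrightarrow>
           unitary_equivalent K gK \<pi> V K' gK' \<pi>' V') \<and>
        (\<exists>R gR \<rho>. minimal_invariant_rk_pair act gH k R gR \<rho>) \<and>
        (\<forall>R gR \<rho> R' gR' \<rho>'.
           minimal_invariant_rk_pair act gH k R gR \<rho> \<and> invariant_rk_pair act gH k R' gR' \<rho>' \<longrightarrow>
           R \<subseteq> R' \<and> (\<forall>f\<in>R. \<forall>g\<in>R. gR f g = gR' f g)) \<and>
        (\<forall>R gR \<rho> R' gR' \<rho>'.
           minimal_invariant_rk_pair act gH k R gR \<rho> \<and>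
           minimal_invariant_rk_pair act gH k R' gR' \<rho>' \<longrightarrow>
           R = R' \<and> (\<forall>f\<in>R. \<forall>g\<in>R. gR f g = gR' f g) \<and> (\<forall>\<xi>. \<forall>f\<in>R. \<rho> \<xi> f = \<rho>' \<xi> f)) \<and>
        (\<forall>R gR \<rho> R' gR' \<rho>'.
           invariant_rk_pair act gH k R gR \<rho> \<and> invariant_rk_pair act gH k R' gR' \<rho>' \<longrightarrow>
           (\<forall>\<xi>. \<forall>f\<in>R \<inter> R'. \<rho> \<xi> f = \<rho>' \<xi> f)))"
proof -
  interpret VH_kernel gH k by (intro VH_kernel.intro VH_kernel_axioms.intro H k)
  have min_pair: "\<exists>R gR \<rho>. minimal_invariant_rk_pair act gH k R gR \<rho>" if assertion1
    using that action minimal_rk_pair_exists unfolding assertion1_def by blast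
  have imp_pair: "invariant_rk_pair act gH k R gR \<rho>" if "minimal_invariant_rk_pair act gH k R gR \<rho>" for R gR \<rho>
    using that by (simp add: minimal_invariant_rk_pair_def)
  have "assertion1 \<Longrightarrow> assertion3" using min_pair imp_pair unfolding assertion3_def by blast
  moreover have "assertion3 \<Longrightarrow> assertion2"
    using rk_pair_invariant_linearisation
    unfolding assertion3_def assertion2_def has_invariant_linearisation_def by blast
  moreover have "assertion2 \<Longrightarrow> assertion1"
    using invariant_linearisation_imp_positivity
    unfolding assertion1_def assertion2_def has_invariant_linearisation_def by blast
  moreover have any: "assertion2_any \<Longrightarrow> assertion1"
    using invariant_linearisation_imp_positivity
    unfolding assertion1_def assertion2_any_def has_invariant_linearisation_def by blast
  ultimately have equiv: "assertion1 \<longleftrightarrow> assertion2" "assertion1 \<longleftrightarrow> assertion3" by blast+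
  have min_lin: "\<exists>(K :: ('x \<Rightarrow> 'h) set) gK \<pi> V. minimal_invariant_linearisation act gH k K gK \<pi> V" if A: assertion1
  proof -
    obtain R gR \<rho> where m: "minimal_invariant_rk_pair act gH k R gR \<rho>" using min_pair[OF A] by blast
    have "invariant_linearisation act gH k R gR \<rho> (kernel_section k)"
      by (rule rk_pair_invariant_linearisation[OF imp_pair[OF m]])
    then have "minimal_invariant_linearisation act gH k R gR \<rho> (kernel_section k)"
      using m by (simp add: minimal_invariant_linearisation_def minimal_linearisation_def
          invariant_linearisation_def minimal_invariant_rk_pair_def)
    then show ?thesis by blast
  qed
  have least: "R \<subseteq> R' \<and> (\<forall>f\<in>R. \<forall>g\<in>R. gR f g = gR' f g)"
    if "minimal_invariant_rk_pair act gH k R gR \<rho>" "invariant_rk_pair act gH k R' gR' \<rho>'" for R gR \<rho> R' gR' \<rho>'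
    using minimal_rk_pair_least[OF that] by blast
  have rep: "\<rho> \<xi> f = \<rho>' \<xi> f"
    if "invariant_rk_pair act gH k R gR \<rho>" "invariant_rk_pair act gH k R' gR' \<rho>'" "f \<in> R \<inter> R'"
    for R gR \<rho> R' gR' \<rho>' \<xi> f
    using rk_pair_representation[OF that(1)] rk_pair_representation[OF that(2)] that(3) by simp
  have unique: "R = R' \<and> (\<forall>f\<in>R. \<forall>g\<in>R. gR f g = gR' f g) \<and> (\<forall>\<xi>. \<forall>f\<in>R. \<rho> \<xi> f = \<rho>' \<xi> f)"
    if m: "minimal_invariant_rk_pair act gH k R gR \<rho>" "minimal_invariant_rk_pair act gH k R' gR' \<rho>'"
    for R gR \<rho> R' gR' \<rho>'
  proof -
    have "R = R'" using least[OF m(1) imp_pair[OF m(2)]] least[OF m(2) imp_pair[OF m(1)]] by blast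
    then show ?thesis
      using least[OF m(1) imp_pair[OF m(2)]] rep[OF imp_pair[OF m(1)] imp_pair[OF m(2)]] by simp
  qed
  show ?thesis
  proof (intro conjI impI)
    show "assertion1 \<longleftrightarrow> assertion2" "assertion1 \<longleftrightarrow> assertion3" by (fact equiv)+
    show assertion1 if assertion2_any using that by (rule any)
    assume "assertion1 \<or> assertion2 \<or> assertion2_any \<or> assertion3"
    then have A: assertion1 using equiv any by blast
    show "\<exists>(K :: ('x \<Rightarrow> 'h) set) gK \<pi> V. minimal_invariant_linearisation act gH k K gK \<pi> V"
      by (rule min_lin[OF A])
    show "\<exists>R gR \<rho>. minimal_invariant_rk_pair act gH k R gR \<rho>" by (rule min_pair[OF A])
  qed (intro allI impI ballI, elim conjE,
      rule minimal_linearisations_unitary_equivalent least unique rep; assumption)+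
qed

end
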